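(* Fix a prime $p$ and an integer $s\ge1$. Suppose that for every $b\in\mathbb{Z}_p$, $$\mathscr{F}^{\rm Dw}_b(t)=\varepsilon_b\,((-1)^st)^{l_b}\,\mathscr{F}^{\rm Dw}_b(t^{-1}),$$ where $\varepsilon_b=1$ if $p$ is odd and $\varepsilon_b\in\{\pm1\}$ if $p=2$. Then for every $a\in\mathbb{Z}_p\setminus\mathbb{Z}_{\le0}$ such that $a^{(r)}=a$ for some $r>0$, and every $c\in1+pW$, with $\sigma(t)=ct^p$ and $\widehat\sigma(t)=c^{-1}t^p$, one has $$\mathscr{F}^{(\sigma)}_a(t)=-\widehat{\mathscr{F}}^{\,(\widehat\sigma)}_a(t^{-1})$$ in the ring $W\langle t,t^{-1},h(t)^{-1}\rangle$, where $h(t)=\prod_{i=0}^{r-1}F_{a^{(i)}}(t)_{<p}$ and $\widehat{\mathscr{F}}^{\,(\widehat\sigma)}_a(t^{-1}):=\omega\big(\widehat{\mathscr{F}}^{\,(\widehat\sigma)}_a(t)\big)$.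
   Context: $W=W(\overline{\mathbb{F}}_p)$. $(\alpha)_k=\alpha(\alpha+1)\cdots(\alpha+k-1)$, $(\alpha)_0=1$; for $b\in\mathbb{Z}_p$, $F_b(t)=\sum_{k\ge0}\left(\frac{(b)_k}{k!}\right)^st^k$. Dwork prime: $b'=(b+l_b)/p$ with $l_b\in\{0,\dots,p-1\}$, $b+l_b\equiv0\pmod p$; $b^{(0)}=b$, $b^{(i)}=(b^{(i-1)})'$. $f(t)_{<m}$ is the truncation $\sum_{i<m}a_it^i$ of $f=\sum a_it^i$. Dwork's function: $\mathscr{F}^{\rm Dw}_b(t)=F_b(t)/F_{b'}(t^p)$; since $\mathscr{F}^{\rm Dw}_b(t)\equiv F_b(t)_{<p^n}/F_{b'}(t^p)_{<p^n}\pmod{p^n}$, $\mathscr{F}^{\rm Dw}_b(t^{-1})$ denotes the $p$-adic limit of these rational functions with $t$ replaced by $t^{-1}$. For $u\in W$, $\alpha\in\mathbb{Z}_p$: $(1+pu)^\alpha=\sum_i\binom{\alpha}{i}p^iu^i$. Write $F_a(t)=\sum A_kt^k$, $F_{a'}(t)=\sum A^{(1)}_kt^k$ with $A^{(1)}_{m/p}=0$ if $m<0$ or $p\nmid m$; $l=l_a$; $q=4$ if $p=2$, $q=p$ otherwise; $l'\in\{0,\dots,q-1\}$ with $a+l'\equiv0\pmod q$, $e=l'-\lfloor l'/p\rfloor$. The $p$-adic hypergeometric function of logarithmic type is $\mathscr{F}^{(\sigma)}_a(t)=G^{(\sigma)}_a(t)/F_a(t)$ with $G^{(\sigma)}_a(t)=\sum_kB_kt^k$,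 $B_0=s\psi_p(a)+s\gamma_p-p^{-1}\log(c)$ ($\psi_p$ the $p$-adic digamma function and $\gamma_p$ the $p$-adic Euler constant in the sense of Asakura, $\log$ the Iwasawa logarithm) and $B_k=(A_k-c^{k/p}A^{(1)}_{k/p})/k$ for $k>0$. Further $\widehat{\mathscr{F}}^{\,(\widehat\sigma)}_a(t)=\widehat G^{(\widehat\sigma)}_a(t)/F_a(t)$ with $\widehat G^{(\widehat\sigma)}_a(t)=\sum_k\widehat B_kt^k$, $\widehat B_k=\frac{1}{k+a}\big(A_k-(-1)^{se}A^{(1)}_{(k-l)/p}(c^{-1})^{(k+a)/p}\big)$. $W\langle t,t^{-1},h(t)^{-1}\rangle$ is the $p$-adic completion of $W[t,t^{-1},h(t)^{-1}]$; the power series $\mathscr{F}^{(\sigma)}_a(t),\widehat{\mathscr{F}}^{\,(\widehat\sigma)}_a(t)$ are regarded as elements of it (as $p$-adic limits of $G_a(t)_{<p^n}/F_a(t)_{<p^n}$, resp. $\widehat G_a(t)_{<p^n}/F_a(t)_{<p^n}$), and $\omega$ is the continuous $W$-algebra endomorphism of $W\langle t,t^{-1},h(t)^{-1}\rangle$ with $\omega(t)=t^{-1}$. *)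

theory Defs
  imports "HOL-Algebra.Algebraic_Closure_Type"
begin

section \<open>Completions and limits with respect to a principal ideal\<close>

text \<open>A subset \<open>A\<close> of a type of class \<^class>\<open>ring_1\<close> as a ring with the operations of that type;
  it is a ring precisely if \<open>A\<close> is a subring.\<close>

abbreviation ring_on :: "'a::ring_1 set \<Rightarrow> 'a ring" where
  "ring_on A \<equiv> ring_of_type_algebra\<lparr>carrier := A\<rparr>"

text \<open>The inverse limit of the rings \<open>R / x\<^sup>n R\<close>. An element is a sequence of cosets; the \<open>n\<close>-th one is
  the image of the next one iff it contains the next one.\<close>

definition adic_completion :: "'a ring \<Rightarrow> 'a \<Rightarrow> (nat \<Rightarrow> 'a set) ring" where
  "adic_completion R x = (let Q = (\<lambda>n::nat. R Quot (PIdl\<^bsub>R\<^esub> (x [^]\<^bsub>R\<^esub> n))) in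
     \<lparr>carrier = {f. \<forall>n. f n \<in> carrier (Q n) \<and> f (Suc n) \<subseteq> f n},
      monoid.mult = (\<lambda>f g n. f n \<otimes>\<^bsub>Q n\<^esub> g n), one = (\<lambda>n. \<one>\<^bsub>Q n\<^esub>),
      ring.zero = (\<lambda>n. \<zero>\<^bsub>Q n\<^esub>), ring.add = (\<lambda>f g n. f n \<oplus>\<^bsub>Q n\<^esub> g n)\<rparr>)"

definition to_adic_completion :: "'a ring \<Rightarrow> 'a \<Rightarrow> 'a \<Rightarrow> nat \<Rightarrow> 'a set" where
  "to_adic_completion R x r = (\<lambda>n. PIdl\<^bsub>R\<^esub> (x [^]\<^bsub>R\<^esub> n) +>\<^bsub>R\<^esub> r)"

definition adic_lim :: "'a ring \<Rightarrow> 'a \<Rightarrow> 'b filter \<Rightarrow> ('b \<Rightarrow> 'a) \<Rightarrow> 'a" where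
  "adic_lim R x \<F> y = (THE L. L \<in> carrier R \<and>
     (\<forall>n::nat. eventually (\<lambda>m. y m \<ominus>\<^bsub>R\<^esub> L \<in> PIdl\<^bsub>R\<^esub> (x [^]\<^bsub>R\<^esub> n)) \<F>))"


section \<open>The Witt ring and the p-adic integers\<close>

text \<open>\<open>W\<close> is the ring of Witt vectors of an algebraic closure of \<open>\<bbbF>\<^sub>p\<close>, realised inside a field of
  characteristic 0 (such as its fraction field) in which one can divide. For a perfect field \<open>k\<close> of
  characteristic \<open>p\<close>, the Witt ring is the strict \<open>p\<close>-ring with residue ring \<open>k\<close>, unique up to
  unique isomorphism: \<open>p\<close> is not a zero divisor (automatic here), the ring is \<open>p\<close>-adically complete
  and separated, and its quotient by \<open>p\<close> is \<open>k\<close>. The range in the last clause is the prime field.\<close>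

definition witt_ring_Fpbar :: "nat \<Rightarrow> 'K::field_char_0 set \<Rightarrow> bool" where
  "witt_ring_Fpbar p W \<longleftrightarrow>
     cring (ring_on W) \<and>
     bij_betw (to_adic_completion (ring_on W) (of_nat p)) W
       (carrier (adic_completion (ring_on W) (of_nat p))) \<and>
     algebraic_closure (ring_on W Quot (PIdl\<^bsub>ring_on W\<^esub> (of_nat p)))
       (range (\<lambda>m::int. PIdl\<^bsub>ring_on W\<^esub> (of_nat p) +>\<^bsub>ring_on W\<^esub> of_int m))"

text \<open>\<open>\<int>\<^sub>p\<close> is the closure of \<open>\<int>\<close> in \<open>W\<close>.\<close>

definition Zp :: "'K::field_char_0 set \<Rightarrow> nat \<Rightarrow> 'K set" where
  "Zp W p = {x \<in> W. \<forall>n. \<exists>m::int. x - of_int m \<in> PIdl\<^bsub>ring_on W\<^esub> (of_nat (p ^ n))}"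

abbreviation W_lim :: "'K::field_char_0 set \<Rightarrow> nat \<Rightarrow> 'b filter \<Rightarrow> ('b \<Rightarrow> 'K) \<Rightarrow> 'K" where
  "W_lim W p \<equiv> adic_lim (ring_on W) (of_nat p)"

text \<open>The power \<open>c\<^sup>\<alpha>\<close> for \<open>c \<in> 1 + pW\<close>, \<open>\<alpha> \<in> \<int>\<^sub>p\<close>.\<close>

definition padic_power :: "'K::field_char_0 set \<Rightarrow> nat \<Rightarrow> 'K \<Rightarrow> 'K \<Rightarrow> 'K" where
  "padic_power W p c \<alpha> = W_lim W p sequentially (\<lambda>N. \<Sum>i<N. (\<alpha> gchoose i) * (c - 1) ^ i)"

text \<open>The Iwasawa logarithm on \<open>W\<^sup>\<times>\<close>: if \<open>m\<close> is the (finite) order of \<open>x\<close> modulo \<open>p\<close>, then \<open>x\<^sup>m\<close> lies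
  in the disc of convergence of the logarithm series, and \<open>m log(x) = log(x\<^sup>m)\<close>.\<close>

definition iwasawa_log :: "'K::field_char_0 set \<Rightarrow> nat \<Rightarrow> 'K \<Rightarrow> 'K" where
  "iwasawa_log W p x =
     (let m = (LEAST m. 0 < m \<and> x ^ m - 1 \<in> PIdl\<^bsub>ring_on W\<^esub> (of_nat p))
      in W_lim W p sequentially (\<lambda>N. \<Sum>i=1..N. (-1) ^ (i + 1) * (x ^ m - 1) ^ i / of_nat i)
           / of_nat m)"

text \<open>Asakura's \<open>p\<close>-adic Euler constant
  \<open>\<gamma>\<^sub>p = - lim\<^sub>n p\<^sup>-\<^sup>n \<Sum>\<^bsub>0 \<le> j < p^n, p \<nmid> j\<^esub> log j\<close> and \<open>p\<close>-adic digamma function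
  \<open>\<psi>\<^sub>p(z) = - \<gamma>\<^sub>p + lim\<^bsub>m \<rightarrow> z\<^esub> \<Sum>\<^bsub>1 \<le> k < m, p \<nmid> k\<^esub> 1/k\<close>, where \<open>m\<close> runs through positive integers
  tending \<open>p\<close>-adically to \<open>z\<close>.\<close>

definition padic_euler :: "'K::field_char_0 set \<Rightarrow> nat \<Rightarrow> 'K" where
  "padic_euler W p =
     - W_lim W p sequentially
         (\<lambda>n. (\<Sum>j | j < p ^ n \<and> \<not> p dvd j. iwasawa_log W p (of_nat j)) / of_nat (p ^ n))"

definition padic_digamma :: "'K::field_char_0 set \<Rightarrow> nat \<Rightarrow> 'K \<Rightarrow> 'K" where
  "padic_digamma W p z =
     - padic_euler W p
     + W_lim W p
         (INF n. principal {m. 0 < m \<and> z - of_nat m \<in> PIdl\<^bsub>ring_on W\<^esub> (of_nat (p ^ n))})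
         (\<lambda>m. \<Sum>k | k < m \<and> \<not> p dvd k. 1 / of_nat k)"


section \<open>Hypergeometric series\<close>

definition hyp_fps :: "nat \<Rightarrow> 'K::field_char_0 \<Rightarrow> 'K fps" where
  "hyp_fps s b = Abs_fps (\<lambda>k. (pochhammer b k / fact k) ^ s)"

text \<open>The \<open>l \<in> {0,\<dots>,q-1}\<close> with \<open>b + l \<equiv> 0 (mod q)\<close>; for \<open>q = p\<close> this is \<open>l\<^sub>b\<close>.\<close>

definition neg_residue :: "'K::field_char_0 set \<Rightarrow> nat \<Rightarrow> 'K \<Rightarrow> nat" where
  "neg_residue W q b = (THE l. l < q \<and> b + of_nat l \<in> PIdl\<^bsub>ring_on W\<^esub> (of_nat q))"

definition dwork_prime :: "'K::field_char_0 set \<Rightarrow> nat \<Rightarrow> 'K \<Rightarrow> 'K" where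
  "dwork_prime W p b = (b + of_nat (neg_residue W p b)) / of_nat p"

definition hyp_sign_exponent :: "'K::field_char_0 set \<Rightarrow> nat \<Rightarrow> 'K \<Rightarrow> nat" where
  "hyp_sign_exponent W p a =
     (let l' = neg_residue W (if p = 2 then 4 else p) a in l' - l' div p)"

definition hyp_G :: "'K::field_char_0 set \<Rightarrow> nat \<Rightarrow> nat \<Rightarrow> 'K \<Rightarrow> 'K \<Rightarrow> 'K fps" where
  "hyp_G W p s c a =
     (let A = fps_nth (hyp_fps s a); A1 = fps_nth (hyp_fps s (dwork_prime W p a))
      in Abs_fps (\<lambda>k.
        if k = 0 then
          of_nat s * padic_digamma W p a + of_nat s * padic_euler W p - iwasawa_log W p c / of_nat p
        else (A k - (if p dvd k then c ^ (k div p) * A1 (k div p) else 0)) / of_nat k))"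

text \<open>Here \<open>d\<close> is the coefficient in the Frobenius \<open>t \<mapsto> d t\<^sup>p\<close>.\<close>

definition hyp_G_hat :: "'K::field_char_0 set \<Rightarrow> nat \<Rightarrow> nat \<Rightarrow> 'K \<Rightarrow> 'K \<Rightarrow> 'K fps" where
  "hyp_G_hat W p s d a =
     (let A = fps_nth (hyp_fps s a); A1 = fps_nth (hyp_fps s (dwork_prime W p a));
          l = neg_residue W p a; e = hyp_sign_exponent W p a
      in Abs_fps (\<lambda>k.
        (A k - (if l \<le> k \<and> p dvd (k - l)
                then (-1) ^ (s * e) * A1 ((k - l) div p)
                       * padic_power W p d ((of_nat k + a) / of_nat p)
                else 0)) / (of_nat k + a)))"


section \<open>Rational functions and their p-adic limits\<close>

definition rat_t :: "'K::field_char_0 poly fract" where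
  "rat_t = to_fract [:0, 1:]"

definition rat_const :: "'K::field_char_0 \<Rightarrow> 'K poly fract" where
  "rat_const c = to_fract [:c:]"

text \<open>The value of the truncation \<open>f\<^bsub><m\<^esub>\<close> at the rational function \<open>x\<close>.\<close>

definition trunc_at :: "'K::field_char_0 fps \<Rightarrow> nat \<Rightarrow> 'K poly fract \<Rightarrow> 'K poly fract" where
  "trunc_at f m x = (\<Sum>i<m. rat_const (fps_nth f i) * x ^ i)"

text \<open>The localisation of \<open>W[t]\<close> at the prime ideal generated by \<open>p\<close>. Its \<open>p\<close>-adic completion is where
  \<open>p\<close>-adic limits of rational functions are taken for arbitrary \<open>b \<in> \<int>\<^sub>p\<close>; since
  \<open>k[t,t\<inverse>,g\<inverse>] \<subseteq> k(t)\<close> for the residue field \<open>k\<close>, it contains the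
  rings \<open>W\<langle>t,t\<inverse>,g\<inverse>\<rangle>\<close> for all \<open>g \<in> W[t]\<close> that are nonzero modulo \<open>p\<close>.\<close>

definition gauss_ring :: "'K::field_char_0 set \<Rightarrow> nat \<Rightarrow> 'K poly fract set" where
  "gauss_ring W p =
     {to_fract f / to_fract g | f g. (\<forall>i. coeff f i \<in> W) \<and> (\<forall>i. coeff g i \<in> W) \<and>
        (\<exists>i. coeff g i \<notin> PIdl\<^bsub>ring_on W\<^esub> (of_nat p))}"

definition gauss_completion ::
  "'K::field_char_0 set \<Rightarrow> nat \<Rightarrow> (nat \<Rightarrow> 'K poly fract set) ring" where
  "gauss_completion W p = adic_completion (ring_on (gauss_ring W p)) (of_nat p)"

definition to_gauss ::
  "'K::field_char_0 set \<Rightarrow> nat \<Rightarrow> 'K poly fract \<Rightarrow> nat \<Rightarrow> 'K poly fract set" where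
  "to_gauss W p = to_adic_completion (ring_on (gauss_ring W p)) (of_nat p)"

text \<open>Dwork's function as the \<open>p\<close>-adic limit of the rational functions
  \<open>F\<^sub>b(t)\<^bsub><p^n\<^esub> / F\<^bsub>b'\<^esub>(t\<^sup>p)\<^bsub><p^n\<^esub>\<close>, with \<open>x\<close> (either \<open>t\<close> or \<open>t\<inverse>\<close>) substituted for \<open>t\<close> in them.
  The series in the denominator is truncated as a series in \<open>t\<close>.\<close>

definition dwork_fun ::
  "'K::field_char_0 set \<Rightarrow> nat \<Rightarrow> nat \<Rightarrow> 'K \<Rightarrow> 'K poly fract \<Rightarrow> nat \<Rightarrow> 'K poly fract set" where
  "dwork_fun W p s b x =
     adic_lim (gauss_completion W p) (to_gauss W p (of_nat p)) sequentially
       (\<lambda>n. to_gauss W p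
          (trunc_at (hyp_fps s b) (p ^ n) x /
           trunc_at (fps_compose (hyp_fps s (dwork_prime W p b)) (fps_X ^ p)) (p ^ n) x))"


section \<open>The ring of the main statement\<close>

text \<open>\<open>W[t, t\<inverse>, h\<inverse>]\<close> inside the field of rational functions, its \<open>p\<close>-adic completion
  \<open>W\<langle>t, t\<inverse>, h\<inverse>\<rangle>\<close>, and the canonical map.\<close>

definition laurent_loc :: "'K::field_char_0 set \<Rightarrow> 'K poly fract \<Rightarrow> 'K poly fract set" where
  "laurent_loc W h = {to_fract f / (rat_t ^ i * h ^ j) | f i j. \<forall>n. coeff f n \<in> W}"

definition W_hat ::
  "'K::field_char_0 set \<Rightarrow> nat \<Rightarrow> 'K poly fract \<Rightarrow> (nat \<Rightarrow> 'K poly fract set) ring" where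
  "W_hat W p h = adic_completion (ring_on (laurent_loc W h)) (of_nat p)"

definition to_W_hat ::
  "'K::field_char_0 set \<Rightarrow> nat \<Rightarrow> 'K poly fract \<Rightarrow> 'K poly fract \<Rightarrow> nat \<Rightarrow> 'K poly fract set" where
  "to_W_hat W p h = to_adic_completion (ring_on (laurent_loc W h)) (of_nat p)"

definition hyp_h :: "'K::field_char_0 set \<Rightarrow> nat \<Rightarrow> nat \<Rightarrow> 'K \<Rightarrow> nat \<Rightarrow> 'K poly fract" where
  "hyp_h W p s a r = (\<Prod>i<r. trunc_at (hyp_fps s ((dwork_prime W p ^^ i) a)) p rat_t)"

text \<open>The limit of \<open>G(t)\<^bsub><p^n\<^esub> / F(t)\<^bsub><p^n\<^esub>\<close>. The truncations of \<open>F = F\<^sub>a\<close> are invertible only after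
  completion, so the quotient is formed there.\<close>

definition quotient_lim ::
  "'K::field_char_0 set \<Rightarrow> nat \<Rightarrow> 'K poly fract \<Rightarrow> 'K fps \<Rightarrow> 'K fps \<Rightarrow> nat \<Rightarrow> 'K poly fract set"
  where
  "quotient_lim W p h G F =
     adic_lim (W_hat W p h) (to_W_hat W p h (of_nat p)) sequentially
       (\<lambda>n. to_W_hat W p h (trunc_at G (p ^ n) rat_t) \<otimes>\<^bsub>W_hat W p h\<^esub>
            inv\<^bsub>W_hat W p h\<^esub> (to_W_hat W p h (trunc_at F (p ^ n) rat_t)))"

definition hyp_log ::
  "'K::field_char_0 set \<Rightarrow> nat \<Rightarrow> nat \<Rightarrow> 'K poly fract \<Rightarrow> 'K \<Rightarrow> 'K \<Rightarrow> nat \<Rightarrow> 'K poly fract set"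
  where
  "hyp_log W p s h c a = quotient_lim W p h (hyp_G W p s c a) (hyp_fps s a)"

definition hyp_log_hat ::
  "'K::field_char_0 set \<Rightarrow> nat \<Rightarrow> nat \<Rightarrow> 'K poly fract \<Rightarrow> 'K \<Rightarrow> 'K \<Rightarrow> nat \<Rightarrow> 'K poly fract set"
  where
  "hyp_log_hat W p s h d a = quotient_lim W p h (hyp_G_hat W p s d a) (hyp_fps s a)"

text \<open>\<open>\<omega>\<close> is a continuous \<open>W\<close>-algebra endomorphism of \<open>W\<langle>t, t\<inverse>, h\<inverse>\<rangle>\<close> with \<open>\<omega>(t) = t\<inverse>\<close>. These
  conditions determine \<open>\<omega>\<close> on the carrier, because the image of \<open>W[t, t\<inverse>, h\<inverse>]\<close> is dense.\<close>

definition inversion_endo ::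
  "'K::field_char_0 set \<Rightarrow> nat \<Rightarrow> 'K poly fract \<Rightarrow>
     ((nat \<Rightarrow> 'K poly fract set) \<Rightarrow> (nat \<Rightarrow> 'K poly fract set)) \<Rightarrow> bool" where
  "inversion_endo W p h \<omega> \<longleftrightarrow>
     (let R = W_hat W p h; \<iota> = to_W_hat W p h; P = (\<lambda>n::nat. PIdl\<^bsub>R\<^esub> (\<iota> (of_nat p) [^]\<^bsub>R\<^esub> n)) in
       \<omega> \<in> ring_hom R R \<and>
       (\<forall>w\<in>W. \<omega> (\<iota> (rat_const w)) = \<iota> (rat_const w)) \<and>
       (\<forall>x\<in>carrier R. \<forall>n. \<exists>m. \<forall>y\<in>carrier R. y \<ominus>\<^bsub>R\<^esub> x \<in> P m \<longrightarrow> \<omega> y \<ominus>\<^bsub>R\<^esub> \<omega> x \<in> P n) \<and>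
       \<omega> (\<iota> rat_t) = \<iota> (inverse rat_t))"

end

(* Write A_k for the coefficients of F_a. For a continuous function phi on Z_p put
   S_n(phi)(t) = sum_(k < p^n) A_k phi(k) t^k. The quotients S_n(phi) / S_n(1) converge to the integral
   of phi against a W<t,1/t,1/h>-valued measure mu_a on Z_p, and both logarithmic functions are such
   integrals: F_a^sigma = int beta d mu_a with beta(k) = B_k / A_k, and likewise for the hatted function
   with beta_hat(k) = Bhat_k / A_k. Since beta_hat(x) = - beta(-a - x), the theorem says that inversion
   t -> 1/t carries mu_a to its image under the reflection x -> -a - x.

   To prove this, split k = u + p k' with u < p. Then A_(u + p k') is the coefficient of F_(a') at k'
   times a continuous function of k', so that a sum for a and phi becomes a combination of sums for a'
   and functions that depend, modulo p, on one p-adic digit less. The splitting is compatible with the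
   reflection. Consequently the form
     S_n(phi)(t) S_n'(psi o refl)(1/t) - S_n(psi)(t) S_n'(phi o refl)(1/t),
   which vanishes for constant phi and psi, reduces to its values at functions that are constant modulo p,
   where it is divisible by p; by iteration it tends to 0 as n and n' grow. With psi = 1 this
   gives the convergence of the quotients and the reflection formula together. *)
theory Submission
  imports Defs
begin

section \<open>Congruences modulo powers of an element\<close>

text \<open>What shapes the proof is the splitting at 1/t. With l = \<open>res a\<close>, reflection
  sends the last digit u to l - u if u \<le> l. For u > l there is a carry: the digit becomes p + l
  - u and the higher part shifts by one. Exactly for these digits A_(u + p k') has an additional
  factor (p (a' + k'))^s. The recurrence of the coefficients turns this factor into the required
  shift, up to a boundary term divisible by p^n. The sign caused by the carry cancels against the
  one from reflecting p (a' + k'), so that one sign (-1)^(s e) is left for all digits; it leaves the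
  form as a common factor. For p = 2 this sign depends on a modulo 4, whence q = 4.

  Functions on Z_p are never formed: phi and phi o refl are two sequences tied by congruences at
  those k, k' for which a + k + k' is small. The indices n and n' are independent so that two
  quotients can be compared through a third.

  Dividing by S_n(1) is possible in the completion because modulo p it is a product of powers of the
  truncations F_(a^(i))(t)_(<p), which by periodicity are factors of h.\<close>

locale adic_subring =
  fixes A :: "'a::field set" and x :: 'a
  assumes zero_closed [simp]: "0 \<in> A" and one_closed [simp]: "1 \<in> A"
    and add_closed [simp]: "\<And>u v. u \<in> A \<Longrightarrow> v \<in> A \<Longrightarrow> u + v \<in> A"
    and uminus_closed [simp]: "\<And>u. u \<in> A \<Longrightarrow> - u \<in> A"
    and mult_closed [simp]: "\<And>u v. u \<in> A \<Longrightarrow> v \<in> A \<Longrightarrow> u * v \<in> A"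
    and x_closed [simp]: "x \<in> A" and x_nonzero [simp]: "x \<noteq> 0"
begin

text \<open>The elements \<open>u\<close> and \<open>v\<close> need not lie in \<open>A\<close>;
  only the cofactor of their difference does. So \<open>cg 0\<close> says that two elements differ
  by an element of \<open>A\<close>, and membership in \<open>A\<close> can be transported along a
  congruence.\<close>

definition cg :: "nat \<Rightarrow> 'a \<Rightarrow> 'a \<Rightarrow> bool" where
  "cg n u v \<longleftrightarrow> (\<exists>w\<in>A. u - v = x ^ n * w)"

lemma diff_closed [simp]: "u \<in> A \<Longrightarrow> v \<in> A \<Longrightarrow> u - v \<in> A"
  using add_closed[of u "- v"] by simp

lemma power_closed [simp]: "u \<in> A \<Longrightarrow> u ^ k \<in> A"
  by (induction k) auto

lemma sum_closed: "(\<And>i. i \<in> I \<Longrightarrow> f i \<in> A) \<Longrightarrow> sum f I \<in> A"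
  by (induction I rule: infinite_finite_induct) auto

lemma prod_closed: "(\<And>i. i \<in> I \<Longrightarrow> f i \<in> A) \<Longrightarrow> prod f I \<in> A"
  by (induction I rule: infinite_finite_induct) auto

lemma of_nat_closed [simp]: "of_nat k \<in> A"
  by (induction k) auto

lemma of_int_closed [simp]: "of_int k \<in> A"
  by (cases k rule: int_cases2) auto

lemma cg_refl [simp]: "cg n u u"
  unfolding cg_def by (auto intro: bexI[of _ 0])

lemma cg_sym: "cg n u v \<Longrightarrow> cg n v u"
  unfolding cg_def by (metis minus_diff_eq mult_minus_right uminus_closed)

lemma cg_trans [trans]: "cg n u v \<Longrightarrow> cg n v w \<Longrightarrow> cg n u w"
proof -
  assume "cg n u v" "cg n v w"
  then obtain a b where "a \<in> A" "b \<in> A" "u - v = x ^ n * a" "v - w = x ^ n * b"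
    unfolding cg_def by auto
  then have "u - w = x ^ n * (a + b)" "a + b \<in> A"
    by (simp_all add: algebra_simps)
  then show ?thesis unfolding cg_def by blast
qed

lemma cg_eq_trans [trans]: "cg n u v \<Longrightarrow> v = w \<Longrightarrow> cg n u w"
  by simp

lemma eq_cg_trans [trans]: "u = v \<Longrightarrow> cg n v w \<Longrightarrow> cg n u w"
  by simp

lemma cg_0: "u \<in> A \<Longrightarrow> v \<in> A \<Longrightarrow> cg 0 u v"
  unfolding cg_def by auto

lemma cg_mono: "cg n u v \<Longrightarrow> k \<le> n \<Longrightarrow> cg k u v"
proof -
  assume "cg n u v" "k \<le> n"
  then obtain a where "a \<in> A" "u - v = x ^ n * a" unfolding cg_def by auto
  moreover have "x ^ n = x ^ k * x ^ (n - k)" using \<open>k \<le> n\<close> by (simp flip: power_add)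
  ultimately show ?thesis unfolding cg_def
    by (auto intro!: bexI[of _ "x ^ (n - k) * a"])
qed

lemma cg_closed: "cg n u v \<Longrightarrow> v \<in> A \<Longrightarrow> u \<in> A"
  unfolding cg_def by (metis add_closed diff_add_cancel mult_closed power_closed x_closed)

lemma cg_closed': "cg n u v \<Longrightarrow> u \<in> A \<Longrightarrow> v \<in> A"
  using cg_closed cg_sym by blast

lemma cg_add: "cg n u v \<Longrightarrow> cg n u' v' \<Longrightarrow> cg n (u + u') (v + v')"
proof -
  assume "cg n u v" "cg n u' v'"
  then obtain a b where "a \<in> A" "b \<in> A" "u - v = x ^ n * a" "u' - v' = x ^ n * b"
    unfolding cg_def by auto
  then have "(u + u') - (v + v') = x ^ n * (a + b)" "a + b \<in> A"
    by (simp_all add: algebra_simps)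
  then show ?thesis unfolding cg_def by blast
qed

lemma cg_minus: "cg n u v \<Longrightarrow> cg n (- u) (- v)"
proof -
  assume "cg n u v"
  then obtain a where "a \<in> A" "u - v = x ^ n * a"
    unfolding cg_def by auto
  then have "- u - - v = x ^ n * - a" "- a \<in> A"
    by (simp_all add: algebra_simps)
  then show ?thesis unfolding cg_def by blast
qed

lemma cg_diff: "cg n u v \<Longrightarrow> cg n u' v' \<Longrightarrow> cg n (u - u') (v - v')"
  using cg_add[of n u v "- u'" "- v'"] cg_minus by simp

lemma cg_mult: "cg n u v \<Longrightarrow> cg n u' v' \<Longrightarrow> u \<in> A \<Longrightarrow> v' \<in> A \<Longrightarrow> cg n (u * u') (v * v')"
proof -
  assume "cg n u v" "cg n u' v'" "u \<in> A" "v' \<in> A"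
  then obtain a b where "a \<in> A" "b \<in> A" "u - v = x ^ n * a" "u' - v' = x ^ n * b"
    unfolding cg_def by auto
  moreover have "u * u' - v * v' = u * (u' - v') + (u - v) * v'"
    by (simp add: algebra_simps)
  ultimately have "u * u' - v * v' = x ^ n * (u * b + a * v')"
    by (simp add: algebra_simps)
  moreover have "u * b + a * v' \<in> A"
    using \<open>u \<in> A\<close> \<open>v' \<in> A\<close> \<open>a \<in> A\<close> \<open>b \<in> A\<close> by simp
  ultimately show ?thesis unfolding cg_def by blast
qed

lemma cg_mult_left: "cg n u v \<Longrightarrow> w \<in> A \<Longrightarrow> cg n (w * u) (w * v)"
  unfolding cg_def by (metis mult.left_commute mult_closed right_diff_distrib')

lemma cg_mult_right: "cg n u v \<Longrightarrow> w \<in> A \<Longrightarrow> cg n (u * w) (v * w)"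
  using cg_mult_left by (simp add: mult.commute)

lemma cg_power: "cg n u v \<Longrightarrow> u \<in> A \<Longrightarrow> v \<in> A \<Longrightarrow> cg n (u ^ k) (v ^ k)"
  by (induction k) (auto intro: cg_mult)

lemma cg_sum: "(\<And>i. i \<in> I \<Longrightarrow> cg n (f i) (g i)) \<Longrightarrow> cg n (sum f I) (sum g I)"
  by (induction I rule: infinite_finite_induct) (auto intro: cg_add)

lemma cg_prod:
  "(\<And>i. i \<in> I \<Longrightarrow> cg n (f i) (g i)) \<Longrightarrow> (\<And>i. i \<in> I \<Longrightarrow> f i \<in> A) \<Longrightarrow> (\<And>i. i \<in> I \<Longrightarrow> g i \<in> A)
    \<Longrightarrow> cg n (prod f I) (prod g I)"
  by (induction I rule: infinite_finite_induct) (auto intro!: cg_mult prod_closed)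

lemma cg_inverse:
  assumes "cg n u v" "u \<noteq> 0" "v \<noteq> 0" "inverse u \<in> A" "inverse v \<in> A"
  shows "cg n (inverse u) (inverse v)"
proof -
  have "inverse u - inverse v = inverse u * inverse v * (v - u)"
    using assms by (simp add: field_simps)
  then show ?thesis
    using assms(1,4,5) cg_sym[OF assms(1)] unfolding cg_def
    by (metis mult.left_commute mult_closed)
qed

text \<open>Cancellation works because \<open>A\<close> lies in a field and \<open>x\<close> is
  nonzero. Every later division by a power of p loses precision in this way.\<close>

lemma cg_x_mult: "cg (k + n) (x ^ k * u) (x ^ k * v) \<longleftrightarrow> cg n u v"
  unfolding cg_def by (simp add: power_add mult.assoc flip: right_diff_distrib)

lemma cg_x_mult_Suc: "cg (Suc n) (x * u) (x * v) \<longleftrightarrow> cg n u v"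
  using cg_x_mult[of 1] by simp

lemma cg_multiple: "w \<in> A \<Longrightarrow> k \<le> n \<Longrightarrow> cg k (x ^ n * w) 0"
  unfolding cg_def by (auto intro!: bexI[of _ "x ^ (n - k) * w"] simp flip: power_add mult.assoc)

lemma cg_diff_0: "cg n (u - v) 0 \<longleftrightarrow> cg n u v"
  unfolding cg_def by simp

end

section \<open>Adic completions of subrings of a field\<close>

lemma ring_of_type_algebra_simps [simp]:
  "u \<otimes>\<^bsub>ring_of_type_algebra\<^esub> v = u * v" "\<one>\<^bsub>ring_of_type_algebra\<^esub> = 1"
  "\<zero>\<^bsub>ring_of_type_algebra\<^esub> = 0" "u \<oplus>\<^bsub>ring_of_type_algebra\<^esub> v = u + v"
  by (simp_all add: ring_of_type_algebra_def)

context adic_subring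
begin

lemma cring_ring_on: "cring (ring_on A)"
proof (rule cringI)
  show "abelian_group (ring_on A)"
    by (rule abelian_groupI) (auto simp: add.assoc add.commute intro!: bexI[of _ "- _"])
  show "Group.comm_monoid (ring_on A)"
    by (rule comm_monoidI) (auto simp: ac_simps)
qed (auto simp: algebra_simps)

sublocale R: cring "ring_on A"
  by (rule cring_ring_on)

lemma ring_on_pow [simp]: "u [^]\<^bsub>ring_on A\<^esub> (n::nat) = u ^ n"
  by (induction n) (simp_all add: mult.commute)

lemma ring_on_uminus [simp]: "u \<in> A \<Longrightarrow> \<ominus>\<^bsub>ring_on A\<^esub> u = - u"
  using R.minus_equality[of "- u" u] by simp

lemma ring_on_minus [simp]: "v \<in> A \<Longrightarrow> u \<ominus>\<^bsub>ring_on A\<^esub> v = u - v"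
  by (simp add: a_minus_def)

lemma PIdl_ring_on: "z \<in> PIdl\<^bsub>ring_on A\<^esub> (x ^ n) \<longleftrightarrow> cg n z 0"
  by (auto simp: cgenideal_def cg_def mult.commute)

definition cls :: "nat \<Rightarrow> 'a \<Rightarrow> 'a set" where
  "cls n r = {z. cg n z r}"

lemma cls_eq_iff: "cls n r = cls n s \<longleftrightarrow> cg n r s"
  unfolding cls_def using cg_refl cg_sym cg_trans by blast

lemma cls_mono_iff: "cls (Suc n) r \<subseteq> cls n s \<longleftrightarrow> cg n r s"
proof
  show "cg n r s" if "cls (Suc n) r \<subseteq> cls n s"
    using that cg_refl[of "Suc n" r] unfolding cls_def by blast
  show "cls (Suc n) r \<subseteq> cls n s" if "cg n r s"
    unfolding cls_def using that cg_mono[of "Suc n" _ r n] by (auto intro: cg_trans)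
qed

lemma coset_eq_cls: "PIdl\<^bsub>ring_on A\<^esub> (x ^ n) +>\<^bsub>ring_on A\<^esub> r = cls n r"
proof -
  have "PIdl\<^bsub>ring_on A\<^esub> (x ^ n) +>\<^bsub>ring_on A\<^esub> r = {h + r | h. cg n h 0}"
    by (auto simp: a_r_coset_def' PIdl_ring_on)
  also have "\<dots> = cls n r"
    unfolding cls_def using cg_diff_0
    by (auto simp: cg_def) (metis add_diff_cancel diff_add_cancel)
  finally show ?thesis .
qed

lemma PIdl_eq_cls: "PIdl\<^bsub>ring_on A\<^esub> (x ^ n) = cls n 0"
  by (auto simp: PIdl_ring_on cls_def)

abbreviation completion :: "(nat \<Rightarrow> 'a set) ring" where
  "completion \<equiv> adic_completion (ring_on A) x"

abbreviation to_completion :: "'a \<Rightarrow> nat \<Rightarrow> 'a set" where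
  "to_completion \<equiv> to_adic_completion (ring_on A) x"

lemma PIdl_is_ideal: "ideal (cls n 0) (ring_on A)"
  using R.cgenideal_ideal[of "x ^ n"] by (simp add: PIdl_eq_cls)

lemma coset_cls: "cls n 0 +>\<^bsub>ring_on A\<^esub> r = cls n r"
  using coset_eq_cls by (simp add: PIdl_eq_cls)

lemma to_completion_eq: "to_completion r = (\<lambda>n. cls n r)"
  by (simp add: to_adic_completion_def coset_eq_cls)

lemma cls_mult:
  "r \<in> A \<Longrightarrow> s \<in> A \<Longrightarrow> cls n r \<otimes>\<^bsub>ring_on A Quot cls n 0\<^esub> cls n s = cls n (r * s)"
  using ideal.rcoset_mult_add[OF PIdl_is_ideal, of r s n]
  by (simp add: FactRing_def coset_cls)

lemma cls_add:
  "r \<in> A \<Longrightarrow> s \<in> A \<Longrightarrow> cls n r \<oplus>\<^bsub>ring_on A Quot cls n 0\<^esub> cls n s = cls n (r + s)"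
  using abelian_subgroup.a_rcos_sum[OF abelian_subgroupI3[OF
        ideal.axioms(1)[OF PIdl_is_ideal] R.abelian_group_axioms], of r s n]
  by (simp add: FactRing_def coset_cls)

lemma quot_carrier: "carrier (ring_on A Quot cls n 0) = {cls n r | r. r \<in> A}"
  by (auto simp: FactRing_def A_RCOSETS_def' coset_cls)

lemma completion_carrier:
  "carrier completion = {f. \<forall>n. (\<exists>r\<in>A. f n = cls n r) \<and> f (Suc n) \<subseteq> f n}"
  by (simp add: adic_completion_def PIdl_eq_cls quot_carrier Bex_def conj_commute)

lemma completion_ex:
  assumes "f \<in> carrier completion"
  shows "\<exists>r. (\<forall>n. r n \<in> A) \<and> (\<forall>n. cg n (r (Suc n)) (r n)) \<and> f = (\<lambda>n. cls n (r n))"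
proof -
  have "\<forall>n. \<exists>r\<in>A. f n = cls n r"
    using assms by (simp add: completion_carrier)
  then obtain r where r: "\<And>n. r n \<in> A" "\<And>n. f n = cls n (r n)"
    by metis
  moreover have "cg n (r (Suc n)) (r n)" for n
    using assms r(2) cls_mono_iff by (simp add: completion_carrier)
  ultimately show ?thesis
    by blast
qed

lemma completion_memI:
  "(\<And>n. r n \<in> A) \<Longrightarrow> (\<And>n. cg n (r (Suc n)) (r n)) \<Longrightarrow> (\<lambda>n. cls n (r n)) \<in> carrier completion"
  using cls_mono_iff by (auto simp: completion_carrier)

lemma completion_mult:
  "(\<And>n. r n \<in> A) \<Longrightarrow> (\<And>n. s n \<in> A) \<Longrightarrow>
    (\<lambda>n. cls n (r n)) \<otimes>\<^bsub>completion\<^esub> (\<lambda>n. cls n (s n)) = (\<lambda>n. cls n (r n * s n))"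
  by (simp add: adic_completion_def PIdl_eq_cls cls_mult)

lemma completion_add:
  "(\<And>n. r n \<in> A) \<Longrightarrow> (\<And>n. s n \<in> A) \<Longrightarrow>
    (\<lambda>n. cls n (r n)) \<oplus>\<^bsub>completion\<^esub> (\<lambda>n. cls n (s n)) = (\<lambda>n. cls n (r n + s n))"
  by (simp add: adic_completion_def PIdl_eq_cls cls_add)

lemma completion_one: "\<one>\<^bsub>completion\<^esub> = (\<lambda>n. cls n 1)"
  by (simp add: adic_completion_def PIdl_eq_cls FactRing_def coset_cls)

lemma completion_zero: "\<zero>\<^bsub>completion\<^esub> = (\<lambda>n. cls n 0)"
  by (simp add: adic_completion_def PIdl_eq_cls FactRing_def)

lemma cring_completion: "cring completion"
proof (rule cringI)
  show "abelian_group completion"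
  proof (rule abelian_groupI)
    fix f g h
    assume fgh: "f \<in> carrier completion" "g \<in> carrier completion" "h \<in> carrier completion"
  obtain r where r: "\<And>n. r n \<in> A" "\<And>n. cg n (r (Suc n)) (r n)" "f = (\<lambda>n. cls n (r n))"
    using completion_ex[OF fgh(1)] by blast
  obtain s where s: "\<And>n. s n \<in> A" "\<And>n. cg n (s (Suc n)) (s n)" "g = (\<lambda>n. cls n (s n))"
    using completion_ex[OF fgh(2)] by blast
  obtain t where t: "\<And>n. t n \<in> A" "\<And>n. cg n (t (Suc n)) (t n)" "h = (\<lambda>n. cls n (t n))"
    using completion_ex[OF fgh(3)] by blast
  from r s t show "f \<oplus>\<^bsub>completion\<^esub> g \<oplus>\<^bsub>completion\<^esub> h = f \<oplus>\<^bsub>completion\<^esub> (g \<oplus>\<^bsub>completion\<^esub> h)"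
      by (simp add: completion_add add.assoc)
  next
    fix f g
    assume fg: "f \<in> carrier completion" "g \<in> carrier completion"
  obtain r where r: "\<And>n. r n \<in> A" "\<And>n. cg n (r (Suc n)) (r n)" "f = (\<lambda>n. cls n (r n))"
    using completion_ex[OF fg(1)] by blast
  obtain s where s: "\<And>n. s n \<in> A" "\<And>n. cg n (s (Suc n)) (s n)" "g = (\<lambda>n. cls n (s n))"
    using completion_ex[OF fg(2)] by blast
  note rs = r s
  from rs show "f \<oplus>\<^bsub>completion\<^esub> g = g \<oplus>\<^bsub>completion\<^esub> f"
      by (simp add: completion_add add.commute)
    from rs show "f \<oplus>\<^bsub>completion\<^esub> g \<in> carrier completion"
      by (simp add: completion_add completion_memI cg_add)
  next
    show "\<zero>\<^bsub>completion\<^esub> \<in> carrier completion"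
      using completion_memI[of "\<lambda>_. 0"] by (simp add: completion_zero)
  next
    fix f
    assume f: "f \<in> carrier completion"
  obtain r where r: "\<And>n. r n \<in> A" "\<And>n. cg n (r (Suc n)) (r n)" "f = (\<lambda>n. cls n (r n))"
    using completion_ex[OF f] by blast
  from r show "\<zero>\<^bsub>completion\<^esub> \<oplus>\<^bsub>completion\<^esub> f = f"
      using completion_add[of "\<lambda>_. 0" r] by (simp add: completion_zero)
    show "\<exists>g\<in>carrier completion. g \<oplus>\<^bsub>completion\<^esub> f = \<zero>\<^bsub>completion\<^esub>"
      using r completion_add[of "\<lambda>n. - r n" r]
      by (intro bexI[of _ "\<lambda>n. cls n (- r n)"] completion_memI)
        (auto simp: completion_zero cg_minus)
  qed
  show "Group.comm_monoid completion"
  proof (rule comm_monoidI)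
    fix f g h
    assume fgh: "f \<in> carrier completion" "g \<in> carrier completion" "h \<in> carrier completion"
  obtain r where r: "\<And>n. r n \<in> A" "\<And>n. cg n (r (Suc n)) (r n)" "f = (\<lambda>n. cls n (r n))"
    using completion_ex[OF fgh(1)] by blast
  obtain s where s: "\<And>n. s n \<in> A" "\<And>n. cg n (s (Suc n)) (s n)" "g = (\<lambda>n. cls n (s n))"
    using completion_ex[OF fgh(2)] by blast
  obtain t where t: "\<And>n. t n \<in> A" "\<And>n. cg n (t (Suc n)) (t n)" "h = (\<lambda>n. cls n (t n))"
    using completion_ex[OF fgh(3)] by blast
  from r s t show "f \<otimes>\<^bsub>completion\<^esub> g \<otimes>\<^bsub>completion\<^esub> h = f \<otimes>\<^bsub>completion\<^esub> (g \<otimes>\<^bsub>completion\<^esub> h)"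
      by (simp add: completion_mult mult.assoc)
  next
    fix f g
    assume fg: "f \<in> carrier completion" "g \<in> carrier completion"
  obtain r where r: "\<And>n. r n \<in> A" "\<And>n. cg n (r (Suc n)) (r n)" "f = (\<lambda>n. cls n (r n))"
    using completion_ex[OF fg(1)] by blast
  obtain s where s: "\<And>n. s n \<in> A" "\<And>n. cg n (s (Suc n)) (s n)" "g = (\<lambda>n. cls n (s n))"
    using completion_ex[OF fg(2)] by blast
  note rs = r s
  from rs show "f \<otimes>\<^bsub>completion\<^esub> g = g \<otimes>\<^bsub>completion\<^esub> f"
      by (simp add: completion_mult mult.commute)
    from rs show "f \<otimes>\<^bsub>completion\<^esub> g \<in> carrier completion"
      by (simp add: completion_mult completion_memI cg_mult)
  next
    show "\<one>\<^bsub>completion\<^esub> \<in> carrier completion"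
      using completion_memI[of "\<lambda>_. 1"] by (simp add: completion_one)
  next
    fix f
    assume f: "f \<in> carrier completion"
  obtain r where r: "\<And>n. r n \<in> A" "\<And>n. cg n (r (Suc n)) (r n)" "f = (\<lambda>n. cls n (r n))"
    using completion_ex[OF f] by blast
  from r show "\<one>\<^bsub>completion\<^esub> \<otimes>\<^bsub>completion\<^esub> f = f"
      using completion_mult[of "\<lambda>_. 1" r] by (simp add: completion_one)
  qed
next
  fix f g h
  assume fgh: "f \<in> carrier completion" "g \<in> carrier completion" "h \<in> carrier completion"
  obtain r where r: "\<And>n. r n \<in> A" "\<And>n. cg n (r (Suc n)) (r n)" "f = (\<lambda>n. cls n (r n))"
    using completion_ex[OF fgh(1)] by blast
  obtain s where s: "\<And>n. s n \<in> A" "\<And>n. cg n (s (Suc n)) (s n)" "g = (\<lambda>n. cls n (s n))"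
    using completion_ex[OF fgh(2)] by blast
  obtain t where t: "\<And>n. t n \<in> A" "\<And>n. cg n (t (Suc n)) (t n)" "h = (\<lambda>n. cls n (t n))"
    using completion_ex[OF fgh(3)] by blast
  from r s t show "(f \<oplus>\<^bsub>completion\<^esub> g) \<otimes>\<^bsub>completion\<^esub> h
      = f \<otimes>\<^bsub>completion\<^esub> h \<oplus>\<^bsub>completion\<^esub> g \<otimes>\<^bsub>completion\<^esub> h"
    by (simp add: completion_mult completion_add algebra_simps)
qed

sublocale C: cring completion
  by (rule cring_completion)

lemma to_completion_closed [simp]: "r \<in> A \<Longrightarrow> to_completion r \<in> carrier completion"
  using completion_memI[of "\<lambda>_. r"] by (simp add: to_completion_eq)

lemma to_completion_mult:
  "r \<in> A \<Longrightarrow> s \<in> A \<Longrightarrow> to_completion (r * s) = to_completion r \<otimes>\<^bsub>completion\<^esub> to_completion s"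
  using completion_mult[of "\<lambda>_. r" "\<lambda>_. s"] by (simp add: to_completion_eq)

lemma to_completion_add:
  "r \<in> A \<Longrightarrow> s \<in> A \<Longrightarrow> to_completion (r + s) = to_completion r \<oplus>\<^bsub>completion\<^esub> to_completion s"
  using completion_add[of "\<lambda>_. r" "\<lambda>_. s"] by (simp add: to_completion_eq)

lemma to_completion_one: "to_completion 1 = \<one>\<^bsub>completion\<^esub>"
  by (simp add: to_completion_eq completion_one)

lemma to_completion_zero: "to_completion 0 = \<zero>\<^bsub>completion\<^esub>"
  by (simp add: to_completion_eq completion_zero)

lemma to_completion_pow:
  "r \<in> A \<Longrightarrow> to_completion (r ^ n) = to_completion r [^]\<^bsub>completion\<^esub> (n::nat)"
  by (induction n) (simp_all add: to_completion_one to_completion_mult C.m_comm)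

lemma completion_minus:
  assumes "\<And>n. r n \<in> A" "\<And>n. cg n (r (Suc n)) (r n)" "\<And>n. s n \<in> A" "\<And>n. cg n (s (Suc n)) (s n)"
  shows "(\<lambda>n. cls n (r n)) \<ominus>\<^bsub>completion\<^esub> (\<lambda>n. cls n (s n)) = (\<lambda>n. cls n (r n - s n))"
proof -
  have m: "(\<lambda>n. cls n (- s n)) \<in> carrier completion" "(\<lambda>n. cls n (s n)) \<in> carrier completion"
    using assms by (auto intro!: completion_memI cg_minus)
  have "\<ominus>\<^bsub>completion\<^esub> (\<lambda>n. cls n (s n)) = (\<lambda>n. cls n (- s n))"
    using assms m completion_add[of "\<lambda>n. - s n" s]
    by (intro C.minus_equality) (auto simp: completion_zero)
  then show ?thesis
    using assms completion_add[of r "\<lambda>n. - s n"] by (simp add: a_minus_def)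
qed

text \<open>If the n-th coset is zero, all representatives from n on are multiples of
  \<open>x ^ n\<close>, and the cofactors form a coherent sequence again. Their index is shifted by
  n because the cancellation costs n steps of precision.\<close>

lemma PIdl_completion:
  assumes "f \<in> carrier completion"
  shows "f \<in> PIdl\<^bsub>completion\<^esub> (to_completion x [^]\<^bsub>completion\<^esub> (n::nat)) \<longleftrightarrow> f n = cls n 0"
proof
  assume "f \<in> PIdl\<^bsub>completion\<^esub> (to_completion x [^]\<^bsub>completion\<^esub> n)"
  then obtain g where g: "g \<in> carrier completion" "f = g \<otimes>\<^bsub>completion\<^esub> to_completion (x ^ n)"
    by (auto simp: cgenideal_def to_completion_pow)
  obtain r where r: "\<And>n. r n \<in> A" "\<And>n. cg n (r (Suc n)) (r n)" "g = (\<lambda>n. cls n (r n))"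
    using completion_ex[OF g(1)] by blast
  have "f n = cls n (r n * x ^ n)"
    using completion_mult[of r "\<lambda>_. x ^ n"] r by (simp add: g(2) to_completion_eq)
  also have "\<dots> = cls n 0"
    using r by (auto simp: cls_eq_iff cg_def mult.commute)
  finally show "f n = cls n 0" .
next
  assume f: "f n = cls n 0"
  obtain r where r: "\<And>n. r n \<in> A" "\<And>n. cg n (r (Suc n)) (r n)" "f = (\<lambda>n. cls n (r n))"
    using completion_ex[OF assms] by blast
  have r': "cg i (r (i + j)) (r i)" for i j
  proof (induction j)
    case (Suc j)
    have "cg i (r (Suc (i + j))) (r (i + j))"
      using r(2) by (rule cg_mono) simp
    then show ?case using Suc cg_trans by simp
  qed simp
  have "cg n (r (k + n)) 0" for k
    using r'[of n k] f r(3) cg_trans by (auto simp: cls_eq_iff add.commute)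
  then have "\<forall>k. \<exists>w\<in>A. r (k + n) = x ^ n * w"
    by (simp add: cg_def)
  then obtain w where w: "\<And>k. w k \<in> A" "\<And>k. r (k + n) = x ^ n * w k"
    by metis
  have "cg k (w (Suc k)) (w k)" for k
    using r(2)[of "k + n"] w(2)[of "Suc k"] w(2)[of k] cg_x_mult[of n k "w (Suc k)" "w k"]
    by (simp add: add.commute)
  then have "(\<lambda>k. cls k (w k)) \<in> carrier completion"
    using w(1) by (intro completion_memI)
  moreover have "f = (\<lambda>k. cls k (w k)) \<otimes>\<^bsub>completion\<^esub> to_completion (x ^ n)"
  proof -
    have "cg k (r k) (w k * x ^ n)" for k
      using cg_sym[OF r'[of k n]] w(2)[of k] by (simp add: mult.commute)
    then have "(\<lambda>k. cls k (r k)) = (\<lambda>k. cls k (w k * x ^ n))"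
      by (simp add: cls_eq_iff fun_eq_iff)
    then show ?thesis
      using completion_mult[of w "\<lambda>_. x ^ n"] w(1) by (simp add: to_completion_eq r(3))
  qed
  ultimately show "f \<in> PIdl\<^bsub>completion\<^esub> (to_completion x [^]\<^bsub>completion\<^esub> n)"
    by (auto simp: cgenideal_def to_completion_pow)
qed

lemma completion_near_iff:
  assumes "f \<in> carrier completion" "g \<in> carrier completion"
  shows "f \<ominus>\<^bsub>completion\<^esub> g \<in> PIdl\<^bsub>completion\<^esub> (to_completion x [^]\<^bsub>completion\<^esub> (n::nat))
    \<longleftrightarrow> f n = g n"
proof -
  obtain r where r: "\<And>n. r n \<in> A" "\<And>n. cg n (r (Suc n)) (r n)" "f = (\<lambda>n. cls n (r n))"
    using completion_ex[OF assms(1)] by blast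
  obtain s where s: "\<And>n. s n \<in> A" "\<And>n. cg n (s (Suc n)) (s n)" "g = (\<lambda>n. cls n (s n))"
    using completion_ex[OF assms(2)] by blast
  note rs = r s
  have "f \<ominus>\<^bsub>completion\<^esub> g \<in> carrier completion"
    using assms by simp
  then show ?thesis
    using rs by (simp add: PIdl_completion completion_minus cls_eq_iff cg_diff_0)
qed

lemma adic_lim_completion_eqI:
  assumes "\<And>m. y m \<in> carrier completion" "L \<in> carrier completion" "\<F> \<noteq> bot"
    and "\<And>n. eventually (\<lambda>m. y m n = L n) \<F>"
  shows "adic_lim completion (to_completion x) \<F> y = L"
  unfolding adic_lim_def
proof (rule the_equality)
  show "L \<in> carrier completion \<and> (\<forall>n::nat. eventually (\<lambda>m. y m \<ominus>\<^bsub>completion\<^esub> L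
      \<in> PIdl\<^bsub>completion\<^esub> (to_completion x [^]\<^bsub>completion\<^esub> n)) \<F>)"
    using assms by (simp add: completion_near_iff)
next
  fix L'
  assume "L' \<in> carrier completion \<and> (\<forall>n::nat. eventually (\<lambda>m. y m \<ominus>\<^bsub>completion\<^esub> L'
      \<in> PIdl\<^bsub>completion\<^esub> (to_completion x [^]\<^bsub>completion\<^esub> n)) \<F>)"
  then have L': "eventually (\<lambda>m. y m n = L' n) \<F>" for n
    using assms(1) by (auto simp: completion_near_iff)
  have "eventually (\<lambda>m. L' n = L n) \<F>" for n
    using assms(4)[of n] L'[of n] by eventually_elim simp
  then show "L' = L"
    using assms(3) by (auto simp: fun_eq_iff)
qed

lemma completion_Cauchy:
  assumes "\<And>m. y m \<in> carrier completion" "\<And>n. \<exists>m0. \<forall>m\<ge>m0. y m n = y m0 n"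
  shows "\<exists>L\<in>carrier completion. \<forall>n. eventually (\<lambda>m. y m n = L n) sequentially"
proof -
  from assms(2) obtain M where M: "\<And>n m. m \<ge> M n \<Longrightarrow> y m n = y (M n) n"
    by metis
  define L where "L = (\<lambda>n. y (M n) n)"
  have "L (Suc n) \<subseteq> L n" for n
  proof -
    define m where "m = max (M n) (M (Suc n))"
    have "L (Suc n) = y m (Suc n)" "L n = y m n"
      using M[of n m] M[of "Suc n" m] by (auto simp: L_def m_def)
    then show ?thesis
      using assms(1)[of m] by (simp add: completion_carrier)
  qed
  moreover have "\<exists>r\<in>A. L n = cls n r" for n
    using assms(1)[of "M n"] by (simp add: completion_carrier L_def)
  ultimately have "L \<in> carrier completion"
    by (simp add: completion_carrier)
  moreover have "eventually (\<lambda>m. y m n = L n) sequentially" for n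
    unfolding eventually_sequentially L_def using M by blast
  ultimately show ?thesis
    by blast
qed

text \<open>Invertibility modulo \<open>x\<close> is enough: z = 1 - r s is a multiple of
  \<open>x\<close>, and s times the geometric series in z inverts r. Its partial sum of length n is
  exact modulo \<open>x ^ n\<close>.\<close>

lemma to_completion_Unit:
  assumes "r \<in> A" "s \<in> A" "cg 1 (r * s) 1"
  shows "to_completion r \<in> Units completion"
proof -
  define z where "z = 1 - r * s"
  have z: "z \<in> A" "cg 1 z 0"
    using assms cg_diff[OF cg_refl[of 1 1] assms(3)] by (auto simp: z_def)
  define g where "g = (\<lambda>n. s * (\<Sum>i<n. z ^ i))"
  have zn: "cg n (z ^ n) 0" for n
  proof -
    obtain w where "w \<in> A" "z = x * w"
      using z(2) by (auto simp: cg_def)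
    then show ?thesis
      by (simp add: power_mult_distrib cg_multiple)
  qed
  have g: "g n \<in> A" for n
    using assms z by (auto simp: g_def intro!: sum_closed mult_closed)
  have "cg n (g (Suc n)) (g n)" for n
    using cg_mult_left[OF cg_add[OF cg_refl[of n "\<Sum>i<n. z ^ i"] zn[of n]] assms(2)]
    by (simp add: g_def)
  then have gC: "(\<lambda>n. cls n (g n)) \<in> carrier completion"
    using g by (intro completion_memI)
  have "cg n (r * g n) 1" for n
  proof -
    have "r * g n = (1 - z) * (\<Sum>i<n. z ^ i)"
      by (simp add: g_def z_def)
    also have "\<dots> = 1 - z ^ n"
      by (simp add: one_diff_power_eq)
    finally show ?thesis
      using cg_diff[OF cg_refl[of n 1] zn[of n]] by simp
  qed
  then have "(\<lambda>n. cls n (r * g n)) = (\<lambda>n. cls n 1)"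
    by (simp add: cls_eq_iff fun_eq_iff)
  then have "to_completion r \<otimes>\<^bsub>completion\<^esub> (\<lambda>n. cls n (g n)) = \<one>\<^bsub>completion\<^esub>"
    using completion_mult[of "\<lambda>_. r" g] g assms
    by (simp add: to_completion_eq completion_one)
  then show ?thesis
    using gC assms(1) C.m_comm[of "to_completion r" "\<lambda>n. cls n (g n)"]
    by (auto simp: Units_def)
qed

lemma adic_lim_ring_on_eqI:
  assumes "L \<in> A" "\<F> \<noteq> bot" "\<And>n. eventually (\<lambda>m. cg n (y m) L) \<F>"
    and separated: "\<And>z. z \<in> A \<Longrightarrow> (\<And>n. cg n z 0) \<Longrightarrow> z = 0"
  shows "adic_lim (ring_on A) x \<F> y = L"
  unfolding adic_lim_def
proof (rule the_equality)
  show "L \<in> carrier (ring_on A) \<and> (\<forall>n::nat. eventually (\<lambda>m. y m \<ominus>\<^bsub>ring_on A\<^esub> L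
      \<in> PIdl\<^bsub>ring_on A\<^esub> (x [^]\<^bsub>ring_on A\<^esub> n)) \<F>)"
    using assms by (simp add: PIdl_ring_on cg_diff_0)
next
  fix L'
  assume "L' \<in> carrier (ring_on A) \<and> (\<forall>n::nat. eventually (\<lambda>m. y m \<ominus>\<^bsub>ring_on A\<^esub> L'
      \<in> PIdl\<^bsub>ring_on A\<^esub> (x [^]\<^bsub>ring_on A\<^esub> n)) \<F>)"
  then have L': "L' \<in> A" "eventually (\<lambda>m. cg n (y m) L') \<F>" for n
    by (auto simp: PIdl_ring_on cg_diff_0)
  have "eventually (\<lambda>m. cg n L' L) \<F>" for n
    using assms(3)[of n] L'(2)[of n] by eventually_elim (use cg_sym cg_trans in blast)
  then have "cg n L' L" for n
    using assms(2) by simp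
  then show "L' = L"
    using separated[of "L' - L"] L'(1) assms(1) by (simp add: cg_diff_0)
qed

end

section \<open>A complete ring in which a prime number is topologically nilpotent\<close>

context adic_subring
begin

definition units :: "'a set" where
  "units = {u \<in> A. u \<noteq> 0 \<and> inverse u \<in> A}"

lemma units_closed: "u \<in> units \<Longrightarrow> u \<in> A"
  and units_nonzero: "u \<in> units \<Longrightarrow> u \<noteq> 0"
  and units_inverse_closed: "u \<in> units \<Longrightarrow> inverse u \<in> A"
  by (auto simp: units_def)

lemma units_one [simp]: "1 \<in> units"
  by (simp add: units_def)

lemma units_mult: "u \<in> units \<Longrightarrow> v \<in> units \<Longrightarrow> u * v \<in> units"
  by (auto simp: units_def)

lemma units_uminus: "u \<in> units \<Longrightarrow> - u \<in> units"
  by (auto simp: units_def)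

lemma units_inverse: "u \<in> units \<Longrightarrow> inverse u \<in> units"
  by (auto simp: units_def)

lemma units_power: "u \<in> units \<Longrightarrow> u ^ k \<in> units"
  by (induction k) (auto intro: units_mult)

lemma units_prod: "(\<And>i. i \<in> I \<Longrightarrow> f i \<in> units) \<Longrightarrow> prod f I \<in> units"
  by (induction I rule: infinite_finite_induct) (auto intro: units_mult)

lemma units_factor: "u \<in> A \<Longrightarrow> v \<in> A \<Longrightarrow> u * v \<in> units \<Longrightarrow> u \<in> units"
proof -
  assume a: "u \<in> A" "v \<in> A" "u * v \<in> units"
  then have uv: "u * v \<noteq> 0" "inverse (u * v) \<in> A"
    unfolding units_def by blast+
  then have "inverse u = v * inverse (u * v)" "u \<noteq> 0"
    by auto
  then show ?thesis
    unfolding units_def using a(1) mult_closed[OF a(2) uv(2)] by (simp only: mem_Collect_eq not_False_eq_True simp_thms)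
qed

lemma cg_units_inverse:
  "cg n u v \<Longrightarrow> u \<in> units \<Longrightarrow> v \<in> units \<Longrightarrow> cg n (inverse u) (inverse v)"
  by (rule cg_inverse) (auto simp: units_def)

end

locale padic_ring = adic_subring W "of_nat p" for W :: "'K::field_char_0 set" and p :: nat +
  assumes prime_p: "Factorial_Ring.prime p"
    and separated: "\<And>z. z \<in> W \<Longrightarrow> (\<And>n. cg n z 0) \<Longrightarrow> z = 0"
    and complete: "\<And>y. (\<And>n. y n \<in> W) \<Longrightarrow> (\<And>n. cg n (y (Suc n)) (y n)) \<Longrightarrow>
      \<exists>L\<in>W. \<forall>n. cg n (y n) L"
begin

abbreviation P :: 'K where "P \<equiv> of_nat p"

lemma p_gt_1: "p > 1" and p_gt_0 [simp]: "p > 0"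
  using prime_gt_1_nat[OF prime_p] prime_gt_0_nat[OF prime_p] by auto

lemma units_near_one:
  assumes "cg 1 u 1"
  shows "u \<in> units"
proof -
  define z where "z = 1 - u"
  have u: "u \<in> W"
    using assms cg_closed by simp
  have z: "z \<in> W" "cg 1 z 0"
    using assms u cg_diff[OF cg_refl[of 1 1] assms] by (auto simp: z_def)
  have zn: "cg n (z ^ n) 0" for n
  proof -
    obtain w where "w \<in> W" "z = P * w"
      using z(2) by (auto simp: cg_def)
    then show ?thesis
      by (simp add: power_mult_distrib cg_multiple)
  qed
  define y where "y = (\<lambda>n. \<Sum>i<n. z ^ i)"
  have y: "y n \<in> W" for n
    using z by (auto simp: y_def intro!: sum_closed)
  moreover have "cg n (y (Suc n)) (y n)" for n
    using cg_add[OF cg_refl[of n "\<Sum>i<n. z ^ i"] zn[of n]] by (simp add: y_def)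
  ultimately obtain L where L: "L \<in> W" "\<And>n. cg n (y n) L"
    using complete[of y] by blast
  have "cg n (u * L - 1) 0" for n
  proof -
    have "u * y n = (1 - z) * (\<Sum>i<n. z ^ i)"
      by (simp add: y_def z_def)
    also have "\<dots> = 1 - z ^ n"
      by (simp add: one_diff_power_eq)
    finally have "cg n (u * y n) 1"
      using cg_diff[OF cg_refl[of n 1] zn[of n]] by simp
    then show ?thesis
      using cg_mult_left[OF L(2)[of n] u] cg_sym cg_trans by (subst cg_diff_0) blast
  qed
  then have "u * L - 1 = 0"
    using L(1) u by (intro separated) auto
  then show ?thesis
    using units_factor[of u L] L(1) u by simp
qed

lemma units_cong:
  assumes "cg 1 u v" "v \<in> units"
  shows "u \<in> units"
proof -
  have "v * inverse v = 1"
    using units_nonzero[OF assms(2)] by simp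
  then have "cg 1 (u * inverse v) 1"
    using cg_mult_right[OF assms(1) units_inverse_closed[OF assms(2)]] by simp
  then have "u * inverse v \<in> units"
    by (rule units_near_one)
  then show ?thesis
    using units_factor[of u "inverse v"] cg_closed[OF assms(1) units_closed[OF assms(2)]]
      units_inverse_closed[OF assms(2)] by simp
qed

lemma of_int_units:
  assumes "\<not> int p dvd k"
  shows "of_int k \<in> units"
proof -
  have "coprime k (int p)"
    using assms prime_p prime_imp_coprime[of "int p" k] by (simp add: coprime_commute)
  then obtain u v where "u * k + v * int p = 1"
    using bezout_int[of k "int p"] by auto
  then have "(of_int (u * k + v * int p) :: 'K) = of_int 1"
    by (simp only:)
  then have "of_int k * of_int u - 1 = P * of_int (- v)"
    by (simp add: algebra_simps)
  then have "cg 1 (of_int k * of_int u) 1"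
    unfolding cg_def power_one_right by (intro bexI[of _ "of_int (- v)"]) auto
  then show ?thesis
    using units_near_one units_factor of_int_closed by blast
qed

lemma of_nat_units: "\<not> p dvd k \<Longrightarrow> of_nat k \<in> units"
  using of_int_units[of "int k"] by simp

lemma inverse_P_notin: "inverse P \<notin> W"
proof
  assume "inverse P \<in> W"
  then have "cg n 1 0" for n
    unfolding cg_def by (intro bexI[of _ "inverse P ^ n"]) (simp_all flip: power_mult_distrib)
  then show False
    using separated[of 1] by simp
qed

text \<open>A further factor p that exists in \<open>W\<close> but not in the integers would divide
  a unit, and 1/p would lie in \<open>W\<close>, contrary to separatedness.\<close>

lemma cg_of_int_0_iff: "cg n (of_int k) 0 \<longleftrightarrow> int (p ^ n) dvd k"
proof (induction n)
  case (Suc n)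
  show ?case
  proof
    assume "int (p ^ Suc n) dvd k"
    then obtain j where "k = int (p ^ Suc n) * j" ..
    then show "cg (Suc n) (of_int k) 0"
      using cg_multiple[of "of_int j" "Suc n" "Suc n"] by simp
  next
    assume *: "cg (Suc n) (of_int k) 0"
    then have "int (p ^ n) dvd k"
      using cg_mono[of "Suc n" "of_int k" 0 n] Suc by simp
    then obtain j where j: "k = int (p ^ n) * j" ..
    from * obtain w where w: "w \<in> W" "of_int k = P ^ Suc n * w"
      by (auto simp: cg_def)
    have "P ^ n * of_int j = P ^ n * (P * w)"
      using w(2) by (simp add: j mult.assoc mult.left_commute)
    then have "of_int j = P * w"
      by (simp only: mult_cancel_left power_eq_0_iff x_nonzero simp_thms)
    have "int p dvd j"
    proof (rule ccontr)
      assume "\<not> int p dvd j"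
      then have "of_int j \<in> units"
        by (rule of_int_units)
      moreover have "inverse P = w * inverse (of_int j)"
        using \<open>of_int j = P * w\<close> units_nonzero[OF \<open>of_int j \<in> units\<close>] by (simp add: field_simps)
      ultimately show False
        using inverse_P_notin w(1) units_inverse_closed by simp
    qed
    then show "int (p ^ Suc n) dvd k"
      by (auto simp: j)
  qed
qed (simp add: cg_0)

lemma cg_of_nat_0_iff: "cg n (of_nat k) 0 \<longleftrightarrow> p ^ n dvd k"
  using cg_of_int_0_iff[of n "int k"] by (simp only: of_int_of_nat_eq of_nat_dvd_iff)

lemma cg_of_int_iff: "cg n (of_int k) (of_int j) \<longleftrightarrow> int (p ^ n) dvd k - j"
  using cg_of_int_0_iff[of n "k - j"] cg_diff_0 by simp

lemma PIdl_iff: "z \<in> PIdl\<^bsub>ring_on W\<^esub> (of_nat (p ^ n)) \<longleftrightarrow> cg n z 0"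
  using PIdl_ring_on[of z n] by simp

lemma Zp_iff: "z \<in> Zp W p \<longleftrightarrow> z \<in> W \<and> (\<forall>n. \<exists>m::int. cg n z (of_int m))"
  by (simp only: Zp_def PIdl_iff cg_diff_0 mem_Collect_eq)

lemma Zp_closed: "z \<in> Zp W p \<Longrightarrow> z \<in> W"
  by (simp add: Zp_iff)

text \<open>The bound \<open>N\<close> serves, with N = 0, to obtain nonzero approximations.\<close>

lemma Zp_approx:
  assumes "z \<in> Zp W p"
  obtains m :: nat where "m > N" "cg n z (of_nat m)"
proof -
  obtain k :: int where k: "cg n z (of_int k)"
    using assms Zp_iff by blast
  define m where "m = nat (k mod int (p ^ n)) + p ^ n * Suc N"
  have *: "int (nat (k mod int (p ^ n))) = k mod int (p ^ n)"
    by (simp add: prime_gt_0_nat[OF prime_p])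
  have "k - int m = int (p ^ n) * (k div int (p ^ n) - int (Suc N))"
    unfolding m_def of_nat_add of_nat_mult *
    by (simp only: right_diff_distrib minus_mod_eq_mult_div[symmetric] diff_diff_eq)
  then have "int (p ^ n) dvd k - int m"
    by simp
  then have "cg n (of_int k) (of_int (int m))"
    by (simp only: cg_of_int_iff)
  then have "cg n z (of_nat m)"
    using cg_trans[OF k] by simp
  moreover have "Suc N \<le> p ^ n * Suc N"
    using p_gt_0 by (metis One_nat_def Suc_leI mult.commute mult_le_mono2 nat_mult_1_right zero_less_power)
  then have "m > N"
    unfolding m_def by simp
  ultimately show ?thesis
    using that by blast
qed

lemma Zp_of_nat [simp]: "of_nat k \<in> Zp W p"
  using Zp_iff by (metis cg_refl of_int_of_nat_eq of_nat_closed)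

lemma Zp_uminus: "z \<in> Zp W p \<Longrightarrow> - z \<in> Zp W p"
  unfolding Zp_iff using cg_minus by (metis of_int_minus uminus_closed)

lemma Zp_add: "z \<in> Zp W p \<Longrightarrow> z' \<in> Zp W p \<Longrightarrow> z + z' \<in> Zp W p"
  unfolding Zp_iff using cg_add by (metis of_int_add add_closed)

lemma Zp_P_mult: "P * z \<in> Zp W p \<Longrightarrow> z \<in> W \<Longrightarrow> z \<in> Zp W p"
proof -
  assume Pz: "P * z \<in> Zp W p" and z: "z \<in> W"
  have "\<exists>m::int. cg n z (of_int m)" for n
  proof -
    obtain k :: int where k: "cg (Suc n) (P * z) (of_int k)"
      using Pz Zp_iff by blast
    have "cg 1 (P * z) 0"
      using cg_multiple[OF z, of 1 1] by simp
    then have "cg 1 (of_int k) 0"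
      using cg_trans[OF cg_sym[OF cg_mono[OF k, of 1]]] by simp
    then have "int p dvd k"
      using cg_of_int_0_iff[of 1 k] by simp
    then obtain j where "k = int p * j" ..
    then have "cg (Suc n) (P * z) (P * of_int j)"
      using k by simp
    then show ?thesis
      using cg_x_mult_Suc by blast
  qed
  with z show ?thesis
    by (simp add: Zp_iff)
qed

lemma neg_residue_unique:
  assumes "l < p ^ j" "cg j (b + of_nat l) 0"
  shows "neg_residue W (p ^ j) b = l"
  unfolding neg_residue_def PIdl_iff
proof (rule the_equality)
  fix l'
  assume l': "l' < p ^ j \<and> cg j (b + of_nat l') 0"
  then have "cg j (b + of_nat l' - (b + of_nat l)) (0 - 0)"
    using assms cg_diff by blast
  then have "cg j (of_int (int l')) (of_int (int l))"
    using cg_diff_0 by simp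
  then have "int (p ^ j) dvd int l' - int l"
    by (simp only: cg_of_int_iff)
  then show "l' = l"
    using l' assms(1)
    by (metis mod_eq_dvd_iff mod_less of_nat_eq_iff zmod_int)
qed (use assms in simp)

lemma neg_residue:
  assumes "b \<in> Zp W p"
  shows "neg_residue W (p ^ j) b < p ^ j" "cg j (b + of_nat (neg_residue W (p ^ j) b)) 0"
proof -
  obtain m :: nat where m: "cg j (- b) (of_nat m)"
    using Zp_approx[OF Zp_uminus[OF assms]] by blast
  define l where "l = m mod p ^ j"
  have "cg j (of_int (int m)) (of_int (int l))"
    unfolding cg_of_int_iff l_def by (simp add: zmod_int flip: mod_eq_dvd_iff)
  then have "cg j (- b) (of_nat l)"
    using cg_trans[OF m] by simp
  then have l: "cg j (b + of_nat l) 0"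
    using cg_add[OF cg_refl[of j b]] cg_sym by fastforce
  moreover have "l < p ^ j"
    unfolding l_def by simp
  ultimately have "neg_residue W (p ^ j) b = l"
    by (rule neg_residue_unique[rotated])
  then show "neg_residue W (p ^ j) b < p ^ j" "cg j (b + of_nat (neg_residue W (p ^ j) b)) 0"
    using l \<open>l < p ^ j\<close> by simp_all
qed

abbreviation res :: "'K \<Rightarrow> nat" where "res \<equiv> neg_residue W p"

abbreviation prm :: "'K \<Rightarrow> 'K" where "prm \<equiv> dwork_prime W p"

lemma res: "b \<in> Zp W p \<Longrightarrow> res b < p" "b \<in> Zp W p \<Longrightarrow> cg 1 (b + of_nat (res b)) 0"
  using neg_residue[of b 1] by simp_all

lemma prm_eq: "P * prm b = b + of_nat (res b)"
  by (simp add: dwork_prime_def)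

lemma prm_Zp: "b \<in> Zp W p \<Longrightarrow> prm b \<in> Zp W p"
proof -
  assume b: "b \<in> Zp W p"
  then obtain w where "w \<in> W" "P * w = b + of_nat (res b)"
    using res(2)[of b] by (auto simp: cg_def)
  then have "prm b \<in> W"
    using prm_eq[of b] by (metis mult_cancel_left x_nonzero)
  then show ?thesis
    using b Zp_P_mult[of "prm b"] Zp_add[OF b Zp_of_nat] by (simp add: prm_eq)
qed

lemma cg_add_of_nat_0_iff:
  assumes "b \<in> Zp W p"
  shows "cg 1 (b + of_nat i) 0 \<longleftrightarrow> i mod p = res b"
proof -
  have "int (p ^ 1) dvd int i - int (i mod p)"
    by (simp add: zmod_int flip: mod_eq_dvd_iff)
  then have mod_p: "cg 1 (of_nat i) (of_nat (i mod p))"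
    using cg_of_int_iff[of 1 "int i" "int (i mod p)"] by simp
  show ?thesis
  proof
  assume "cg 1 (b + of_nat i) 0"
  moreover note cg_sym[OF mod_p]
  ultimately have "cg 1 (b + of_nat (i mod p)) 0"
    using cg_add[OF cg_refl[of 1 b]] cg_trans by blast
  then show "i mod p = res b"
    using neg_residue_unique[of "i mod p" 1 b] by simp
next
  assume i: "i mod p = res b"
  then show "cg 1 (b + of_nat i) 0"
    using cg_add[OF cg_refl[of 1 b] mod_p] cg_trans res(2)[OF assms] i by simp
qed
qed

lemma units_iff_not_cg_0:
  assumes "z \<in> Zp W p"
  shows "z \<in> units \<longleftrightarrow> \<not> cg 1 z 0"
proof
  obtain m :: nat where m: "cg 1 z (of_nat m)"
    using Zp_approx[OF assms] by blast
  show "z \<in> units" if "\<not> cg 1 z 0"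
  proof -
    have "\<not> cg 1 (of_nat m) 0"
      using that m cg_trans by blast
    then have "\<not> p dvd m"
      using cg_of_nat_0_iff[of 1 m] by simp
    then show ?thesis
      using units_cong[OF m of_nat_units] by simp
  qed
  show "\<not> cg 1 z 0" if z: "z \<in> units"
  proof
    assume "cg 1 z 0"
    then obtain w where "w \<in> W" "z = P * w"
      by (auto simp: cg_def)
    moreover from this have "w \<noteq> 0"
      using units_nonzero[OF z] by auto
    ultimately have "inverse P = w * inverse z" "w * inverse z \<in> W"
      using units_inverse_closed[OF z] by (simp_all del: inverse_mult_distrib, simp)
    then show False
      using inverse_P_notin by simp
  qed
qed

end

section \<open>Hypergeometric coefficients modulo powers of a prime\<close>

context padic_ring
begin

lemma p_neq_0 [simp]: "p \<noteq> 0"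
  using p_gt_0 by simp

lemma cg_uminus_0_iff: "cg n (- u) 0 \<longleftrightarrow> cg n u 0"
  using cg_minus[of n u 0] cg_minus[of n "- u" 0] by auto

lemma div_p_eq: "v < p \<Longrightarrow> (v + p * k) div p = k"
  by simp

text \<open>The product of the i \<le> n prime to p, up to sign the value of Morita's p-adic Gamma
  function at n + 1.\<close>

primrec pfac :: "nat \<Rightarrow> 'K" where
  "pfac 0 = 1"
| "pfac (Suc n) = pfac n * (if p dvd Suc n then 1 else of_nat (Suc n))"

lemma pfac_units: "pfac n \<in> units"
proof (induction n)
  case (Suc n)
  then show ?case
    using of_nat_units[of "Suc n"] by (simp add: units_mult del: of_nat_Suc)
qed simp

lemma fact_split: "fact n = P ^ (n div p) * fact (n div p) * pfac n"
proof (induction n)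
  case (Suc n)
  show ?case
  proof (cases "p dvd Suc n")
    case True
    then have "Suc n div p = Suc (n div p)"
      by (simp add: div_Suc mod_eq_0_iff_dvd)
    moreover from True this have "Suc n = p * Suc (n div p)"
      by (metis dvd_mult_div_cancel)
    then have "(of_nat (Suc n) :: 'K) = P * of_nat (Suc (n div p))"
      by (metis of_nat_mult)
    ultimately show ?thesis
      using Suc True by (simp del: of_nat_Suc add: mult_ac)
  next
    case False
    then have "Suc n div p = n div p"
      by (simp add: div_Suc mod_eq_0_iff_dvd)
    then show ?thesis
      using Suc False by (simp del: of_nat_Suc add: mult_ac)
  qed
qed simp

text \<open>Up to a unit, i! is p^j j! with j = i div p. Because 2 j \<le> i, a second factor p^j
  remains to be divided by j! in the induction.\<close>

lemma power_div_fact_closed: "P ^ i / fact i \<in> W"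
proof (induction i rule: less_induct)
  case (less i)
  show ?case
  proof (cases "i = 0")
    case False
    define j where "j = i div p"
    have "j < i"
      using False p_gt_1 by (simp add: j_def)
    have "2 * j \<le> p * j"
      using p_gt_1 by simp
    also have "\<dots> \<le> i"
      by (simp add: j_def)
    finally have "P ^ i = P ^ j * P ^ j * P ^ (i - 2 * j)"
      by (simp flip: power_add mult_2)
    then have "P ^ i / fact i = P ^ (i - 2 * j) * (P ^ j / fact j) * inverse (pfac i)"
      using fact_split[of i] units_nonzero[OF pfac_units] by (simp add: j_def field_simps)
    then show ?thesis
      using less[OF \<open>j < i\<close>] units_inverse_closed[OF pfac_units] by (simp only: mult_closed power_closed x_closed)
  qed simp
qed

lemma cg_fact_gchoose:
  assumes "cg M z z'" "z \<in> W" "z' \<in> W"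
  shows "cg M (fact i * (z gchoose i)) (fact i * (z' gchoose i))"
proof -
  have "fact i * (y gchoose i) = (\<Prod>k = 0..<i. y - of_nat k)" for y :: 'K
    by (simp add: gbinomial_prod_rev)
  then show ?thesis
    using assms by (auto intro!: cg_prod cg_diff)
qed

text \<open>Multiplied by i!, the binomial coefficient is an integral polynomial in z, and p^i
  absorbs i!. Thus no precision is lost, which makes binomial series on 1 + pW as continuous in the
  exponent as the exponent itself.\<close>

lemma cg_gchoose_power:
  assumes "cg M z z'" "z \<in> W" "z' \<in> W"
  shows "cg M ((z gchoose i) * P ^ i) ((z' gchoose i) * P ^ i)"
  using cg_mult_left[OF cg_fact_gchoose[OF assms, of i] power_div_fact_closed[of i]]
  by (simp add: mult.commute)

lemma cg_gchoose:
  assumes "cg (i + M) z z'" "z \<in> W" "z' \<in> W"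
  shows "cg M (z gchoose i) (z' gchoose i)"
  using cg_gchoose_power[OF assms, of i] cg_x_mult[of i M "z gchoose i" "z' gchoose i"]
  by (simp add: mult.commute)

lemma gchoose_closed:
  assumes "z \<in> Zp W p"
  shows "z gchoose i \<in> W"
proof -
  obtain m :: nat where "cg (i + 0) z (of_nat m)"
    using Zp_approx[OF assms] by blast
  then have "cg 0 (z gchoose i) (of_nat m gchoose i)"
    using Zp_closed[OF assms] by (intro cg_gchoose) auto
  moreover have "(of_nat m gchoose i :: 'K) \<in> W"
    by (simp flip: binomial_gbinomial)
  ultimately show ?thesis
    using cg_closed by blast
qed

section \<open>Splitting the hypergeometric coefficients at the last digit of the index\<close>

definition hc :: "'K \<Rightarrow> nat \<Rightarrow> 'K" where
  "hc b k = pochhammer b k / fact k"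

lemma hyp_fps_nth: "fps_nth (hyp_fps s b) k = hc b k ^ s"
  by (simp add: hyp_fps_def hc_def)

lemma hc_0 [simp]: "hc b 0 = 1"
  by (simp add: hc_def)

lemma hc_eq_gchoose: "hc b k = (- 1) ^ k * (- b gchoose k)"
  by (simp add: hc_def gbinomial_pochhammer)

lemma hc_closed: "b \<in> Zp W p \<Longrightarrow> hc b k \<in> W"
  using gchoose_closed[OF Zp_uminus] by (simp add: hc_eq_gchoose)

lemma hc_Suc: "hc b k * (b + of_nat k) = hc b (Suc k) * of_nat (Suc k)"
  by (simp add: hc_def pochhammer_Suc del: of_nat_Suc)

text \<open>The analogue of \<open>pfac\<close> for the numerator: the index condition singles out
  the factors divisible by p.\<close>

primrec ppoch :: "'K \<Rightarrow> nat \<Rightarrow> 'K" where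
  "ppoch b 0 = 1"
| "ppoch b (Suc n) = ppoch b n * (if n mod p = res b then 1 else b + of_nat n)"

text \<open>The part of (b)_n / n! that is prime to p. Up to sign it is the quotient of \<Gamma>_p(b
  + n) by \<Gamma>_p(b) \<Gamma>_p(1 + n).\<close>

definition rho :: "'K \<Rightarrow> nat \<Rightarrow> 'K" where
  "rho b n = ppoch b n / pfac n"

lemma ppoch_units:
  assumes "b \<in> Zp W p"
  shows "ppoch b n \<in> units"
proof (induction n)
  case (Suc n)
  have "b + of_nat n \<in> units" if "n mod p \<noteq> res b"
    using that assms units_iff_not_cg_0[OF Zp_add[OF assms Zp_of_nat]] cg_add_of_nat_0_iff by simp
  then show ?case
    using Suc by (simp add: units_mult)
qed simp

lemma rho_units: "b \<in> Zp W p \<Longrightarrow> rho b n \<in> units"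
  unfolding rho_def divide_inverse by (intro units_mult units_inverse ppoch_units pfac_units)

lemma rho_0 [simp]: "rho b 0 = 1"
  by (simp add: rho_def)

text \<open>With l = \<open>res b\<close>, the factors divisible by p are those with i = l + p j,
  where b + i = p (b' + j). The exponent (n + (p - 1 - l)) div p is the number of such i below
  n.\<close>

lemma pochhammer_split:
  assumes "b \<in> Zp W p"
  shows "pochhammer b n = P ^ ((n + (p - 1 - res b)) div p)
    * pochhammer (prm b) ((n + (p - 1 - res b)) div p) * ppoch b n"
proof (induction n)
  case 0
  show ?case
    using p_gt_0 by simp
next
  case (Suc n)
  define l where "l = res b"
  define K where "K = (n + (p - 1 - l)) div p"
  have l: "l < p"
    using res(1)[OF assms] by (simp add: l_def)
  show ?case
  proof (cases "n mod p = l")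
    case True
    define j where "j = n div p"
    have n: "n = l + p * j"
      using True mult_div_mod_eq[of p n] by (simp add: j_def)
    have K: "K = j"
    proof -
      have "n + (p - 1 - l) = (p - 1) + p * j" "p - 1 < p"
        using l by (simp_all add: n)
      then show ?thesis
        unfolding K_def using div_p_eq by (simp only:)
    qed
    have "Suc n + (p - 1 - l) = p * Suc j"
      using l by (simp add: n)
    then have SK: "(Suc n + (p - 1 - l)) div p = Suc K"
      using K p_gt_0 by (metis nonzero_mult_div_cancel_left less_numeral_extra(3))
    have "b + of_nat n = P * (prm b + of_nat j)"
      using prm_eq[of b] by (simp add: n algebra_simps l_def)
    then show ?thesis
      using Suc SK K True by (simp add: pochhammer_Suc l_def K_def mult_ac)
  next
    case False
    have "(Suc n + (p - 1 - l)) div p = K"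
    proof -
      define j where "j = n div p"
      define v where "v = n mod p"
      have n: "n = v + p * j" and v: "v < p" "v \<noteq> l"
        using False mult_div_mod_eq[of p n] by (auto simp: j_def v_def)
      consider "v < l" | "v > l" using v by linarith
      then show ?thesis
      proof cases
        case 1
        then have "n + (p - 1 - l) = (v + (p - 1 - l)) + p * j" "v + (p - 1 - l) < p"
          "Suc n + (p - 1 - l) = Suc (v + (p - 1 - l)) + p * j" "Suc (v + (p - 1 - l)) < p"
          using l by (simp_all add: n)
        then show ?thesis
          unfolding K_def using div_p_eq by (simp only:)
      next
        case 2
        then have "n + (p - 1 - l) = (v - 1 - l) + p * Suc j" "v - 1 - l < p"
          "Suc n + (p - 1 - l) = (v - l) + p * Suc j" "v - l < p"
          using l v by (simp_all add: n)
        then show ?thesis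
          unfolding K_def by (metis add.commute div_less div_mult_self2 add_0 less_numeral_extra(3) p_gt_0)
      qed
    qed
    then show ?thesis
      using Suc False by (simp add: pochhammer_Suc l_def K_def mult_ac)
  qed
qed

text \<open>For these last digits the numerator and the factorial contain the same number k of
  multiples of p, so the powers of p cancel.\<close>

lemma hc_low:
  assumes "b \<in> Zp W p" "u \<le> res b"
  shows "hc b (u + p * k) = hc (prm b) k * rho b (u + p * k)"
proof -
  have l: "res b < p"
    using res(1)[OF assms(1)] .
  have "u + p * k + (p - 1 - res b) = (u + (p - 1 - res b)) + p * k" "u + (p - 1 - res b) < p"
    using assms l by simp_all
  then have K: "(u + p * k + (p - 1 - res b)) div p = k"
    using div_p_eq by (simp only:)
  have "u < p"
    using assms l by simp
  then have k: "(u + p * k) div p = k"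
    by simp
  show ?thesis
    using pochhammer_split[OF assms(1), of "u + p * k"] fact_split[of "u + p * k"]
    unfolding K k by (simp add: hc_def rho_def)
qed

text \<open>Here the numerator contains one more multiple of p, the factor with index
  \<open>res b\<close> + p k, which equals p (b' + k).\<close>

lemma hc_high:
  assumes "b \<in> Zp W p" "res b < u" "u < p"
  shows "hc b (u + p * k) = hc (prm b) k * (P * (prm b + of_nat k) * rho b (u + p * k))"
proof -
  have "u + p * k + (p - 1 - res b) = (u - 1 - res b) + p * Suc k" "u - 1 - res b < p"
    using assms by simp_all
  then have K: "(u + p * k + (p - 1 - res b)) div p = Suc k"
    by (metis add.commute div_less div_mult_self2 add_0 less_numeral_extra(3) p_gt_0)
  have k: "(u + p * k) div p = k"
    using assms by simp
  show ?thesis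
    using pochhammer_split[OF assms(1), of "u + p * k"] fact_split[of "u + p * k"]
    unfolding K k by (simp add: hc_def rho_def pochhammer_Suc mult_ac)
qed

lemma cg_mod_unique: "cg j (b + of_nat N) 0 \<Longrightarrow> neg_residue W (p ^ j) b = N mod p ^ j"
proof (rule neg_residue_unique)
  assume *: "cg j (b + of_nat N) 0"
  have "int (p ^ j) dvd int (N mod p ^ j) - int N"
    by (simp only: zmod_int mod_eq_dvd_iff[symmetric] mod_mod_trivial)
  then have "cg j (of_nat (N mod p ^ j)) (of_nat N)"
    using cg_of_int_iff[of j "int (N mod p ^ j)" "int N"] by (simp only: of_int_of_nat_eq)
  then show "cg j (b + of_nat (N mod p ^ j)) 0"
    using cg_add[OF cg_refl[of j b]] cg_trans * by blast
qed simp

section \<open>Reflection of the unit parts of the coefficients\<close>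

definition nu :: "nat \<Rightarrow> nat" where
  "nu n = n - n div p"

primrec spfac :: "nat \<Rightarrow> 'K" where
  "spfac 0 = 1"
| "spfac (Suc n) = spfac n * (if p dvd Suc n then 1 else - of_nat (Suc n))"

lemma nu_Suc: "nu (Suc n) = (if p dvd Suc n then nu n else Suc (nu n))"
proof -
  show ?thesis
    by (auto simp: nu_def div_Suc mod_eq_0_iff_dvd Suc_diff_le)
qed

lemma spfac_eq: "spfac n = (- 1) ^ nu n * pfac n"
  by (induction n) (simp_all add: nu_Suc nu_def[of 0] del: of_nat_Suc)

text \<open>The left-hand side does not depend on n modulo p^M. Going from n to n + 1 moves the
  factor b + n, which is congruent to -(N - n), from \<open>spfac\<close> to \<open>ppoch\<close>;
  as M \<ge> 1, it is omitted from both under the same condition.\<close>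

lemma ppoch_mult_spfac:
  assumes "b \<in> Zp W p" "M \<ge> 1" "cg M (b + of_nat N) 0" "n \<le> N"
  shows "cg M (ppoch b n * spfac (N - n)) (spfac N)"
  using assms(4)
proof (induction n)
  case (Suc n)
  define j where "j = N - Suc n"
  have j: "N - n = Suc j" "N = Suc j + n"
    using Suc.prems by (simp_all add: j_def)
  have bn: "cg M (b + of_nat n) (- of_nat (Suc j))"
  proof -
    have "b + of_nat N - of_nat (Suc j) = b + of_nat n"
      by (simp add: j(2))
    then show ?thesis
      using cg_diff[OF assms(3) cg_refl[of M "of_nat (Suc j)"]] by (simp only: diff_0)
  qed
  have l: "n mod p = res b \<longleftrightarrow> p dvd Suc j"
  proof -
    have "n mod p = res b \<longleftrightarrow> cg 1 (b + of_nat n) 0"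
      using cg_add_of_nat_0_iff[OF assms(1)] by simp
    also have "\<dots> \<longleftrightarrow> cg 1 (- of_nat (Suc j)) 0"
      using cg_mono[OF bn assms(2)] cg_sym cg_trans by blast
    also have "\<dots> \<longleftrightarrow> cg 1 (of_nat (Suc j)) 0"
      by (rule cg_uminus_0_iff)
    finally show ?thesis
      using cg_of_nat_0_iff[of 1 "Suc j"] by simp
  qed
  have IH: "cg M (ppoch b n * spfac (Suc j)) (spfac N)"
    using Suc j(1) by simp
  have sj: "spfac j \<in> W"
    using units_closed[OF pfac_units] by (simp add: spfac_eq)
  have "cg M (ppoch b (Suc n) * spfac j) (ppoch b n * spfac (Suc j))"
  proof (cases "p dvd Suc j")
    case True
    then show ?thesis
      using l by simp
  next
    case False
    have "cg M (ppoch b n * spfac j * (b + of_nat n)) (ppoch b n * spfac j * - of_nat (Suc j))"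
      using units_closed[OF ppoch_units[OF assms(1)]] sj bn by (intro cg_mult_left) auto
    then show ?thesis
      using l False by (simp add: mult_ac del: of_nat_Suc)
  qed
  then show ?case
    using IH cg_trans j_def by blast
qed simp

text \<open>With N = n + n', \<open>rho b n\<close> is up to sign congruent to pfac N / (pfac n pfac
  n'), which is symmetric in n and n'. The rest is bookkeeping of the two signs.\<close>

lemma rho_reflect_nu:
  assumes "b \<in> Zp W p" "M \<ge> 1" "cg M (b + of_nat (n + n')) 0"
  shows "cg M (rho b n) ((- 1) ^ (nu n + nu n') * rho b n')"
proof -
  define N where "N = n + n'"
  have half: "cg M (rho b i) ((- 1) ^ (nu N + nu j) * (pfac N / (pfac i * pfac j)))"
    if ij: "i + j = N" for i j
  proof -
    have "i \<le> N" "N - i = j"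
      using ij by simp_all
    then have "cg M (ppoch b i * spfac j) (spfac N)"
      using ppoch_mult_spfac[of b M N i] assms by (simp add: N_def)
    moreover have "pfac i * spfac j \<in> units"
      unfolding spfac_eq by (intro units_mult pfac_units units_power units_uminus units_one)
    ultimately have "cg M (ppoch b i * spfac j / (pfac i * spfac j)) (spfac N / (pfac i * spfac j))"
      unfolding divide_inverse by (intro cg_mult_right units_inverse_closed)
    moreover have "ppoch b i * spfac j / (pfac i * spfac j) = rho b i"
      using units_nonzero[OF pfac_units] by (simp add: rho_def spfac_eq)
    moreover have "spfac N / (pfac i * spfac j) = (- 1) ^ (nu N + nu j) * (pfac N / (pfac i * pfac j))"
      by (cases "even (nu j)") (simp_all add: spfac_eq power_add)
    ultimately show ?thesis
      by simp
  qed
  have "cg M (rho b n) ((- 1) ^ (nu N + nu n') * (pfac N / (pfac n * pfac n')))"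
    using half[of n n'] by (simp add: N_def)
  also have "(- 1) ^ (nu N + nu n') * (pfac N / (pfac n * pfac n')) =
      (- 1) ^ (nu n + nu n') * ((- 1) ^ (nu N + nu n) * (pfac N / (pfac n' * pfac n)))"
    by (cases "even (nu n)") (simp_all add: power_add mult_ac)
  also have "cg M \<dots> ((- 1) ^ (nu n + nu n') * rho b n')"
    using half[of n' n] by (intro cg_mult_left cg_sym[OF half]) (simp_all add: N_def)
  finally show ?thesis .
qed

text \<open>For N = n + n', the sum nu n + nu n' exceeds nu N by the carry in adding the last digits
  of n and n', which is 1 exactly if the digit of n is larger than \<open>res b\<close>. For odd p
  the parity of nu N depends only on N mod p, since p - 1 is even. For p = 2 it depends on N mod 4,
  which b determines once M \<ge> 2.\<close>

lemma sign_exponent_parity: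
  assumes "b \<in> Zp W p" "cg M (b + of_nat (n + n')) 0" "M \<ge> 1" "odd p \<or> M \<ge> 2"
  shows "even (nu n + nu n') \<longleftrightarrow>
    even (hyp_sign_exponent W p b + (if n mod p \<le> res b then 0 else 1))"
proof -
  define N where "N = n + n'"
  have N: "N mod p = res b"
    using cg_mod_unique[of 1 b N] cg_mono[OF assms(2,3)] by (simp add: N_def)
  have e: "even (nu N) \<longleftrightarrow> even (hyp_sign_exponent W p b)"
  proof (cases "p = 2")
    case True
    define L where "L = N mod 4"
    define K where "K = N div 4"
    have NL: "N = L + 4 * K"
      by (simp add: L_def K_def)
    have "neg_residue W 4 b = L"
      using cg_mod_unique[of 2 b N] cg_mono[OF assms(2), of 2] assms(4) True
      by (simp add: N_def L_def)
    moreover have "nu N = (L - L div 2) + 2 * K"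
    proof -
      have "(L + 4 * K) div 2 = L div 2 + 2 * K"
        by simp
      then show ?thesis
        unfolding nu_def NL using True by simp
    qed
    moreover have "L div 2 \<le> L"
      by simp
    ultimately show ?thesis
      using True by (simp add: hyp_sign_exponent_def Let_def not_less[symmetric])
  next
    case False
    then have "odd p"
      using prime_p primes_dvd_imp_eq two_is_prime_nat by blast
    define K where "K = N div p"
    have NL: "N = res b + p * K"
      using mult_div_mod_eq[of p N] by (simp add: K_def N)
    have "nu N = res b + (p - 1) * K"
    proof -
      have "nu N = N - K"
        by (simp add: nu_def K_def)
      also have "\<dots> = res b + (p - 1) * K"
        using p_gt_0 by (cases p) (simp_all add: NL)
      finally show ?thesis .
    qed
    moreover have "hyp_sign_exponent W p b = res b"
      using False res(1)[OF assms(1)] by (simp add: hyp_sign_exponent_def Let_def)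
    ultimately show ?thesis
      using \<open>odd p\<close> p_gt_0 by simp
  qed
  have le: "i div p \<le> i" for i
    by simp
  have "N div p = n div p + n' div p + (n mod p + n' mod p) div p"
    unfolding N_def by (rule div_add1_eq)
  moreover have "(n mod p + n' mod p) div p = (if n mod p \<le> res b then 0 else 1)"
  proof -
    have v: "n mod p < p" "n' mod p < p"
      by simp_all
    have s: "(n mod p + n' mod p) mod p = res b"
      using N by (simp add: N_def mod_add_eq)
    show ?thesis
    proof (cases "n mod p + n' mod p < p")
      case True
      then show ?thesis
        using s by simp
    next
      case False
      then have "n mod p + n' mod p = (n mod p + n' mod p - p) + p * 1" "n mod p + n' mod p - p < p"
        using v by linarith+
      then have "(n mod p + n' mod p) div p = 1" "(n mod p + n' mod p) mod p = n mod p + n' mod p - p"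
        using div_p_eq[of "n mod p + n' mod p - p" 1] by (metis, metis mod_mult_self2 mod_less)
      moreover have "\<not> n mod p \<le> n mod p + n' mod p - p"
        using v False by linarith
      ultimately show ?thesis
        using s by simp
    qed
  qed
  ultimately have "nu n + nu n' = nu N + (if n mod p \<le> res b then 0 else 1)"
    using le[of n] le[of n'] le[of N] by (simp add: nu_def N_def)
  then show ?thesis
    using e by simp
qed

lemma rho_reflect:
  assumes "b \<in> Zp W p" "M \<ge> 1" "cg M (b + of_nat (n + n')) 0"
  shows "cg M (rho b n)
    ((- 1) ^ (hyp_sign_exponent W p b + (if n mod p \<le> res b then 0 else 1)) * rho b n')"
proof -
  define e where "e = hyp_sign_exponent W p b + (if n mod p \<le> res b then 0 else 1)"
  have "cg M ((- 1) ^ (nu n + nu n')) ((- 1) ^ e)"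
  proof (cases "odd p \<or> M \<ge> 2")
    case True
    then have "even (nu n + nu n') \<longleftrightarrow> even e"
      using sign_exponent_parity[OF assms(1,3,2)] by (simp add: e_def)
    then show ?thesis
      by (simp add: minus_one_power_iff)
  next
    case False
    then have "p = 2" "M = 1"
      using prime_p primes_dvd_imp_eq two_is_prime_nat assms(2) by (blast, simp)
    \<comment> \<open>At this precision the sign is immaterial: 1 and -1 agree modulo 2.\<close>
    have "cg 1 (1 :: 'K) (- 1)" "cg 1 (- 1 :: 'K) 1"
      unfolding cg_def using \<open>p = 2\<close> by (auto intro: bexI[of _ 1] bexI[of _ "- 1"])
    then show ?thesis
      using \<open>M = 1\<close> by (simp add: minus_one_power_iff)
  qed
  then have "cg M ((- 1) ^ (nu n + nu n') * rho b n') ((- 1) ^ e * rho b n')"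
    using units_closed[OF rho_units[OF assms(1)]] by (rule cg_mult_right)
  then show ?thesis
    using rho_reflect_nu[OF assms] cg_trans unfolding e_def by blast
qed

end

section \<open>A contraction argument for truncated generating functions\<close>

lemma rat_const_simps [simp]:
  "rat_const 0 = 0" "rat_const 1 = 1" "rat_const (u + v) = rat_const u + rat_const v"
  "rat_const (u * v) = rat_const u * rat_const v" "rat_const (- u) = - rat_const u"
  "rat_const (u - v) = rat_const u - rat_const v"
  by (simp_all add: rat_const_def flip: to_fract_add to_fract_mult to_fract_uminus to_fract_diff one_pCons)

lemma rat_const_power [simp]: "rat_const (u ^ n) = rat_const u ^ n"
  by (induction n) simp_all

lemma rat_const_of_nat [simp]: "rat_const (of_nat n) = of_nat n"
  by (induction n) simp_all

lemma sum_lessThan_mult: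
  fixes f :: "nat \<Rightarrow> 'b::comm_monoid_add"
  shows "(\<Sum>k<q * m. f k) = (\<Sum>u<q. \<Sum>k<m. f (u + q * k))"
proof -
  have "(\<Sum>k<q * m. f k) = (\<Sum>k<m. sum f {k * q..<k * q + q})"
    by (simp add: sum.nat_group mult.commute)
  also have "\<dots> = (\<Sum>k<m. \<Sum>u<q. f (u + q * k))"
  proof (rule sum.cong)
    fix k
    show "sum f {k * q..<k * q + q} = (\<Sum>u<q. f (u + q * k))"
      using sum.shift_bounds_nat_ivl[of f 0 "k * q" q]
      by (simp add: atLeast0LessThan mult.commute add.commute)
  qed simp
  finally show ?thesis
    by (simp add: sum.swap[of _ "{..<m}"])
qed

text \<open>In the end \<open>B\<close> is W[t, 1/t, 1/h]. The variable enters as an arbitrary x in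
  \<open>B\<close> with an inverse y in \<open>B\<close>, since the recursion replaces t by
  t^p.\<close>

locale hyp_sums = padic_ring W p + B: adic_subring B "of_nat p"
  for W :: "'K::field_char_0 set" and p :: nat and B :: "'K poly fract set" +
  fixes s :: nat
  assumes const_closed: "\<And>w. w \<in> W \<Longrightarrow> rat_const w \<in> B"
    and s_pos: "s \<ge> 1"
begin

lemma cg_const: "cg n u v \<Longrightarrow> B.cg n (rat_const u) (rat_const v)"
proof -
  assume "cg n u v"
  then obtain w where "w \<in> W" "u - v = P ^ n * w"
    by (auto simp: cg_def)
  then have "rat_const (u - v) = rat_const (P ^ n * w)" "rat_const w \<in> B"
    using const_closed by simp_all
  then show ?thesis
    unfolding B.cg_def by (auto simp del: mult_cancel_left)
qed

definition S :: "'K \<Rightarrow> nat \<Rightarrow> (nat \<Rightarrow> 'K) \<Rightarrow> 'K poly fract \<Rightarrow> 'K poly fract" where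
  "S b n f x = (\<Sum>k<p ^ n. rat_const (hc b k ^ s * f k) * x ^ k)"

lemma S_closed:
  assumes "b \<in> Zp W p" "\<And>k. f k \<in> W" "x \<in> B"
  shows "S b n f x \<in> B"
  unfolding S_def using assms hc_closed[OF assms(1)]
  by (intro B.sum_closed B.mult_closed const_closed B.power_closed mult_closed power_closed) auto

text \<open>\<open>f\<close> and \<open>f'\<close> stand for the restrictions to \<open>\<nat>\<close> of a continuous function \<open>\<phi>\<close> on \<open>\<int>\<^sub>p\<close> and of
  \<open>x \<mapsto> \<phi>(-b - x)\<close>.\<close>

definition reflected :: "'K \<Rightarrow> (nat \<Rightarrow> 'K) \<Rightarrow> (nat \<Rightarrow> 'K) \<Rightarrow> bool" where
  "reflected b f f' \<longleftrightarrow> (\<forall>k. f k \<in> W) \<and> (\<forall>k. f' k \<in> W) \<and>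
    (\<forall>m. \<exists>M. \<forall>k k'. cg M (b + of_nat (k + k')) 0 \<longrightarrow> cg m (f k) (f' k'))"

text \<open>The function to be summed for b' when the digit u is split off: the coefficient for b at
  u + p k times f is the coefficient for b' at k times \<open>lo b f u k\<close>. The two cases are
  those of \<open>hc_low\<close> and \<open>hc_high\<close>.\<close>

definition lo :: "'K \<Rightarrow> (nat \<Rightarrow> 'K) \<Rightarrow> nat \<Rightarrow> nat \<Rightarrow> 'K" where
  "lo b f u k = (if u \<le> res b then rho b (u + p * k) else P * (prm b + of_nat k) * rho b (u + p * k)) ^ s
    * f (u + p * k)"

definition sgn_b :: "'K \<Rightarrow> 'K" where
  "sgn_b b = (- 1) ^ (s * hyp_sign_exponent W p b)"

text \<open>For \<open>u > l\<^sub>b\<close> the index is shifted by one, which amounts to the recurrence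
  \<open>(b + k) A\<^sub>k = (k + 1) A\<^bsub>k+1\<^esub>\<close> of the coefficients.\<close>

definition hi :: "'K \<Rightarrow> (nat \<Rightarrow> 'K) \<Rightarrow> nat \<Rightarrow> nat \<Rightarrow> 'K" where
  "hi b f u k = (if u \<le> res b
    then sgn_b b * rho b (res b - u + p * k) ^ s * f (res b - u + p * k)
    else if k = 0 then 0
    else sgn_b b * (P * of_nat k * rho b (p + res b - u + p * (k - 1))) ^ s
      * f (p + res b - u + p * (k - 1)))"

lemma sgn_b_closed [simp]: "sgn_b b \<in> W"
  by (simp add: sgn_b_def)

lemma sgn_b_square [simp]: "sgn_b b * sgn_b b = 1" "sgn_b b * (sgn_b b * z) = z"
  by (cases "even (s * hyp_sign_exponent W p b)"; simp add: sgn_b_def minus_one_power_iff)+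

lemma lo_closed: "b \<in> Zp W p \<Longrightarrow> (\<And>k. f k \<in> W) \<Longrightarrow> lo b f u k \<in> W"
  using units_closed[OF rho_units] Zp_closed[OF prm_Zp] by (simp add: lo_def)

lemma hi_closed: "b \<in> Zp W p \<Longrightarrow> (\<And>k. f k \<in> W) \<Longrightarrow> hi b f u k \<in> W"
  using units_closed[OF rho_units] by (simp add: hi_def)

lemma S_split:
  assumes "b \<in> Zp W p"
  shows "S b (Suc n) f x = (\<Sum>u<p. x ^ u * S (prm b) n (lo b f u) (x ^ p))"
proof -
  have "S b (Suc n) f x = (\<Sum>u<p. \<Sum>k<p ^ n. rat_const (hc b (u + p * k) ^ s * f (u + p * k))
      * x ^ (u + p * k))"
    unfolding S_def power_Suc by (rule sum_lessThan_mult)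
  also have "\<dots> = (\<Sum>u<p. x ^ u * S (prm b) n (lo b f u) (x ^ p))"
    unfolding S_def sum_distrib_left
  proof (intro sum.cong refl)
    fix u k
    assume "u \<in> {..<p}"
    then have "hc b (u + p * k) ^ s * f (u + p * k) = hc (prm b) k ^ s * lo b f u k"
      using hc_low[OF assms, of u k] hc_high[OF assms, of u k]
      by (auto simp: lo_def power_mult_distrib)
    then show "rat_const (hc b (u + p * k) ^ s * f (u + p * k)) * x ^ (u + p * k)
      = x ^ u * (rat_const (hc (prm b) k ^ s * lo b f u k) * (x ^ p) ^ k)"
      by (simp only: power_add power_mult mult.left_commute)
  qed
  finally show ?thesis .
qed

text \<open>Multiplication by x shifts the index, and the recurrence for (b)_k / k! trades b + k for
  k + 1. The two sides differ only by the term with index p^n, which contains the s-th power of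
  p^(n+1).\<close>

lemma S_shift:
  assumes "b \<in> Zp W p" "x \<in> B" "\<And>k. f k \<in> W"
  shows "B.cg n (x * S b n (\<lambda>k. (P * (b + of_nat k)) ^ s * f k) x)
    (S b n (\<lambda>k. if k = 0 then 0 else (P * of_nat k) ^ s * f (k - 1)) x)"
proof -
  define g where "g = (\<lambda>k. rat_const (hc b k ^ s * ((P * of_nat k) ^ s * f (k - 1))) * x ^ k)"
  have "x * S b n (\<lambda>k. (P * (b + of_nat k)) ^ s * f k) x = (\<Sum>k<p ^ n. g (Suc k))"
    unfolding S_def sum_distrib_left
  proof (intro sum.cong refl)
    fix k
    have "hc b k ^ s * ((P * (b + of_nat k)) ^ s * f k) = (P * (hc b k * (b + of_nat k))) ^ s * f k"
      by (simp add: power_mult_distrib mult_ac)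
    also have "\<dots> = hc b (Suc k) ^ s * ((P * of_nat (Suc k)) ^ s * f (Suc k - 1))"
      unfolding hc_Suc by (simp add: power_mult_distrib mult_ac del: of_nat_Suc)
    finally have "hc b k ^ s * ((P * (b + of_nat k)) ^ s * f k)
      = hc b (Suc k) ^ s * ((P * of_nat (Suc k)) ^ s * f (Suc k - 1))" .
    then show "x * (rat_const (hc b k ^ s * ((P * (b + of_nat k)) ^ s * f k)) * x ^ k) = g (Suc k)"
      unfolding g_def by (simp only: power_Suc mult.left_commute)
  qed
  also have "\<dots> = (\<Sum>k<Suc (p ^ n). g k) - g 0"
    unfolding sum.lessThan_Suc_shift by simp
  also have "\<dots> = (\<Sum>k<p ^ n. g k) + g (p ^ n)"
    using s_pos by (simp add: g_def)
  also have "(\<Sum>k<p ^ n. g k) = S b n (\<lambda>k. if k = 0 then 0 else (P * of_nat k) ^ s * f (k - 1)) x"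
    unfolding S_def g_def using s_pos by (intro sum.cong) auto
  finally have eq: "x * S b n (\<lambda>k. (P * (b + of_nat k)) ^ s * f k) x =
    S b n (\<lambda>k. if k = 0 then 0 else (P * of_nat k) ^ s * f (k - 1)) x + g (p ^ n)" .
  have "cg n ((P * of_nat (p ^ n)) ^ s) 0"
  proof -
    have "(P * of_nat (p ^ n)) ^ s = P ^ n * (P * (P * P ^ n) ^ (s - 1))"
      using s_pos by (cases s) simp_all
    then show ?thesis
      using cg_multiple[of "P * (P * P ^ n) ^ (s - 1)" n n] by simp
  qed
  then have "cg n (hc b (p ^ n) ^ s * ((P * of_nat (p ^ n)) ^ s * f (p ^ n - 1))) 0"
    using cg_mult_left[OF cg_mult_right] hc_closed[OF assms(1)] assms(3)
    by (metis mult_zero_left mult_zero_right power_closed)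
  then have "B.cg n (g (p ^ n)) 0"
    using B.cg_mult_right[OF cg_const B.power_closed[OF assms(2)], of n _ 0 "p ^ n"]
    by (simp only: g_def rat_const_simps(1) mult_zero_left)
  then show ?thesis
    using B.cg_add[OF B.cg_refl] eq by fastforce
qed

lemma S_scale: "S b n (\<lambda>k. w * f k) x = rat_const w * S b n f x"
  by (simp add: S_def sum_distrib_left mult_ac)

lemma S_add: "S b n (\<lambda>k. f k + g k) x = S b n f x + S b n g x"
  by (simp add: S_def algebra_simps sum.distrib)

text \<open>The splitting at y with its digits permuted by the reflection. With l =
  \<open>res b\<close>, the digit v of the reflected term satisfies y^v = y^l x^u if u \<le> l and
  y^v = y^l x^u y^p otherwise. So y^l is a common factor and the powers x^u are those of the
  splitting at x; the surplus y^p is absorbed by \<open>S_shift\<close>.\<close>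

lemma S_split_reflected:
  assumes "b \<in> Zp W p" "\<And>k. f k \<in> W" "x \<in> B" "y \<in> B" "x * y = 1"
  shows "B.cg n (S b (Suc n) f y)
    (rat_const (sgn_b b) * y ^ res b * (\<Sum>u<p. x ^ u * S (prm b) n (hi b f u) (y ^ p)))"
proof -
  define l where "l = res b"
  have l: "l < p"
    using res(1)[OF assms(1)] by (simp add: l_def)
  \<comment> \<open>An involution of the digits: u + v u is l or p + l.\<close>
  define v where "v = (\<lambda>u. if u \<le> l then l - u else p + l - u)"
  have xy: "y ^ (i + j) * x ^ i = y ^ j" for i j
  proof -
    have "y ^ (i + j) * x ^ i = (x * y) ^ i * y ^ j"
      by (simp add: power_add power_mult_distrib)
    then show ?thesis using assms(5) by simp
  qed
  have "S b (Suc n) f y = (\<Sum>i<p. y ^ i * S (prm b) n (lo b f i) (y ^ p))"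
    by (rule S_split[OF assms(1)])
  also have "\<dots> = (\<Sum>u<p. y ^ v u * S (prm b) n (lo b f (v u)) (y ^ p))"
    using l by (intro sum.reindex_bij_witness[of _ v v]) (auto simp: v_def)
  also have "B.cg n \<dots> (\<Sum>u<p. rat_const (sgn_b b) * y ^ l * (x ^ u * S (prm b) n (hi b f u) (y ^ p)))"
  proof (rule B.cg_sum)
    fix u
    assume "u \<in> {..<p}"
    then have u: "u < p" by simp
    define c where "c = rat_const (sgn_b b)"
    have "c * c = 1"
      by (simp add: c_def flip: rat_const_simps(4))
    then have cc: "c * y' * (z * (c * w)) = y' * z * w" for y' z w
    proof -
      have "c * y' * (z * (c * w)) = c * c * (y' * z * w)"
        by (simp only: mult_ac)
      then show ?thesis
        using \<open>c * c = 1\<close> by simp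
    qed
    show "B.cg n (y ^ v u * S (prm b) n (lo b f (v u)) (y ^ p))
      (rat_const (sgn_b b) * y ^ l * (x ^ u * S (prm b) n (hi b f u) (y ^ p)))"
    proof (cases "u \<le> l")
      case True
      have "hi b f u = (\<lambda>k. sgn_b b * lo b f (v u) k)"
        using True by (auto simp: hi_def lo_def v_def l_def)
      then have "S (prm b) n (hi b f u) (y ^ p) = rat_const (sgn_b b) * S (prm b) n (lo b f (v u)) (y ^ p)"
        by (simp only: S_scale)
      moreover have "y ^ l * x ^ u = y ^ v u"
        using xy[of u "v u"] True by (simp add: v_def)
      ultimately have "rat_const (sgn_b b) * y ^ l * (x ^ u * S (prm b) n (hi b f u) (y ^ p))
          = y ^ v u * S (prm b) n (lo b f (v u)) (y ^ p)"
        using cc by (simp only: c_def)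
      then show ?thesis
        by simp
    next
      case False
      define g where "g = (\<lambda>k. rho b (v u + p * k) ^ s * f (v u + p * k))"
      have g: "g k \<in> W" for k
        using units_closed[OF rho_units[OF assms(1)]] assms(2) by (simp add: g_def)
      have vu: "v u = p + l - u" "v u > l"
        using False u by (auto simp: v_def)
      have lo: "lo b f (v u) = (\<lambda>k. (P * (prm b + of_nat k)) ^ s * g k)"
        using vu by (auto simp: lo_def g_def l_def power_mult_distrib)
      have hi: "hi b f u = (\<lambda>k. sgn_b b * (if k = 0 then 0 else (P * of_nat k) ^ s * g (k - 1)))"
        using False vu(1) by (auto simp: hi_def g_def l_def power_mult_distrib fun_eq_iff)
      have hi': "rat_const (sgn_b b) * y ^ l * (x ^ u * S (prm b) n (hi b f u) (y ^ p)) =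
        y ^ l * x ^ u * S (prm b) n (\<lambda>k. if k = 0 then 0 else (P * of_nat k) ^ s * g (k - 1)) (y ^ p)"
        unfolding hi S_scale c_def[symmetric] by (rule cc)
      have "y ^ (u + v u) * x ^ u = y ^ v u"
        by (rule xy)
      moreover have "u + v u = p + l"
        using vu u by simp
      ultimately have "y ^ v u = y ^ l * x ^ u * y ^ p"
        by (simp add: power_add mult_ac)
      then have lo': "y ^ v u * S (prm b) n (lo b f (v u)) (y ^ p) =
        y ^ l * x ^ u * (y ^ p * S (prm b) n (\<lambda>k. (P * (prm b + of_nat k)) ^ s * g k) (y ^ p))"
        unfolding lo by (simp only: mult.assoc)
      show ?thesis
        unfolding hi' lo' using assms(3,4) g
        by (intro B.cg_mult_left S_shift prm_Zp[OF assms(1)]) auto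
    qed
  qed
  finally show ?thesis
    by (simp only: sum_distrib_left l_def)
qed

text \<open>The matching indices satisfy b + i + i' = p (b' + k + k'), so a congruence for b' modulo
  p^M gives one for b modulo p^(M+1). This gained digit drives the contraction. For u > l,
  \<open>rho_reflect\<close> yields an additional sign, which cancels against the one in the
  replacement of p (b' + k) by -p k'.\<close>

lemma lo_hi_cong:
  assumes b: "b \<in> Zp W p" and f: "\<And>k. f k \<in> W" "\<And>k. f' k \<in> W" and "u < p" and m: "m \<le> Suc M"
    and ff': "\<And>i i'. cg (Suc M) (b + of_nat (i + i')) 0 \<Longrightarrow> cg m (f i) (f' i')"
    and kk': "cg M (prm b + of_nat (k + k')) 0"
  shows "cg m (lo b f u k) (hi b f' u k')"
proof -
  define l where "l = res b"
  define e where "e = hyp_sign_exponent W p b"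
  have l: "l < p"
    using res(1)[OF b] by (simp add: l_def)
  have Pkk': "cg (Suc M) (P * (prm b + of_nat (k + k'))) 0"
    using kk' cg_x_mult_Suc[of M "prm b + of_nat (k + k')" 0] by simp
  have rhoW: "rho b i \<in> W" for i
    using units_closed[OF rho_units[OF b]] .
  show ?thesis
  proof (cases "u \<le> l")
    case True
    define i i' where "i = u + p * k" and "i' = l - u + p * k'"
    have "P * (prm b + of_nat (k + k')) = b + of_nat (i + i')"
    proof -
      have "i + i' = l + p * (k + k')"
        using True by (simp add: i_def i'_def algebra_simps)
      then show ?thesis
        using prm_eq[of b] by (simp add: l_def algebra_simps)
    qed
    then have ii': "cg (Suc M) (b + of_nat (i + i')) 0"
      using Pkk' by simp
    have "i mod p = u"
      using \<open>u < p\<close> by (simp add: i_def)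
    then have "cg (Suc M) (rho b i) ((- 1) ^ e * rho b i')"
      using rho_reflect[OF b _ ii'] True by (simp add: e_def l_def)
    then have "cg m (rho b i ^ s) (((- 1) ^ e * rho b i') ^ s)"
      using rhoW m by (intro cg_power cg_mono[of "Suc M" _ _ m]) auto
    moreover have "((- 1) ^ e * rho b i') ^ s = sgn_b b * rho b i' ^ s"
      by (simp add: sgn_b_def e_def power_mult_distrib mult.commute flip: power_mult)
    ultimately have "cg m (rho b i ^ s * f i) (sgn_b b * rho b i' ^ s * f' i')"
      using ff'[OF ii'] rhoW f by (intro cg_mult) auto
    then show ?thesis
      using True by (simp add: lo_def hi_def l_def i_def i'_def)
  next
    case False
    define i where "i = u + p * k"
    have "i mod p = u"
      using \<open>u < p\<close> by (simp add: i_def)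
    have lo: "lo b f u k = (P * (prm b + of_nat k) * rho b i) ^ s * f i"
      using False by (simp add: lo_def l_def i_def)
    show ?thesis
    proof (cases "k' = 0")
      case True
      \<comment> \<open>For k' = 0 the value of \<open>hi\<close> is 0, and p (b' + k) is small
        itself, hence also its s-th power as s \<ge> 1.\<close>
      have "cg m (P * (prm b + of_nat k)) 0"
        using cg_mono[OF Pkk' m] True by simp
      then have "cg m ((P * (prm b + of_nat k) * rho b i) ^ s) ((0 * rho b i) ^ s)"
        using rhoW Zp_closed[OF prm_Zp[OF b]] by (intro cg_power cg_mult_right) auto
      then have "cg m ((P * (prm b + of_nat k) * rho b i) ^ s * f i) ((0 * rho b i) ^ s * f i)"
        using f by (intro cg_mult_right)
      then show ?thesis
        using lo True False s_pos by (simp add: hi_def l_def power_0_left)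
    next
      case k': False
      define i' where "i' = p + l - u + p * (k' - 1)"
      have "P * (prm b + of_nat (k + k')) = b + of_nat (i + i')"
      proof -
        have "i + i' = l + p * (k + k')"
          using False \<open>u < p\<close> k' by (cases k') (simp_all add: i_def i'_def algebra_simps)
        then show ?thesis
          using prm_eq[of b] by (simp add: l_def algebra_simps)
      qed
      then have ii': "cg (Suc M) (b + of_nat (i + i')) 0"
        using Pkk' by simp
      have rho: "cg (Suc M) (rho b i) ((- 1) ^ (e + 1) * rho b i')"
        using rho_reflect[OF b _ ii'] False \<open>i mod p = u\<close> by (simp add: e_def l_def)
      have "P * (prm b + of_nat (k + k')) - P * of_nat k' = P * (prm b + of_nat k)"
        by (simp add: algebra_simps)
      then have "cg (Suc M) (P * (prm b + of_nat k)) (- (P * of_nat k'))"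
        using cg_diff[OF Pkk' cg_refl[of "Suc M" "P * of_nat k'"]] by (simp only: diff_0)
      then have "cg (Suc M) (P * (prm b + of_nat k) * rho b i)
        (- (P * of_nat k') * ((- 1) ^ (e + 1) * rho b i'))"
        using rho rhoW Zp_closed[OF prm_Zp[OF b]] by (intro cg_mult) auto
      then have "cg m ((P * (prm b + of_nat k) * rho b i) ^ s)
        ((- (P * of_nat k') * ((- 1) ^ (e + 1) * rho b i')) ^ s)"
        using rhoW Zp_closed[OF prm_Zp[OF b]] m by (intro cg_power cg_mono[of "Suc M" _ _ m]) auto
      moreover have "(- (P * of_nat k') * ((- 1) ^ (e + 1) * rho b i')) ^ s
        = sgn_b b * (P * of_nat k' * rho b i') ^ s"
      proof -
        have "- (P * of_nat k') * ((- 1) ^ (e + 1) * rho b i') = (- 1) ^ e * (P * of_nat k' * rho b i')"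
          by simp
        then show ?thesis
          by (simp only: sgn_b_def e_def power_mult_distrib mult.commute[of s] power_mult)
      qed
      ultimately have "cg m ((P * (prm b + of_nat k) * rho b i) ^ s * f i)
        (sgn_b b * (P * of_nat k' * rho b i') ^ s * f' i')"
        using ff'[OF ii'] rhoW f Zp_closed[OF prm_Zp[OF b]] by (intro cg_mult) auto
      then show ?thesis
        using lo False k' by (simp add: hi_def l_def i'_def)
    qed
  qed
qed

lemma reflected_step:
  assumes "b \<in> Zp W p" "reflected b f f'" "u < p"
  shows "reflected (prm b) (lo b f u) (hi b f' u)"
proof -
  have f: "\<And>k. f k \<in> W" "\<And>k. f' k \<in> W"
    using assms(2) by (auto simp: reflected_def)
  have "\<exists>M. \<forall>k k'. cg M (prm b + of_nat (k + k')) 0 \<longrightarrow> cg m (lo b f u k) (hi b f' u k')" for m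
  proof -
    obtain M where M: "\<And>k k'. cg M (b + of_nat (k + k')) 0 \<Longrightarrow> cg m (f k) (f' k')"
      using assms(2) unfolding reflected_def by blast
    \<comment> \<open>The \<open>m\<close> in the maximum ensures that \<open>rho\<close> is
      controlled to the precision m; \<open>M\<close> is what the functions themselves
      require.\<close>
    have "cg m (lo b f u k) (hi b f' u k')"
      if "cg (max M m) (prm b + of_nat (k + k')) 0" for k k'
      using assms(1) f assms(3) _ _ that
    proof (rule lo_hi_cong)
      show "cg m (f i) (f' i')" if "cg (Suc (max M m)) (b + of_nat (i + i')) 0" for i i'
        using cg_mono[OF that, of M] by (intro M) simp
    qed simp
    then show ?thesis
      by blast
  qed
  then show ?thesis
    using lo_closed[OF assms(1)] hi_closed[OF assms(1)] f by (simp add: reflected_def)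
qed

text \<open>Vanishing of the antisymmetric form modulo p^m from some index on. It is uniform in x
  and y because each splitting passes to x^p and y^p.\<close>

definition contracts :: "nat \<Rightarrow> 'K \<Rightarrow> (nat \<Rightarrow> 'K) \<Rightarrow> (nat \<Rightarrow> 'K) \<Rightarrow> (nat \<Rightarrow> 'K) \<Rightarrow> (nat \<Rightarrow> 'K) \<Rightarrow> bool" where
  "contracts m b f f' g g' \<longleftrightarrow> (\<exists>n0. \<forall>n\<ge>n0. \<forall>n'\<ge>n0. \<forall>x\<in>B. \<forall>y\<in>B. x * y = 1 \<longrightarrow>
    B.cg m (S b n f x * S b n' g' y) (S b n g x * S b n' f' y))"

text \<open>Splitting both factors gives double sums over digits. The term with f at digit u and g'
  at digit v on the left is matched with g at digit v and f' at digit u on the right; both have the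
  same monomial x^u x^v and the same factor from the reflected splitting. So the form for b is a
  combination of forms for b'.\<close>

lemma contracts_step:
  assumes b: "b \<in> Zp W p" and f: "\<And>k. f k \<in> W" "\<And>k. f' k \<in> W" "\<And>k. g k \<in> W" "\<And>k. g' k \<in> W"
    and *: "\<And>u v. u < p \<Longrightarrow> v < p \<Longrightarrow>
      contracts m (prm b) (lo b f u) (hi b f' u) (lo b g v) (hi b g' v)"
  shows "contracts m b f f' g g'"
proof -
  have "\<forall>u v. \<exists>n0. u < p \<longrightarrow> v < p \<longrightarrow> (\<forall>n\<ge>n0. \<forall>n'\<ge>n0. \<forall>x\<in>B. \<forall>y\<in>B. x * y = 1 \<longrightarrow>
    B.cg m (S (prm b) n (lo b f u) x * S (prm b) n' (hi b g' v) y)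
      (S (prm b) n (lo b g v) x * S (prm b) n' (hi b f' u) y))"
    using * unfolding contracts_def by blast
  then obtain N where N: "\<And>u v n n' x y. u < p \<Longrightarrow> v < p \<Longrightarrow> n \<ge> N u v \<Longrightarrow> n' \<ge> N u v \<Longrightarrow>
    x \<in> B \<Longrightarrow> y \<in> B \<Longrightarrow> x * y = 1 \<Longrightarrow>
    B.cg m (S (prm b) n (lo b f u) x * S (prm b) n' (hi b g' v) y)
      (S (prm b) n (lo b g v) x * S (prm b) n' (hi b f' u) y)"
    by metis
  \<comment> \<open>The summand m controls the error of \<open>S_split_reflected\<close>, and the
    double sum bounds all \<open>N u v\<close> at once.\<close>
  define n0 where "n0 = m + (\<Sum>u<p. \<Sum>v<p. N u v)"
  have n0: "N u v \<le> n0" if "u < p" "v < p" for u v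
  proof -
    have "N u v \<le> (\<Sum>v<p. N u v)"
      using that by (intro member_le_sum) auto
    also have "\<dots> \<le> (\<Sum>u<p. \<Sum>v<p. N u v)"
      using that by (intro member_le_sum[of u _ "\<lambda>u. \<Sum>v<p. N u v"]) auto
    finally show ?thesis
      by (simp add: n0_def)
  qed
  have "B.cg m (S b n f x * S b n' g' y) (S b n g x * S b n' f' y)"
    if nn: "n \<ge> Suc n0" "n' \<ge> Suc n0" and xy: "x \<in> B" "y \<in> B" "x * y = 1" for n n' x y
  proof -
    obtain i j where ij: "n = Suc i" "n' = Suc j" "i \<ge> n0" "j \<ge> n0"
      using nn by (metis Suc_le_D Suc_le_mono)
    have xy': "x ^ p \<in> B" "y ^ p \<in> B" "x ^ p * y ^ p = 1"
      using xy by (simp_all flip: power_mult_distrib)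
    define c where "c = rat_const (sgn_b b) * y ^ res b"
    have c: "c \<in> B"
      using xy const_closed[OF sgn_b_closed] by (simp add: c_def)
    have split: "B.cg m (S b n h x * S b n' h' y)
      (\<Sum>u<p. \<Sum>v<p. c * (x ^ u * x ^ v) *
        (S (prm b) i (lo b h u) (x ^ p) * S (prm b) j (hi b h' v) (y ^ p)))"
      if h: "\<And>k. h k \<in> W" "\<And>k. h' k \<in> W" for h h'
    proof -
      have "B.cg m (S b n' h' y) (c * (\<Sum>v<p. x ^ v * S (prm b) j (hi b h' v) (y ^ p)))"
        using S_split_reflected[OF b h(2) xy, of j] ij n0_def
        by (simp add: c_def B.cg_mono[of j _ _ m])
      then have "B.cg m (S b n h x * S b n' h' y)
          (S b n h x * (c * (\<Sum>v<p. x ^ v * S (prm b) j (hi b h' v) (y ^ p))))"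
        using S_closed[OF b h(1) xy(1)] by (rule B.cg_mult_left)
      also have "S b n h x * (c * (\<Sum>v<p. x ^ v * S (prm b) j (hi b h' v) (y ^ p))) =
          (\<Sum>u<p. \<Sum>v<p. c * (x ^ u * x ^ v) *
        (S (prm b) i (lo b h u) (x ^ p) * S (prm b) j (hi b h' v) (y ^ p)))"
        unfolding ij(1) S_split[OF b]
        by (subst mult.left_commute, simp only: sum_product, simp only: sum_distrib_left mult_ac)
      finally show ?thesis .
    qed
    have "B.cg m (S b n f x * S b n' g' y) (\<Sum>u<p. \<Sum>v<p. c * (x ^ u * x ^ v) *
        (S (prm b) i (lo b f u) (x ^ p) * S (prm b) j (hi b g' v) (y ^ p)))"
      by (intro split f)
    also have "B.cg m \<dots> (\<Sum>u<p. \<Sum>v<p. c * (x ^ u * x ^ v) *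
        (S (prm b) i (lo b g v) (x ^ p) * S (prm b) j (hi b f' u) (y ^ p)))"
      using n0 ij c xy order_trans
      by (intro B.cg_sum B.cg_mult_left N xy') (auto intro: order_trans)
    also have "\<dots> = (\<Sum>v<p. \<Sum>u<p. c * (x ^ v * x ^ u) *
        (S (prm b) i (lo b g v) (x ^ p) * S (prm b) j (hi b f' u) (y ^ p)))"
      by (subst sum.swap) (simp only: mult.commute)
    also have "B.cg m \<dots> (S b n g x * S b n' f' y)"
      by (intro B.cg_sym[OF split] f)
    finally show ?thesis .
  qed
  then show ?thesis
    unfolding contracts_def by blast
qed

text \<open>The functions are c + p h and d + p i, with the same constants c and d on the reflected
  side. In the form the products of constants cancel, and what remains is p times a combination of
  the forms for (1, i), (h, 1) and (h, i). These vanish modulo p^m by \<open>IH\<close>, and the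
  factor p supplies one more power.\<close>

lemma contracts_base:
  assumes b: "b \<in> Zp W p" and f: "reflected b f f'" and g: "reflected b g g'"
    and f1: "\<And>k k'. cg 1 (f k) (f' k')" and g1: "\<And>k k'. cg 1 (g k) (g' k')"
    and IH: "\<And>f f' g g'. reflected b f f' \<Longrightarrow> reflected b g g' \<Longrightarrow> contracts m b f f' g g'"
  shows "contracts (Suc m) b f f' g g'"
proof -
  have const: "\<exists>c h h'. c \<in> W \<and> reflected b h h' \<and> f = (\<lambda>k. c * 1 + P * h k) \<and> f' = (\<lambda>k. c * 1 + P * h' k)"
    if f: "reflected b f f'" and f1: "\<And>k k'. cg 1 (f k) (f' k')" for f f'
  proof -
    define c where "c = f 0"
    define h h' where "h = (\<lambda>k. (f k - c) / P)" and "h' = (\<lambda>k. (f' k - c) / P)"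
    have W: "\<And>k. f k \<in> W" "\<And>k. f' k \<in> W" "c \<in> W"
      using f by (auto simp: reflected_def c_def)
    have eq: "f = (\<lambda>k. c * 1 + P * h k)" "f' = (\<lambda>k. c * 1 + P * h' k)"
      by (simp_all add: h_def h'_def)
    have div: "z / P \<in> W" if "cg 1 z 0" for z
      using that by (auto simp: cg_def)
    have "h k \<in> W" "h' k \<in> W" for k
      using cg_trans[OF f1[of k 0] cg_sym[OF f1[of 0 0]]] cg_sym[OF f1[of 0 k]]
      by (auto simp: h_def h'_def c_def cg_diff_0 intro!: div)
    moreover have "\<exists>M. \<forall>k k'. cg M (b + of_nat (k + k')) 0 \<longrightarrow> cg i (h k) (h' k')" for i
    proof -
      obtain M where M: "\<And>k k'. cg M (b + of_nat (k + k')) 0 \<Longrightarrow> cg (Suc i) (f k) (f' k')"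
        using f unfolding reflected_def by blast
      have "cg i (h k) (h' k')" if "cg M (b + of_nat (k + k')) 0" for k k'
      proof -
        have "P * h k = f k - c" "P * h' k' = f' k' - c"
          by (simp_all add: h_def h'_def)
        then show ?thesis
          using cg_diff[OF M[OF that] cg_refl[of "Suc i" c]] cg_x_mult_Suc[of i "h k" "h' k'"] by simp
      qed
      then show ?thesis by blast
    qed
    ultimately show ?thesis
      using W eq unfolding reflected_def by blast
  qed
  obtain c h h' where c: "c \<in> W" "reflected b h h'"
    and fh: "f = (\<lambda>k. c * 1 + P * h k)" "f' = (\<lambda>k. c * 1 + P * h' k)"
    using const[OF f f1] by blast
  obtain d i i' where d: "d \<in> W" "reflected b i i'"
    and gi: "g = (\<lambda>k. d * 1 + P * i k)" "g' = (\<lambda>k. d * 1 + P * i' k)"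
    using const[OF g g1] by blast
  have one: "reflected b (\<lambda>_. 1) (\<lambda>_. 1)"
    by (simp add: reflected_def)
  obtain n1 where n1: "\<And>n n' x y. n \<ge> n1 \<Longrightarrow> n' \<ge> n1 \<Longrightarrow> x \<in> B \<Longrightarrow> y \<in> B \<Longrightarrow> x * y = 1 \<Longrightarrow>
    B.cg m (S b n (\<lambda>_. 1) x * S b n' i' y) (S b n i x * S b n' (\<lambda>_. 1) y)"
    using IH[OF one d(2)] unfolding contracts_def by blast
  obtain n2 where n2: "\<And>n n' x y. n \<ge> n2 \<Longrightarrow> n' \<ge> n2 \<Longrightarrow> x \<in> B \<Longrightarrow> y \<in> B \<Longrightarrow> x * y = 1 \<Longrightarrow>
    B.cg m (S b n h x * S b n' (\<lambda>_. 1) y) (S b n (\<lambda>_. 1) x * S b n' h' y)"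
    using IH[OF c(2) one] unfolding contracts_def by blast
  obtain n3 where n3: "\<And>n n' x y. n \<ge> n3 \<Longrightarrow> n' \<ge> n3 \<Longrightarrow> x \<in> B \<Longrightarrow> y \<in> B \<Longrightarrow> x * y = 1 \<Longrightarrow>
    B.cg m (S b n h x * S b n' i' y) (S b n i x * S b n' h' y)"
    using IH[OF c(2) d(2)] unfolding contracts_def by blast
  have "B.cg (Suc m) (S b n f x * S b n' g' y) (S b n g x * S b n' f' y)"
    if n: "n \<ge> max n1 (max n2 n3)" "n' \<ge> max n1 (max n2 n3)"
      and xy: "x \<in> B" "y \<in> B" "x * y = 1" for n n' x y
  proof -
    define C D Q where "C = rat_const c" and "D = rat_const d" and "Q = (of_nat p :: 'K poly fract)"
    have CD: "C \<in> B" "D \<in> B" "Q \<in> B"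
      using const_closed c d by (simp_all add: C_def D_def Q_def)
    define a1 a2 a3 where "a1 = S b n (\<lambda>_. 1) x" and "a2 = S b n h x" and "a3 = S b n i x"
    define e1 e2 e3 where "e1 = S b n' (\<lambda>_. 1) y" and "e2 = S b n' h' y" and "e3 = S b n' i' y"
    have S: "S b n f x = C * a1 + Q * a2" "S b n g x = D * a1 + Q * a3"
      "S b n' f' y = C * e1 + Q * e2" "S b n' g' y = D * e1 + Q * e3"
      unfolding fh gi S_add S_scale by (simp_all add: C_def D_def Q_def a1_def a2_def a3_def e1_def e2_def e3_def)
    have "B.cg m (C * (a1 * e3) + D * (a2 * e1) + Q * (a2 * e3)) (C * (a3 * e1) + D * (a1 * e2) + Q * (a3 * e2))"
      unfolding a1_def a2_def a3_def e1_def e2_def e3_def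
      using n by (intro B.cg_add B.cg_mult_left CD n1 n2 n3 xy) auto
    then have "B.cg (Suc m) (Q * (C * (a1 * e3) + D * (a2 * e1) + Q * (a2 * e3)))
      (Q * (C * (a3 * e1) + D * (a1 * e2) + Q * (a3 * e2)))"
      unfolding Q_def by (simp only: B.cg_x_mult_Suc)
    then have "B.cg (Suc m) (C * a1 * (D * e1) + Q * (C * (a1 * e3) + D * (a2 * e1) + Q * (a2 * e3)))
      (C * a1 * (D * e1) + Q * (C * (a3 * e1) + D * (a1 * e2) + Q * (a3 * e2)))"
      by (rule B.cg_add[OF B.cg_refl])
    then show ?thesis
      unfolding S by (simp add: algebra_simps)
  qed
  then show ?thesis
    unfolding contracts_def by blast
qed

text \<open>The outer induction is on m, the inner one on the number j of digits on which the
  functions depend modulo p. \<open>contracts_step\<close> lowers j at fixed m; at j = 0 the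
  functions are constant modulo p and \<open>contracts_base\<close> lowers m.\<close>

lemma contracts:
  assumes "b \<in> Zp W p" "reflected b f f'" "reflected b g g'"
  shows "contracts m b f f' g g'"
  using assms
proof (induction m arbitrary: b f f' g g')
  case 0
  then have "B.cg 0 (S b n f x * S b n' g' y) (S b n g x * S b n' f' y)"
    if "x \<in> B" "y \<in> B" for n n' x y
    using that by (intro B.cg_0 B.mult_closed S_closed) (auto simp: reflected_def)
  then show ?case
    by (auto simp: contracts_def)
next
  case (Suc m)
  have level: "contracts (Suc m) b f f' g g'"
    if "b \<in> Zp W p" "reflected b f f'" "reflected b g g'"
      "\<And>k k'. cg j (b + of_nat (k + k')) 0 \<Longrightarrow> cg 1 (f k) (f' k')"
      "\<And>k k'. cg j (b + of_nat (k + k')) 0 \<Longrightarrow> cg 1 (g k) (g' k')" for j b f f' g g'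
    using that
  proof (induction j arbitrary: b f f' g g')
    case (0 b)
    have "cg 0 (b + of_nat (k + k')) 0" for k k'
      using Zp_closed[OF 0(1)] by (intro cg_0) auto
    with 0 show ?case
      by (intro contracts_base Suc.IH) auto
  next
    case (Suc j)
    note b = Suc.prems(1) and f = Suc.prems(2) and g = Suc.prems(3)
    have W: "\<And>k. f k \<in> W" "\<And>k. f' k \<in> W" "\<And>k. g k \<in> W" "\<And>k. g' k \<in> W"
      using f g by (auto simp: reflected_def)
    show ?case
    proof (rule contracts_step[OF b W])
      fix u v
      assume uv: "u < p" "v < p"
      show "contracts (Suc m) (prm b) (lo b f u) (hi b f' u) (lo b g v) (hi b g' v)"
      proof (rule Suc.IH[OF prm_Zp[OF b] reflected_step[OF b f uv(1)] reflected_step[OF b g uv(2)]])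
        fix k k'
        assume kk': "cg j (prm b + of_nat (k + k')) 0"
        show "cg 1 (lo b f u k) (hi b f' u k')"
          by (rule lo_hi_cong[OF b W(1,2) uv(1) _ Suc.prems(4) kk']) simp_all
        show "cg 1 (lo b g v k) (hi b g' v k')"
          by (rule lo_hi_cong[OF b W(3,4) uv(2) _ Suc.prems(5) kk']) simp_all
      qed
    qed
  qed
  obtain j1 where j1: "\<And>k k'. cg j1 (b + of_nat (k + k')) 0 \<Longrightarrow> cg 1 (f k) (f' k')"
    using Suc.prems(2) unfolding reflected_def by blast
  obtain j2 where j2: "\<And>k k'. cg j2 (b + of_nat (k + k')) 0 \<Longrightarrow> cg 1 (g k) (g' k')"
    using Suc.prems(3) unfolding reflected_def by blast
  show ?case
  proof (rule level[OF Suc.prems, of "max j1 j2"])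
    fix k k'
    assume *: "cg (max j1 j2) (b + of_nat (k + k')) 0"
    show "cg 1 (f k) (f' k')"
      using j1 cg_mono[OF *] by simp
    show "cg 1 (g k) (g' k')"
      using j2 cg_mono[OF *] by simp
  qed
qed

end

section \<open>Logarithm, powers and the digamma function\<close>

context padic_ring
begin

lemma W_limit:
  fixes y :: "nat \<Rightarrow> 'K"
  assumes "\<And>n. y n \<in> W" "\<And>n. \<exists>N. \<forall>m\<ge>N. cg n (y m) (y N)"
  obtains L where "L \<in> W" "\<And>n. \<exists>N. \<forall>m\<ge>N. cg n (y m) L"
proof -
  obtain N where N: "\<And>n m. m \<ge> N n \<Longrightarrow> cg n (y m) (y (N n))"
    using assms(2) by metis
  have "cg n (y (N (Suc n))) (y (N n))" for n
  proof -
    define m where "m = N n + N (Suc n)"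
    have "cg n (y (N (Suc n))) (y m)"
      using cg_mono[OF cg_sym[OF N[of "Suc n" m]], of n] by (simp add: m_def)
    also have "cg n (y m) (y (N n))"
      by (rule N) (simp add: m_def)
    finally show ?thesis .
  qed
  then obtain L where L: "L \<in> W" "\<And>n. cg n (y (N n)) L"
    using complete[of "\<lambda>n. y (N n)"] assms(1) by blast
  have "\<forall>m\<ge>N n. cg n (y m) L" for n
    using N L(2) cg_trans by blast
  then show ?thesis
    using that L(1) by blast
qed

lemma W_lim_eqI:
  assumes "L \<in> W" "\<F> \<noteq> bot" "\<And>n. eventually (\<lambda>m. cg n (y m) L) \<F>"
  shows "W_lim W p \<F> y = L"
  using assms separated by (rule adic_lim_ring_on_eqI)

lemma W_lim_sequentially_eqI:
  assumes "L \<in> W" "\<And>n. \<exists>N. \<forall>m\<ge>N. cg n (y m) L"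
  shows "W_lim W p sequentially y = L"
  using assms by (intro W_lim_eqI) (auto simp: eventually_sequentially)

lemma W_limit_sum:
  fixes t :: "nat \<Rightarrow> 'K"
  assumes "\<And>i. t i \<in> W" "\<And>n. \<exists>N. \<forall>i\<ge>N. cg n (t i) 0"
  obtains L where "L \<in> W" "\<And>n N. (\<And>i. i \<ge> N \<Longrightarrow> cg n (t i) 0) \<Longrightarrow> cg n (\<Sum>i<N. t i) L"
    "\<And>n. \<exists>N. \<forall>m\<ge>N. cg n (\<Sum>i<m. t i) L"
proof -
  define y where "y = (\<lambda>N. \<Sum>i<N. t i)"
  have tail: "cg n (y m) (y N)" if "\<And>i. i \<ge> N \<Longrightarrow> cg n (t i) 0" "m \<ge> N" for n m N
    using that(2)
  proof (induction m rule: dec_induct)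
    case (step m)
    then show ?case
      using cg_add[OF step.IH that(1)[of m]] by (simp add: y_def)
  qed simp
  have y: "y n \<in> W" for n
    using assms(1) by (auto simp: y_def intro: sum_closed)
  moreover have "\<exists>N. \<forall>m\<ge>N. cg n (y m) (y N)" for n
    using assms(2)[of n] tail by blast
  ultimately obtain L where L: "L \<in> W" "\<And>n. \<exists>N. \<forall>m\<ge>N. cg n (y m) L"
    using W_limit[of y] by blast
  have "cg n (y N) L" if N: "\<And>i. i \<ge> N \<Longrightarrow> cg n (t i) 0" for n N
  proof -
    obtain N' where "\<forall>m\<ge>N'. cg n (y m) L"
      using L(2) by blast
    then have "cg n (y (max N N')) L"
      by simp
    then show ?thesis
      using cg_sym[OF tail[of N n "max N N'"]] N cg_trans by simp
  qed
  then show ?thesis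
    using that L unfolding y_def by blast
qed

section \<open>Binomial series with p-adic exponents and the logarithm\<close>

lemma binomial_sum:
  assumes "n < N"
  shows "(\<Sum>i<N. (of_nat n gchoose i) * (d - 1) ^ i) = (d::'K) ^ n"
proof -
  have "d ^ n = ((d - 1) + 1) ^ n"
    by simp
  also have "\<dots> = (\<Sum>i\<le>n. (of_nat n gchoose i) * (d - 1) ^ i)"
    unfolding binomial_ring by (simp add: binomial_gbinomial)
  also have "\<dots> = (\<Sum>i<N. (of_nat n gchoose i) * (d - 1) ^ i)"
    using assms by (intro sum.mono_neutral_left) (auto simp flip: binomial_gbinomial)
  finally show ?thesis ..
qed

lemma cg_1_E:
  assumes "cg 1 d 1"
  obtains u where "u \<in> W" "d = 1 + P * u"
  using assms by (auto simp: cg_def algebra_simps)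

text \<open>The two binomial series agree term by term modulo p^M by
  \<open>cg_gchoose_power\<close>, and for the natural exponent n the series is a finite
  sum.\<close>

lemma padic_power_cg:
  assumes "cg 1 d 1" "\<alpha> \<in> Zp W p" "cg M \<alpha> (of_nat n)"
  shows "cg M (padic_power W p d \<alpha>) (d ^ n)"
proof -
  obtain u where u: "u \<in> W" "d = 1 + P * u"
    using assms(1) by (rule cg_1_E)
  define t where "t = (\<lambda>i. (\<alpha> gchoose i) * (d - 1) ^ i)"
  have t_eq: "t i = P ^ i * ((\<alpha> gchoose i) * u ^ i)" for i
    by (simp add: t_def u(2) power_mult_distrib)
  have t_W: "t i \<in> W" for i
    using u(1) gchoose_closed[OF assms(2)] by (simp add: t_eq)
  have t_0: "cg k (t i) 0" if "i \<ge> k" for k i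
    unfolding t_eq using u(1) gchoose_closed[OF assms(2)] that by (intro cg_multiple) auto
  obtain L where L: "L \<in> W" "\<And>k N. (\<And>i. i \<ge> N \<Longrightarrow> cg k (t i) 0) \<Longrightarrow> cg k (\<Sum>i<N. t i) L"
    "\<And>k. \<exists>N. \<forall>m\<ge>N. cg k (\<Sum>i<m. t i) L"
    using W_limit_sum[of t] t_W t_0 by metis
  have "padic_power W p d \<alpha> = L"
    unfolding padic_power_def using L(1,3) by (intro W_lim_sequentially_eqI) (simp_all add: t_def)
  moreover have "cg M L (d ^ n)"
  proof -
    \<comment> \<open>M terms determine the limit modulo p^M; n + 1 terms give the exact binomial
      expansion of d^n.\<close>
    define N where "N = max M (Suc n)"
    have "cg M L (\<Sum>i<N. t i)"
      by (intro cg_sym[OF L(2)] t_0) (simp add: N_def)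
    also have "cg M \<dots> (\<Sum>i<N. (of_nat n gchoose i) * (d - 1) ^ i)"
    proof (rule cg_sum)
      fix i
      show "cg M (t i) ((of_nat n gchoose i) * (d - 1) ^ i)"
        using cg_mult_right[OF cg_gchoose_power[OF assms(3) Zp_closed[OF assms(2)] of_nat_closed],
            of "u ^ i" i] u(1)
        by (simp add: t_def u(2) power_mult_distrib mult.assoc)
    qed
    also have "\<dots> = d ^ n"
      by (rule binomial_sum) (simp add: N_def)
    finally show ?thesis .
  qed
  ultimately show ?thesis
    by simp
qed

lemma cg_power_1:
  assumes "cg 1 d 1" "p ^ M dvd n"
  shows "cg M (d ^ n) 1"
proof -
  obtain u where u: "u \<in> W" "d = 1 + P * u"
    using assms(1) by (rule cg_1_E)
  have n: "cg M (of_nat n) (of_nat 0)"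
    using assms(2) cg_of_nat_0_iff by simp
  have "cg M (\<Sum>i<Suc n. (of_nat n gchoose i) * (d - 1) ^ i) (\<Sum>i<Suc n. (of_nat 0 gchoose i) * (d - 1) ^ i)"
  proof (rule cg_sum)
    fix i
    show "cg M ((of_nat n gchoose i) * (d - 1) ^ i) ((of_nat 0 gchoose i) * (d - 1) ^ i)"
      using cg_mult_right[OF cg_gchoose_power[OF n], of "u ^ i" i] u(1)
      by (simp add: u(2) power_mult_distrib mult.assoc)
  qed
  then show ?thesis
    using binomial_sum[of n "Suc n" d] binomial_sum[of 0 "Suc n" d] by simp
qed

text \<open>Up to the sign (-1)^i, the coefficient of u^(i+1) in log(1 + p u) / p.\<close>

definition el :: "nat \<Rightarrow> 'K" where
  "el i = P ^ i / of_nat (Suc i)"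

text \<open>The valuation v of i + 1 satisfies 2 v \<le> 2^v \<le> i + 1. Together with 2 m \<le> i
  this gives 2 (m + v) \<le> 2 i + 1, hence m + v \<le> i.\<close>

lemma el_eq:
  assumes "i \<ge> 2 * m"
  obtains w where "w \<in> W" "el i = P ^ m * w"
proof -
  obtain j where j: "Suc i = p ^ multiplicity p (Suc i) * j" "\<not> p dvd j"
    using multiplicity_decompose'[of "Suc i" p] prime_p not_prime_unit by blast
  define v where "v = multiplicity p (Suc i)"
  have "j \<noteq> 0"
    using j(2) by (intro notI) simp
  have "p ^ v dvd Suc i"
    using multiplicity_dvd[of p "Suc i"] by (simp only: v_def)
  then have "p ^ v \<le> Suc i"
    by (rule dvd_imp_le) simp
  have "2 ^ v \<le> p ^ v"
    using p_gt_1 by (intro power_mono) auto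
  moreover have "2 * v \<le> 2 ^ v"
  proof (induction v)
    case (Suc v)
    then show ?case by (cases v) simp_all
  qed simp
  ultimately have "2 * v \<le> Suc i"
    using \<open>p ^ v \<le> Suc i\<close> by linarith
  then have v: "v \<le> i" "m + v \<le> i \<or> (2 * m = i \<and> 2 * v = Suc i)"
    using assms by (linarith, presburger)
  then have iv: "i = m + v + (i - m - v)"
    by presburger
  have "P ^ i = P ^ m * P ^ v * P ^ (i - m - v)"
    using iv by (metis power_add)
  moreover have "of_nat (Suc i) = P ^ v * of_nat j"
    using j(1) v_def by (metis of_nat_mult of_nat_power)
  moreover have aux: "y * z * w / (z * k) = y * (w * inverse k)" if "z \<noteq> 0" for y z w k :: 'K
    using that by (simp add: divide_inverse)
  ultimately have "el i = P ^ m * (P ^ (i - m - v) * inverse (of_nat j))"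
    unfolding el_def using aux[OF power_not_zero[OF x_nonzero, of v]] by (simp only:)
  moreover have "P ^ (i - m - v) * inverse (of_nat j) \<in> W"
    using units_inverse_closed[OF of_nat_units[OF j(2)]] by simp
  ultimately show ?thesis
    using that by blast
qed

lemma el_closed: "el i \<in> W"
  using el_eq[of 0 i] by auto

lemma el_cg_0: "i \<ge> 2 * m \<Longrightarrow> cg m (el i) 0"
  using el_eq[of m i] cg_multiple by (metis order_refl)

text \<open>Here the denominator k + 1 is removed by the identity (i + 1) C(k + 1, i + 1) = (k + 1)
  C(k, i). When k tends to -1, C(k, i) tends to (-1)^i and the right-hand side becomes the series of
  log(1 + p u) / p.\<close>

lemma power_minus_one_divide:
  "((1 + P * u) ^ Suc k - 1) / of_nat (p * Suc k) = (\<Sum>i<Suc k. (of_nat k gchoose i) * el i * u ^ Suc i)"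
proof -
  have "(1 + P * u) ^ Suc k = (\<Sum>i<Suc (Suc k). (of_nat (Suc k) gchoose i) * (P * u) ^ i)"
    using binomial_sum[of "Suc k" "Suc (Suc k)" "1 + P * u"] by (simp del: of_nat_Suc sum.lessThan_Suc)
  also have "\<dots> = 1 + (\<Sum>i<Suc k. (of_nat (Suc k) gchoose Suc i) * (P * u) ^ Suc i)"
    unfolding sum.lessThan_Suc_shift[of _ "Suc k"] by simp
  finally have "(1 + P * u) ^ Suc k - 1 = (\<Sum>i<Suc k. (of_nat (Suc k) gchoose Suc i) * (P * u) ^ Suc i)"
    by simp
  also have "\<dots> = (\<Sum>i<Suc k. of_nat (p * Suc k) * ((of_nat k gchoose i) * el i * u ^ Suc i))"
  proof (rule sum.cong)
    fix i
    have "of_nat (Suc i) * (of_nat (Suc k) gchoose Suc i) = of_nat (Suc k) * (of_nat k gchoose i :: 'K)"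
      using Suc_times_binomial[of i k] by (metis binomial_gbinomial of_nat_mult)
    then have *: "(of_nat (Suc k) gchoose Suc i) = of_nat (Suc k) * (of_nat k gchoose i) / (of_nat (Suc i) :: 'K)"
      by (simp add: field_simps del: of_nat_Suc)
    show "(of_nat (Suc k) gchoose Suc i) * (P * u) ^ Suc i
      = of_nat (p * Suc k) * ((of_nat k gchoose i) * el i * u ^ Suc i)"
      unfolding * el_def of_nat_mult by (simp add: power_mult_distrib mult_ac del: of_nat_Suc)
  qed simp
  also have "\<dots> = of_nat (p * Suc k) * (\<Sum>i<Suc k. (of_nat k gchoose i) * el i * u ^ Suc i)"
    by (rule sum_distrib_left[symmetric])
  finally have *: "(1 + P * u) ^ Suc k - 1
    = of_nat (p * Suc k) * (\<Sum>i<Suc k. (of_nat k gchoose i) * el i * u ^ Suc i)" .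
  have "(of_nat (p * Suc k) :: 'K) \<noteq> 0"
    unfolding of_nat_eq_0_iff by simp
  then show ?thesis
    unfolding * by (rule nonzero_mult_div_cancel_left)
qed

lemma power_minus_one_divide_closed:
  assumes "cg 1 c 1" "K > 0"
  shows "(c ^ K - 1) / of_nat (p * K) \<in> W"
proof -
  obtain u where u: "u \<in> W" "c = 1 + P * u"
    using assms(1) by (rule cg_1_E)
  obtain k where "K = Suc k"
    using assms(2) gr0_implies_Suc by blast
  then show ?thesis
    unfolding u(2) using power_minus_one_divide[of u k] el_closed u(1)
    by (auto intro!: sum_closed simp flip: binomial_gbinomial simp del: of_nat_Suc sum.lessThan_Suc of_nat_mult power_Suc)
qed

text \<open>The logarithm is the limit of (c^K - 1) / K for K tending to 0. In the shape of
  \<open>power_minus_one_divide\<close> the limit can be taken term by term, and the quotient by p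
  is integral.\<close>

lemma log_limit:
  assumes "cg 1 c 1"
  shows "iwasawa_log W p c / P \<in> W" (is ?closed)
    and "\<exists>V. \<forall>K>0. p ^ V dvd K \<longrightarrow> cg m ((c ^ K - 1) / of_nat (p * K)) (iwasawa_log W p c / P)" (is ?lim)
proof -
  obtain u where u: "u \<in> W" "c = 1 + P * u"
    using assms by (rule cg_1_E)
  define t where "t = (\<lambda>i. (- 1) ^ i * el i * u ^ Suc i)"
  have t_W: "t i \<in> W" for i
    using u(1) el_closed by (simp add: t_def)
  have t_0: "cg k (t i) 0" if "i \<ge> 2 * k" for k i
    using cg_mult_right[OF el_cg_0[OF that], of "(- 1) ^ i * u ^ Suc i"] u(1) by (simp add: t_def mult_ac)
  obtain L where L: "L \<in> W" "\<And>k N. (\<And>i. i \<ge> N \<Longrightarrow> cg k (t i) 0) \<Longrightarrow> cg k (\<Sum>i<N. t i) L"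
    "\<And>k. \<exists>N. \<forall>m\<ge>N. cg k (\<Sum>i<m. t i) L"
    using W_limit_sum[of t] t_W t_0 by metis
  have log_sum: "(\<Sum>i=1..N. (- 1) ^ (i + 1) * (c - 1) ^ i / of_nat i) = P * (\<Sum>i<N. t i)" for N
    unfolding One_nat_def sum.atLeast1_atMost_eq sum_distrib_left
    by (intro sum.cong) (simp_all add: t_def el_def u(2) power_mult_distrib)
  have "(LEAST k. 0 < k \<and> c ^ k - 1 \<in> PIdl\<^bsub>ring_on W\<^esub> (of_nat p)) = (1::nat)"
  proof (rule Least_equality)
    show "0 < (1::nat) \<and> c ^ 1 - 1 \<in> PIdl\<^bsub>ring_on W\<^esub> (of_nat p)"
      using PIdl_ring_on[of "c - 1" 1] assms by (simp add: cg_diff_0)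
  qed simp
  then have "iwasawa_log W p c = W_lim W p sequentially (\<lambda>N. P * (\<Sum>i<N. t i))"
    unfolding iwasawa_log_def Let_def by (simp only: power_one_right log_sum of_nat_1 div_by_1)
  also have "\<dots> = P * L"
    using L(1) by (intro W_lim_sequentially_eqI) (auto intro: cg_mult_left dest: L(3)[THEN exE] simp: , meson L(3) cg_mult_left x_closed)
  finally have log: "iwasawa_log W p c / P = L"
    by simp
  then show ?closed
    using L(1) by simp
  \<comment> \<open>The constant 3 m is 2 m + m: terms with i \<ge> 2 m vanish modulo p^m, and for i
    < 2 m replacing k by -1 in the binomial coefficient costs i digits.\<close>
  have "cg m ((c ^ K - 1) / of_nat (p * K)) L" if K: "K > 0" "p ^ (3 * m) dvd K" for K
  proof -
    obtain k where k: "K = Suc k"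
      using K(1) gr0_implies_Suc by blast
    define N where "N = max (2 * m) (Suc k)"
    have "cg (3 * m) (of_nat (Suc k) - 1) (0 - 1)"
      using K(2) by (intro cg_diff) (simp_all only: k cg_of_nat_0_iff cg_refl)
    then have km: "cg (3 * m) (of_nat k) (- 1)"
      by simp
    have "(c ^ K - 1) / of_nat (p * K) = (\<Sum>i<Suc k. (of_nat k gchoose i) * el i * u ^ Suc i)"
      unfolding u(2) k by (rule power_minus_one_divide)
    also have "\<dots> = (\<Sum>i<N. (of_nat k gchoose i) * el i * u ^ Suc i)"
      by (intro sum.mono_neutral_left) (auto simp: N_def simp flip: binomial_gbinomial)
    also have "cg m \<dots> (\<Sum>i<N. t i)"
    proof (rule cg_sum)
      fix i
      have g: "(of_nat k gchoose i :: 'K) \<in> W"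
        by (simp flip: binomial_gbinomial)
      show "cg m ((of_nat k gchoose i) * el i * u ^ Suc i) (t i)"
      proof (cases "i \<ge> 2 * m")
        case True
        have "cg m ((of_nat k gchoose i) * u ^ Suc i * el i) ((of_nat k gchoose i) * u ^ Suc i * 0)"
          using g u(1) el_cg_0[OF True] by (intro cg_mult_left) auto
        then show ?thesis
          using cg_sym[OF t_0[OF True]] cg_trans by (simp add: mult_ac)
      next
        case False
        have "cg m (of_nat k gchoose i) (- 1 gchoose i)"
          using cg_mono[OF km, of "i + m"] False by (intro cg_gchoose) auto
        moreover have "(- 1 gchoose i :: 'K) = (- 1) ^ i"
          using gbinomial_minus[of "1::'K" i] by (simp flip: binomial_gbinomial)
        ultimately have "cg m ((of_nat k gchoose i) * (el i * u ^ Suc i)) ((- 1) ^ i * (el i * u ^ Suc i))"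
          using u(1) el_closed by (intro cg_mult_right) auto
        then show ?thesis
          by (simp add: t_def mult_ac)
      qed
    qed
    also have "cg m \<dots> L"
      by (intro L(2) t_0) (simp add: N_def)
    finally show ?thesis .
  qed
  then show ?lim
    unfolding log by blast
qed

section \<open>Harmonic sums and the digamma function\<close>

definition harm :: "nat \<Rightarrow> 'K" where
  "harm m = (\<Sum>k | k < m \<and> \<not> p dvd k. 1 / of_nat k)"

lemma harm_0 [simp]: "harm 0 = 0"
  by (simp add: harm_def)

lemma harm_Suc: "harm (Suc m) = harm m + (if p dvd m then 0 else 1 / of_nat m)"
proof -
  have "{k. k < Suc m \<and> \<not> p dvd k} =
    (if p dvd m then {k. k < m \<and> \<not> p dvd k} else insert m {k. k < m \<and> \<not> p dvd k})"
    by (auto simp: less_Suc_eq)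
  then show ?thesis
    by (simp add: harm_def)
qed

lemma harm_closed: "harm m \<in> W"
  using units_inverse_closed[OF of_nat_units] by (auto simp: harm_def inverse_eq_divide intro!: sum_closed)

lemma ppoch_of_nat: "ppoch (of_nat (Suc m)) k * pfac m = pfac (m + k)"
proof (induction k)
  case (Suc k)
  have "k mod p = res (of_nat (Suc m)) \<longleftrightarrow> p dvd Suc (m + k)"
    using cg_add_of_nat_0_iff[OF Zp_of_nat, of "Suc m" k] cg_of_nat_0_iff[of 1 "Suc m + k"]
    by (simp only: of_nat_add[symmetric] power_one_right add_Suc)
  then show ?case
    using Suc by (auto simp: algebra_simps)
qed simp

text \<open>First-order expansion of the product of the k + i, where i \<le> m is prime to p: k^2
  vanishes modulo p^(2 w), and as p divides k, the same i are omitted as in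
  \<open>pfac m\<close>.\<close>

lemma pfac_add:
  assumes "p ^ w dvd k" "w \<ge> 1"
  shows "cg (2 * w) (pfac (m + k)) (pfac k * pfac m * (1 + of_nat k * harm (Suc m)))"
proof (induction m)
  case 0
  show ?case
    by (simp add: harm_Suc)
next
  case (Suc m)
  have "p dvd k"
    using assms by (meson dvd_power dvd_trans less_le_trans zero_less_one)
  then have *: "p dvd Suc (m + k) \<longleftrightarrow> p dvd Suc m"
    by (metis add_Suc dvd_add_left_iff)
  show ?case
  proof (cases "p dvd Suc m")
    case True
    then show ?thesis
      using Suc * by (simp add: harm_Suc[of "Suc m"])
  next
    case False
    define j where "j = (of_nat (Suc m) :: 'K)"
    define q where "q = (of_nat k :: 'K)"
    have j: "j \<in> units"
      using of_nat_units[OF False] by (simp add: j_def)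
    have q: "q \<in> W" "cg (2 * w) (q * q) 0"
    proof -
      have "p ^ (2 * w) dvd k * k"
        using mult_dvd_mono[OF assms(1) assms(1)] by (simp add: power_add mult_2)
      then show "cg (2 * w) (q * q) 0"
        using cg_of_nat_0_iff[of "2 * w" "k * k"] by (simp add: q_def)
    qed (simp add: q_def)
    have 1: "pfac (Suc m + k) = pfac (m + k) * (j + q)"
      using False * by (simp add: j_def q_def)
    have 2: "harm (Suc (Suc m)) = harm (Suc m) + inverse j"
      using False by (simp add: harm_Suc[of "Suc m"] j_def inverse_eq_divide)
    have W: "pfac k \<in> W" "pfac m \<in> W" "harm (Suc m) \<in> W"
      using units_closed[OF pfac_units] harm_closed by auto
    have "cg (2 * w) (pfac (m + k) * (j + q)) (pfac k * pfac m * (1 + q * harm (Suc m)) * (j + q))"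
      using Suc j q units_closed by (intro cg_mult_right) (auto simp: q_def)
    also have "pfac k * pfac m * (1 + q * harm (Suc m)) * (j + q) =
        pfac k * (pfac m * j) * (1 + q * (harm (Suc m) + inverse j)) + pfac k * pfac m * harm (Suc m) * (q * q)"
      using units_nonzero[OF j] by (simp add: field_simps)
    also have "cg (2 * w) \<dots> (pfac k * (pfac m * j) * (1 + q * (harm (Suc m) + inverse j)) +
        pfac k * pfac m * harm (Suc m) * 0)"
      using W q by (intro cg_add cg_refl cg_mult_left) auto
    finally show ?thesis
      using False unfolding 1 2 by (simp add: j_def q_def del: of_nat_Suc)
  qed
qed

lemma rho_cg:
  assumes "a \<in> Zp W p" "a' \<in> Zp W p" "cg M a a'" "M \<ge> 1"
  shows "cg M (rho a k) (rho a' k)"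
proof -
  have "cg 1 (a' + of_nat (res a)) 0"
    using cg_trans[OF cg_add[OF cg_sym[OF cg_mono[OF assms(3,4)]] cg_refl] res(2)[OF assms(1)]] .
  then have res: "res a' = res a"
    using neg_residue_unique[of "res a" 1 a'] res(1)[OF assms(1)] by simp
  have "cg M (ppoch a k) (ppoch a' k)"
  proof (induction k)
    case (Suc k)
    then show ?case
      using assms(3) units_closed[OF ppoch_units[OF assms(1)]] Zp_closed[OF assms(2)]
      by (auto simp: res intro!: cg_mult cg_add)
  qed simp
  then show ?thesis
    unfolding rho_def divide_inverse
    using units_inverse_closed[OF pfac_units] by (rule cg_mult_right)
qed

text \<open>After a has been replaced by the integer m, \<open>rho\<close> is pfac (m - 1 + k) /
  (pfac k pfac (m - 1)), to which \<open>pfac_add\<close> applies. So \<open>harm m\<close>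
  approximates the logarithmic derivative of \<open>rho a\<close> at 0.\<close>

lemma rho_expansion:
  assumes "a \<in> Zp W p" "m > 0" "cg (2 * w) a (of_nat m)" "p ^ w dvd k" "w \<ge> 1"
  shows "cg (2 * w) (rho a k) (1 + of_nat k * harm m)"
proof -
  obtain m' where m': "m = Suc m'"
    using assms(2) gr0_implies_Suc by blast
  have cancel: "y * z * inverse y = z" if "y \<noteq> 0" for y z :: 'K
    using that by simp
  have "cg (2 * w) (rho a k) (rho (of_nat m) k)"
    using assms by (intro rho_cg) auto
  also have "rho (of_nat m) k = pfac (m' + k) * inverse (pfac k * pfac m')"
    using ppoch_of_nat[of m' k] units_nonzero[OF pfac_units]
    unfolding rho_def m' by (simp add: field_simps del: of_nat_Suc)
  also have "cg (2 * w) \<dots> (pfac k * pfac m' * (1 + of_nat k * harm m) * inverse (pfac k * pfac m'))"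
    using pfac_add[OF assms(4,5), of m'] units_inverse_closed[OF units_mult[OF pfac_units pfac_units]]
    unfolding m' by (rule cg_mult_right)
  also have "\<dots> = 1 + of_nat k * harm m"
    by (rule cancel[OF units_nonzero[OF units_mult[OF pfac_units pfac_units]]])
  finally show ?thesis .
qed

text \<open>The unit \<open>rho a (p ^ w)\<close> does not involve m. By
  \<open>rho_expansion\<close> it determines p^w times \<open>harm m\<close> modulo p^(2 w), hence
  \<open>harm m\<close> modulo p^w. This is the convergence behind the digamma function.\<close>

lemma harm_limit:
  assumes "a \<in> Zp W p"
  obtains L where "L \<in> W" "padic_digamma W p a + padic_euler W p = L"
    "\<And>m w. m > 0 \<Longrightarrow> w \<ge> 1 \<Longrightarrow> cg (2 * w) a (of_nat m) \<Longrightarrow> cg w (harm m) L"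
proof -
  have harm_cg: "cg w (harm m) (harm m')"
    if "m > 0" "m' > 0" "w \<ge> 1" "cg (2 * w) a (of_nat m)" "cg (2 * w) a (of_nat m')" for m m' w
  proof -
    have "cg (2 * w) (1 + of_nat (p ^ w) * harm m) (1 + of_nat (p ^ w) * harm m')"
      using cg_trans[OF cg_sym[OF rho_expansion[OF assms that(1,4) dvd_refl that(3)]]
          rho_expansion[OF assms that(2,5) dvd_refl that(3)]] .
    then have "cg (2 * w) (P ^ w * harm m) (P ^ w * harm m')"
      using cg_diff[OF _ cg_refl[of "2 * w" 1]] by fastforce
    then show ?thesis
      using cg_x_mult[of w w] by (simp add: mult_2)
  qed
  have "\<exists>m. m > 0 \<and> cg (2 * Suc n) a (of_nat m)" for n
  proof -
    obtain m where "m > 0" "cg (2 * Suc n) a (of_nat m)"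
      by (rule Zp_approx[OF assms, of 0 "2 * Suc n"])
    then show ?thesis by blast
  qed
  then obtain f where f: "\<And>n. f n > 0" "\<And>n. cg (2 * Suc n) a (of_nat (f n))"
    by metis
  have f_cg: "cg w (harm m) (harm (f w))" if "m > 0" "w \<ge> 1" "cg (2 * w) a (of_nat m)" for m w
    using that f(1)[of w] cg_mono[OF f(2)[of w], of "2 * w"] by (intro harm_cg) auto
  have "cg n (harm (f (Suc n))) (harm (f n))" for n
  proof -
    have "cg (Suc n) (harm (f (Suc n))) (harm (f n))"
      using f(1) f(2)[of n] cg_mono[OF f(2)[of "Suc n"], of "2 * Suc n"] by (intro harm_cg) auto
    then show ?thesis
      by (rule cg_mono) simp
  qed
  then obtain L where L: "L \<in> W" "\<And>n. cg n (harm (f n)) L"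
    using complete[of "\<lambda>n. harm (f n)"] harm_closed by blast
  have lim: "cg w (harm m) L" if "m > 0" "w \<ge> 1" "cg (2 * w) a (of_nat m)" for m w
    using f_cg[OF that] L(2) cg_trans by blast
  define F where "F = (\<lambda>n. principal {m. 0 < m \<and> a - of_nat m \<in> PIdl\<^bsub>ring_on W\<^esub> (of_nat (p ^ n))})"
  have F: "F n = principal {m. 0 < m \<and> cg n a (of_nat m)}" for n
    unfolding F_def PIdl_iff cg_diff_0 ..
  have "W_lim W p (INF n. F n) harm = L"
  proof (rule W_lim_eqI)
    show "L \<in> W" by (rule L)
    have "\<not> eventually (\<lambda>_. False) (INF n. F n)"
    proof (subst eventually_INF_base)
      fix n k
      show "\<exists>j\<in>UNIV. F j \<le> inf (F n) (F k)"
        unfolding F by (intro bexI[of _ "max n k"]) (auto intro: cg_mono)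
    next
      show "\<not> (\<exists>n\<in>UNIV. eventually (\<lambda>_. False) (F n))"
        unfolding F eventually_principal using Zp_approx[OF assms] by (metis (mono_tags, lifting) mem_Collect_eq)
    qed simp
    then show "(INF n. F n) \<noteq> bot"
      by (simp add: trivial_limit_def)
    fix n
    have "eventually (\<lambda>m. cg n (harm m) L) (F (2 * Suc n))"
      unfolding F eventually_principal using lim[of _ "Suc n"] cg_mono[of "Suc n" _ L n] by auto
    then show "eventually (\<lambda>m. cg n (harm m) L) (INF n. F n)"
      by (rule eventually_INF1[rotated]) simp
  qed
  then have "padic_digamma W p a + padic_euler W p = L"
    by (simp add: padic_digamma_def F_def harm_def[abs_def])
  then show ?thesis
    using that L(1) lim by blast
qed

end

section \<open>The coefficients of the logarithmic functions\<close>

context hyp_sums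
begin

text \<open>Written without division by A_k: if p divides k, \<open>hc_low\<close> at the digit 0
  shows that A^(1)_(k/p) / A_k is the inverse s-th power of \<open>rho a k\<close>. For
  \<open>beta_hat\<close> the same holds at the digit \<open>res a\<close>.\<close>

definition beta :: "'K \<Rightarrow> 'K \<Rightarrow> nat \<Rightarrow> 'K" where
  "beta c a k = (if k = 0 then
      of_nat s * padic_digamma W p a + of_nat s * padic_euler W p - iwasawa_log W p c / P
    else if p dvd k then (1 - c ^ (k div p) * inverse (rho a k) ^ s) / of_nat k
    else 1 / of_nat k)"

definition beta_hat :: "'K \<Rightarrow> 'K \<Rightarrow> nat \<Rightarrow> 'K" where
  "beta_hat d a k = (if res a \<le> k \<and> p dvd k - res a
    then 1 - sgn_b a * inverse (rho a k) ^ s * padic_power W p d ((of_nat k + a) / P)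
    else 1) / (of_nat k + a)"

lemma hyp_G_nth:
  assumes "a \<in> Zp W p"
  shows "fps_nth (hyp_G W p s c a) k = hc a k ^ s * beta c a k"
proof -
  have "hc a k ^ s - c ^ (k div p) * hc (prm a) (k div p) ^ s
    = hc a k ^ s * (1 - c ^ (k div p) * inverse (rho a k) ^ s)" if "p dvd k"
  proof -
    have "hc a k = hc (prm a) (k div p) * rho a k"
      using hc_low[OF assms, of 0 "k div p"] that by simp
    then show ?thesis
      using units_nonzero[OF rho_units[OF assms, of k]] by (simp add: power_mult_distrib field_simps)
  qed
  then show ?thesis
    by (simp add: hyp_G_def Let_def beta_def hyp_fps_nth)
qed

lemma hyp_G_hat_nth:
  assumes "a \<in> Zp W p"
  shows "fps_nth (hyp_G_hat W p s d a) k = hc a k ^ s * beta_hat d a k"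
proof -
  have "hc a k ^ s - (- 1) ^ (s * hyp_sign_exponent W p a) * hc (prm a) ((k - res a) div p) ^ s * z
    = hc a k ^ s * (1 - sgn_b a * inverse (rho a k) ^ s * z)" if "res a \<le> k" "p dvd k - res a" for z
  proof -
    have "res a + p * ((k - res a) div p) = k"
      using that by simp
    then have "hc a k = hc (prm a) ((k - res a) div p) * rho a k"
      using hc_low[OF assms order_refl, of "(k - res a) div p"] by simp
    then show ?thesis
      using units_nonzero[OF rho_units[OF assms, of k]]
      by (simp add: sgn_b_def power_mult_distrib field_simps)
  qed
  then show ?thesis
    by (simp add: hyp_G_hat_def Let_def beta_hat_def hyp_fps_nth)
qed

lemma nat_valuation:
  assumes "k > 0"
  obtains w k1 where "k = p ^ w * k1" "\<not> p dvd k1"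
  using multiplicity_decompose'[of k p] prime_p not_prime_unit assms by (metis less_numeral_extra(3))

text \<open>Here w is the valuation of k. One has c^(k/p) = 1 + k lam, and the inverse s-th power of
  \<open>rho\<close> is 1 - s k H modulo p^(2 w). So the numerator of \<open>beta\<close> is k (s H
  - lam) modulo p^(2 w), and division by k costs w digits.\<close>

lemma beta_approx:
  assumes a: "a \<in> Zp W p" and c: "cg 1 c 1" and m0: "m0 > 0" "cg (2 * w) a (of_nat m0)"
    and k: "k = p ^ w * k1" "\<not> p dvd k1" "w \<ge> 1" "k > 0"
  shows "cg w (beta c a k) (of_nat s * harm m0 - (c ^ (k div p) - 1) / of_nat k)"
proof -
  define H q lam where "H = harm m0" and "q = (of_nat k :: 'K)"
    and "lam = (c ^ (k div p) - 1) / of_nat k"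
  have "p dvd k"
    using k(1,3) by (metis dvd_mult2 dvd_power less_le_trans zero_less_one)
  then have pk: "p * (k div p) = k" "k div p > 0"
    using k(4) by (auto simp: dvd_div_eq_0_iff)
  have W: "H \<in> W" "q \<in> W" "lam \<in> W" "c \<in> W"
    using harm_closed power_minus_one_divide_closed[OF c pk(2)] cg_closed[OF c] pk(1)
    by (simp_all add: H_def q_def lam_def)
  have "q \<noteq> 0"
    using k(4) by (simp add: q_def)
  have qq: "q = P ^ w * of_nat k1"
    by (simp add: q_def k(1))
  have q2: "cg (2 * w) (q * q * z) 0" if "z \<in> W" for z
  proof -
    have "q * q * z = P ^ (2 * w) * (of_nat k1 * of_nat k1 * z)"
    proof -
      have "P ^ (2 * w) = P ^ w * P ^ w"
        by (simp flip: power_add mult_2)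
      then show ?thesis
        by (simp add: qq mult_ac)
    qed
    then show ?thesis
      using cg_multiple[of "of_nat k1 * of_nat k1 * z" "2 * w" "2 * w"] that
      by (simp only: mult_closed of_nat_closed order_refl)
  qed
  have rho: "rho a k \<in> units"
    by (rule rho_units[OF a])
  have inv: "cg (2 * w) (inverse (rho a k)) (1 - q * H)"
  proof -
    have "cg (2 * w) (rho a k * (1 - q * H)) ((1 + q * H) * (1 - q * H))"
      using rho_expansion[OF a m0 _ k(3), of k] k(1) W by (intro cg_mult_right) (auto simp: q_def H_def)
    also have "(1 + q * H) * (1 - q * H) = 1 - q * q * (H * H)"
      by (simp add: algebra_simps)
    also have "cg (2 * w) \<dots> (1 - 0)"
      using W by (intro cg_diff cg_refl q2) auto
    finally have "cg (2 * w) (inverse (rho a k) * (rho a k * (1 - q * H))) (inverse (rho a k) * 1)"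
      using units_inverse_closed[OF rho] by (intro cg_mult_left) auto
    moreover have "inverse (rho a k) * (rho a k * (1 - q * H)) = 1 - q * H"
      using units_nonzero[OF rho] by (simp flip: mult.assoc)
    ultimately show ?thesis
      using cg_sym by simp
  qed
  have pow: "cg (2 * w) ((1 - q * H) ^ j) (1 - of_nat j * (q * H))" for j
  proof (induction j)
    case (Suc j)
    have "cg (2 * w) ((1 - q * H) ^ Suc j) ((1 - q * H) * (1 - of_nat j * (q * H)))"
      using Suc W by (auto intro: cg_mult_left)
    also have "(1 - q * H) * (1 - of_nat j * (q * H)) = (1 - of_nat (Suc j) * (q * H)) + q * q * (of_nat j * (H * H))"
      by (simp add: algebra_simps)
    also have "cg (2 * w) \<dots> ((1 - of_nat (Suc j) * (q * H)) + 0)"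
      using W by (intro cg_add cg_refl q2) auto
    finally show ?case
      by simp
  qed simp
  have "cg (2 * w) (inverse (rho a k) ^ s) (1 - of_nat s * (q * H))"
    using cg_trans[OF cg_power[OF inv] pow] units_inverse_closed[OF rho] W by simp
  then have "cg (2 * w) (1 - (1 + q * lam) * inverse (rho a k) ^ s) (1 - (1 + q * lam) * (1 - of_nat s * (q * H)))"
    using W by (intro cg_diff cg_refl cg_mult_left) auto
  also have "1 - (1 + q * lam) * (1 - of_nat s * (q * H)) = q * (of_nat s * H - lam) + q * q * (lam * of_nat s * H)"
    by (simp add: algebra_simps)
  also have "cg (2 * w) \<dots> (q * (of_nat s * H - lam) + 0)"
    using W by (intro cg_add cg_refl q2) auto
  finally have "cg (2 * w) (1 - (1 + q * lam) * inverse (rho a k) ^ s) (q * (of_nat s * H - lam))"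
    by simp
  moreover have "1 + q * lam = c ^ (k div p)"
    using \<open>q \<noteq> 0\<close> by (simp add: lam_def q_def)
  moreover have "q * beta c a k = 1 - c ^ (k div p) * inverse (rho a k) ^ s"
    using k(4) \<open>p dvd k\<close> by (simp add: beta_def q_def)
  ultimately have "cg (w + w) (P ^ w * (of_nat k1 * beta c a k)) (P ^ w * (of_nat k1 * (of_nat s * H - lam)))"
    by (simp add: qq mult_2 mult.assoc)
  then have "cg w (of_nat k1 * beta c a k) (of_nat k1 * (of_nat s * H - lam))"
    by (simp only: cg_x_mult)
  then have "cg w (inverse (of_nat k1) * (of_nat k1 * beta c a k)) (inverse (of_nat k1) * (of_nat k1 * (of_nat s * H - lam)))"
    using units_inverse_closed[OF of_nat_units[OF k(2)]] by (rule cg_mult_left)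
  then show ?thesis
    using units_nonzero[OF of_nat_units[OF k(2)]] by (simp add: H_def lam_def flip: mult.assoc)
qed

text \<open>Continuity at 0 explains the constant B_0: in \<open>beta_approx\<close> the harmonic
  sum tends to the digamma value plus the Euler constant, and the quotient with c tends to log(c) /
  p.\<close>

lemma beta_limit:
  assumes a: "a \<in> Zp W p" and c: "cg 1 c 1"
  shows "beta c a 0 \<in> W" "\<exists>V. \<forall>k. p ^ V dvd k \<longrightarrow> cg m (beta c a k) (beta c a 0)"
proof -
  obtain L where L: "L \<in> W" "padic_digamma W p a + padic_euler W p = L"
    "\<And>m w. m > 0 \<Longrightarrow> w \<ge> 1 \<Longrightarrow> cg (2 * w) a (of_nat m) \<Longrightarrow> cg w (harm m) L"
    using harm_limit[OF a] by metis
  define lam where "lam = iwasawa_log W p c / P"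
  have beta0: "beta c a 0 = of_nat s * L - lam"
    unfolding L(2)[symmetric] by (simp add: beta_def lam_def algebra_simps)
  have lam: "lam \<in> W"
    unfolding lam_def by (rule log_limit(1)[OF c])
  then show "beta c a 0 \<in> W"
    using L(1) by (simp add: beta0)
  obtain V where V: "\<And>K. K > 0 \<Longrightarrow> p ^ V dvd K \<Longrightarrow> cg m ((c ^ K - 1) / of_nat (p * K)) lam"
    using log_limit(2)[OF c, of m] by (auto simp: lam_def)
  \<comment> \<open>The exponent covers the precision m and the bound V for the logarithm; one more
    is needed because V applies to k div p.\<close>
  have "cg m (beta c a k) (beta c a 0)" if k: "p ^ Suc (max m V) dvd k" for k
  proof (cases "k = 0")
    case False
    obtain w k1 where k1: "k = p ^ w * k1" "\<not> p dvd k1"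
      using nat_valuation[of k] False by blast
    have w: "w \<ge> Suc (max m V)"
    proof (rule ccontr)
      assume "\<not> w \<ge> Suc (max m V)"
      then have "p ^ Suc w dvd p ^ w * k1"
        using k k1(1) by (meson dvd_trans le_imp_power_dvd not_less_eq_eq)
      then show False
        using k1(2) by simp
    qed
    obtain m0 where m0: "m0 > 0" "cg (2 * w) a (of_nat m0)"
      using Zp_approx[OF a, of 0 "2 * w"] by metis
    have "p dvd k"
      using k by (metis dvd_mult_left power_Suc)
    then have pk: "p * (k div p) = k"
      by simp
    have "cg w (beta c a k) (of_nat s * harm m0 - (c ^ (k div p) - 1) / of_nat k)"
      using False w by (intro beta_approx[OF a c m0 k1]) auto
    then have "cg m (beta c a k) (of_nat s * harm m0 - (c ^ (k div p) - 1) / of_nat k)"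
      using w by (intro cg_mono[of w _ _ m]) auto
    also have "cg m \<dots> (of_nat s * L - lam)"
    proof (intro cg_diff cg_mult_left)
      show "cg m (harm m0) L"
        using L(3)[OF m0(1) _ m0(2)] w by (intro cg_mono[of w _ _ m]) auto
      have "p ^ V dvd k div p"
      proof -
        have "p * p ^ V dvd k"
          using k le_imp_power_dvd[of "Suc V" "Suc (max m V)" p] by (auto intro: dvd_trans)
        then show ?thesis
          by (metis dvd_times_left_cancel_iff pk p_neq_0)
      qed
      moreover have "k div p > 0"
        using False dvd_imp_le[OF \<open>p dvd k\<close>] by (simp add: div_greater_zero_iff)
      ultimately show "cg m ((c ^ (k div p) - 1) / of_nat k) lam"
        using V[of "k div p"] pk by simp
    qed simp
    finally show ?thesis
      by (simp only: beta0)
  qed simp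
  then show "\<exists>V. \<forall>k. p ^ V dvd k \<longrightarrow> cg m (beta c a k) (beta c a 0)"
    by blast
qed

lemma beta_closed:
  assumes a: "a \<in> Zp W p" and c: "cg 1 c 1"
  shows "beta c a k \<in> W"
proof -
  consider "k = 0" | "\<not> p dvd k" | "k > 0" "p dvd k" by blast
  then show ?thesis
  proof cases
    case 1
    then show ?thesis
      using beta_limit(1)[OF a c] by simp
  next
    case 2
    then have "k \<noteq> 0"
      by (metis dvd_0_right)
    then show ?thesis
      using 2 units_inverse_closed[OF of_nat_units[OF 2]] by (simp add: beta_def inverse_eq_divide)
  next
    case 3
    obtain w k1 where k1: "k = p ^ w * k1" "\<not> p dvd k1"
      using nat_valuation[of k] 3 by blast
    have w: "w \<ge> 1"
      using k1 3 by (cases w) auto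
    obtain m0 where m0: "m0 > 0" "cg (2 * w) a (of_nat m0)"
      using Zp_approx[OF a, of 0 "2 * w"] by metis
    have "(c ^ (k div p) - 1) / of_nat k \<in> W"
      using power_minus_one_divide_closed[OF c, of "k div p"] 3 dvd_imp_le[of p k]
      by (simp add: div_greater_zero_iff)
    then show ?thesis
      using cg_closed[OF beta_approx[OF a c m0 k1 w 3(1)]] harm_closed by simp
  qed
qed

text \<open>As k' + a is close to -k, the two quotients have nearly equal numerators and nearly
  opposite denominators. In the bound for M, 2 w pays for the two denominators, whose valuation is
  below w, and 1 for the division in the exponent (k' + a) / p.\<close>

lemma beta_reflect:
  assumes a: "a \<in> Zp W p" and c: "cg 1 c 1" and k: "k > 0" "\<not> p ^ w dvd k"
    and M: "M \<ge> 2 * w + m + 1" "cg M (a + of_nat (k + k')) 0"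
  shows "cg m (beta c a k) (- beta_hat (inverse c) a k')"
proof -
  define D where "D = of_nat k' + a"
  obtain j k1 where k1: "k = p ^ j * k1" "\<not> p dvd k1"
    using nat_valuation[of k] k by blast
  have j: "j < w"
    using k(2) k1(1) le_imp_power_dvd[of w j p] by (metis dvd_mult2 not_le)
  obtain z where z: "z \<in> W" "a + of_nat (k + k') = P ^ M * z"
    using M(2) by (auto simp: cg_def)
  have D_k: "D + of_nat k = P ^ M * z"
    using z(2) by (simp add: D_def algebra_simps)
  define D1 where "D1 = P ^ (M - j) * z - of_nat k1"
  have PM: "P ^ M = P ^ j * P ^ (M - j)"
    using M(1) j by (simp flip: power_add)
  have D: "D = P ^ j * D1"
    using D_k unfolding PM by (simp add: D1_def k1(1) algebra_simps)
  have "cg 1 D1 (0 - of_nat k1)"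
    unfolding D1_def using M(1) j z(1) by (intro cg_diff cg_multiple cg_refl) auto
  then have D1: "D1 \<in> units"
    using units_cong units_uminus[OF of_nat_units[OF k1(2)]] by simp
  have D_Zp: "D \<in> Zp W p"
    unfolding D_def using a by (intro Zp_add) auto
  have cond: "p dvd k \<longleftrightarrow> res a \<le> k' \<and> p dvd k' - res a"
  proof -
    have "p dvd k \<longleftrightarrow> cg 1 (of_nat k) 0"
      using cg_of_nat_0_iff[of 1 k] by simp
    also have "\<dots> \<longleftrightarrow> cg 1 D 0"
    proof -
      have "cg 1 (D + of_nat k) 0"
        unfolding D_k using M(1) z(1) by (intro cg_multiple) auto
      then have "cg 1 D (- of_nat k)"
        using cg_diff[OF _ cg_refl[of 1 "of_nat k"], of "D + of_nat k" 0] by simp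
      then show ?thesis
        using cg_uminus_0_iff cg_sym cg_trans by blast
    qed
    also have "\<dots> \<longleftrightarrow> k' mod p = res a"
      using cg_add_of_nat_0_iff[OF a, of k'] by (simp add: D_def add.commute)
    also have "\<dots> \<longleftrightarrow> res a \<le> k' \<and> p dvd k' - res a"
    proof
      show "res a \<le> k' \<and> p dvd k' - res a" if "k' mod p = res a"
        using that mod_less_eq_dividend[of k' p] dvd_minus_mod[of p k'] by auto
      show "k' mod p = res a" if "res a \<le> k' \<and> p dvd k' - res a"
      proof -
        from that have "p dvd k' - res a" ..
        then obtain q where "k' - res a = p * q" ..
        then have "k' = res a + p * q"
          using that by simp
        then show ?thesis
          using res(1)[OF a] by simp
      qed
    qed
    finally show ?thesis .
  qed
  have cW: "c \<in> units"
    using units_near_one[OF c] .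
  obtain X' Y' where XY: "beta c a k = X' / of_nat k" "beta_hat (inverse c) a k' = Y' / D"
    "X' \<in> W" "Y' \<in> W" "cg (M - 1) X' Y'"
  proof (cases "p dvd k")
    case False
    then show ?thesis
      using cond k(1) by (intro that[of 1 1]) (auto simp: beta_def beta_hat_def D_def)
  next
    case True
    define K where "K = k div p"
    have K: "k = p * K"
      using True by (simp add: K_def)
    define al where "al = D / P"
    have P_al: "P * al = D"
      by (simp add: al_def)
    have "cg 1 (D + of_nat k) 0" "cg 1 (of_nat k) 0"
      unfolding D_k using M(1) z(1) True cg_of_nat_0_iff[of 1 k] by (auto intro!: cg_multiple)
    then have "cg 1 (D + of_nat k - of_nat k) (0 - 0)"
      by (rule cg_diff)
    then have "al \<in> W"
      by (auto simp: cg_def al_def)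
    then have al: "al \<in> Zp W p"
      using Zp_P_mult[of al] D_Zp P_al by simp
    have M1: "M = Suc (M - 1)"
      using M(1) by simp
    have "P * (al + of_nat K) = P * (P ^ (M - 1) * z)"
      using D_k P_al K by (subst (asm) M1) (simp add: distrib_left mult.assoc)
    then have alK: "al + of_nat K = P ^ (M - 1) * z"
      by (simp only: mult_cancel_left x_nonzero simp_thms)
    \<comment> \<open>The power of 1/c with exponent al is compared with that for a natural n close
      to al. Since al + K is small, c^(n + K) is close to 1, and c^K is close to the inverse of
      c^n.\<close>
    obtain n :: nat where n: "cg (M - 1) al (of_nat n)"
      using Zp_approx[OF al] by metis
    have "cg (M - 1) (of_nat (n + K)) 0"
    proof -
      have "cg (M - 1) (of_nat n + of_nat K) (al + of_nat K)"
        by (rule cg_add[OF cg_sym[OF n] cg_refl])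
      also have "cg (M - 1) \<dots> 0"
        unfolding alK using z(1) by (intro cg_multiple) auto
      finally show ?thesis by simp
    qed
    then have "cg (M - 1) (c ^ (n + K)) 1"
      using cg_power_1[OF c] cg_of_nat_0_iff by blast
    then have "cg (M - 1) (c ^ (n + K) * inverse c ^ n) (1 * inverse c ^ n)"
      using units_inverse_closed[OF cW] by (intro cg_mult_right) auto
    moreover have "c ^ (n + K) * inverse c ^ n = c ^ K"
    proof -
      have "c ^ (n + K) * inverse c ^ n = (c * inverse c) ^ n * c ^ K"
        by (simp only: power_add power_mult_distrib mult_ac)
      then show ?thesis
        using right_inverse[OF units_nonzero[OF cW]] by (simp only: power_one mult_1)
    qed
    ultimately have "cg (M - 1) (c ^ K) (inverse c ^ n)"
      by (simp only: mult_1)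
    also have "cg (M - 1) \<dots> (padic_power W p (inverse c) al)"
      using cg_units_inverse[OF c cW units_one] by (intro cg_sym[OF padic_power_cg[OF _ al n]]) simp
    finally have cK: "cg (M - 1) (c ^ K) (padic_power W p (inverse c) al)" .
    have pW: "padic_power W p (inverse c) al \<in> W"
      using cg_closed'[OF cK] units_closed[OF cW] by simp
    have "k mod p = 0"
      using True by simp
    then have "cg M (rho a k) ((- 1) ^ hyp_sign_exponent W p a * rho a k')"
      using rho_reflect[OF a _ M(2)] M(1) by simp
    then have "cg M (inverse (rho a k)) (inverse ((- 1) ^ hyp_sign_exponent W p a * rho a k'))"
      by (intro cg_units_inverse units_mult rho_units[OF a] units_power units_uminus units_one)
    also have "inverse ((- 1) ^ hyp_sign_exponent W p a * rho a k')
      = (- 1) ^ hyp_sign_exponent W p a * inverse (rho a k')"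
      by (cases "even (hyp_sign_exponent W p a)") simp_all
    finally have "cg M (inverse (rho a k) ^ s) (((- 1) ^ hyp_sign_exponent W p a * inverse (rho a k')) ^ s)"
      using units_inverse_closed[OF rho_units[OF a]] by (intro cg_power) auto
    then have "cg (M - 1) (inverse (rho a k) ^ s) (sgn_b a * inverse (rho a k') ^ s)"
      using cg_mono[of M _ _ "M - 1"] by (simp add: sgn_b_def power_mult_distrib mult.commute[of s] power_mult)
    then have "cg (M - 1) (1 - c ^ K * inverse (rho a k) ^ s)
      (1 - padic_power W p (inverse c) al * (sgn_b a * inverse (rho a k') ^ s))"
      using cK units_inverse_closed[OF rho_units[OF a]] units_closed[OF cW]
      by (intro cg_diff cg_refl cg_mult) auto
    moreover have "beta c a k = (1 - c ^ K * inverse (rho a k) ^ s) / of_nat k"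
      using True k(1) by (simp add: beta_def K_def)
    moreover have "beta_hat (inverse c) a k' =
      (1 - padic_power W p (inverse c) al * (sgn_b a * inverse (rho a k') ^ s)) / D"
      using True cond by (simp add: beta_hat_def al_def D_def mult_ac)
    ultimately show ?thesis
      using units_inverse_closed[OF rho_units[OF a]] units_closed[OF cW] pW
      by (intro that) auto
  qed
  obtain y where y: "y \<in> W" "X' - Y' = P ^ (M - 1) * y"
    using XY(5) by (auto simp: cg_def)
  define r where "r = M - 1 - 2 * j - m"
  have r: "M - 1 = j + j + (m + r)"
    using M(1) j by (simp add: r_def)
  have "M = j + j + (m + Suc r)"
    using M(1) j by (simp add: r_def)
  then have pM: "P ^ M = P ^ j * P ^ j * (P ^ m * P ^ Suc r)"
    by (simp only: power_add)
  have pM1: "P ^ (M - 1) = P ^ j * P ^ j * (P ^ m * P ^ r)"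
    unfolding r by (simp only: power_add)
  have nz: "P ^ j \<noteq> 0" "(of_nat k1 :: 'K) \<noteq> 0" "D1 \<noteq> 0"
    using units_nonzero[OF of_nat_units[OF k1(2)]] units_nonzero[OF D1] by auto
  have kD: "(of_nat k :: 'K) \<noteq> 0" "D \<noteq> 0"
    using nz k(1) by (auto simp: D)
  \<comment> \<open>Over the common denominator, the numerator is arranged so that each of its two
    terms contains a small factor, D + k or X' - Y'.\<close>
  have "beta c a k - - beta_hat (inverse c) a k' = (X' * (D + of_nat k) - (X' - Y') * of_nat k) / (of_nat k * D)"
    unfolding XY(1,2) using kD by (simp add: field_simps)
  also have "X' * (D + of_nat k) - (X' - Y') * of_nat k =
      P ^ j * P ^ j * (P ^ m * (X' * P ^ Suc r * z - P ^ r * y * of_nat k))"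
    unfolding D_k y(2) pM pM1 by (simp add: algebra_simps)
  also have "of_nat k * D = P ^ j * P ^ j * (of_nat k1 * D1)"
    by (simp add: k1(1) D mult_ac)
  also have "P ^ j * P ^ j * (P ^ m * (X' * P ^ Suc r * z - P ^ r * y * of_nat k)) / (P ^ j * P ^ j * (of_nat k1 * D1))
    = P ^ m * ((X' * P ^ Suc r * z - P ^ r * y * of_nat k) * (inverse (of_nat k1) * inverse D1))"
    by (subst mult_divide_mult_cancel_left) (use nz in \<open>simp_all add: divide_inverse mult.assoc\<close>)
  finally have "beta c a k - - beta_hat (inverse c) a k' =
    P ^ m * ((X' * P ^ Suc r * z - P ^ r * y * of_nat k) * (inverse (of_nat k1) * inverse D1))" .
  moreover have "(X' * P ^ Suc r * z - P ^ r * y * of_nat k) * (inverse (of_nat k1) * inverse D1) \<in> W"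
    using XY(3) z(1) y(1) units_inverse_closed[OF D1] units_inverse_closed[OF of_nat_units[OF k1(2)]]
    by (intro mult_closed diff_closed power_closed) auto
  ultimately show ?thesis
    unfolding cg_def by blast
qed

text \<open>The precision in \<open>beta_reflect\<close> degenerates as k tends to 0. For k
  divisible by p^V, the index k' is therefore matched with another nonzero k2, again divisible by
  p^V but as close to -a - k' as its own valuation requires. Continuity of \<open>beta\<close> at 0
  relates k to k2.\<close>

lemma reflected_beta:
  assumes a: "a \<in> Zp W p" "\<And>n::nat. a \<noteq> - of_nat n" and c: "cg 1 c 1"
  shows "reflected a (beta c a) (\<lambda>k. - beta_hat (inverse c) a k)"
proof -
  text \<open>A nonzero index \<open>k\<close> close to \<open>-a - k'\<close>, which exists because \<open>-a\<close> is not a natural number.\<close>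
  have partner: "\<exists>k w. k > 0 \<and> \<not> p ^ w dvd k \<and> cg (2 * w + m + V + 1) (a + of_nat (k + k')) 0" for k' m V
  proof -
    define D where "D = a + of_nat k'"
    have D: "D \<in> Zp W p"
      unfolding D_def using a(1) by (intro Zp_add) auto
    have "D \<noteq> 0"
      using a(2)[of k'] by (simp add: D_def eq_neg_iff_add_eq_0)
    then obtain w where w: "\<not> cg w D 0"
      using separated[OF Zp_closed[OF D]] by blast
    obtain k where k: "k > 0" "cg (2 * w + m + V + 1) (- D) (of_nat k)"
      by (rule Zp_approx[OF Zp_uminus[OF D]])
    have "\<not> p ^ w dvd k"
    proof
      assume "p ^ w dvd k"
      then have "cg w (of_nat k) 0"
        by (simp only: cg_of_nat_0_iff)
      moreover have "cg w (- D) (of_nat k)"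
        using k(2) by (rule cg_mono) simp
      ultimately show False
        using w cg_uminus_0_iff cg_trans by blast
    qed
    moreover have "cg (2 * w + m + V + 1) (a + of_nat (k + k')) 0"
    proof -
      have "a + of_nat (k + k') = D + of_nat k"
        by (simp add: D_def)
      then show ?thesis
        unfolding \<open>a + of_nat (k + k') = D + of_nat k\<close>
        using cg_add[OF cg_refl cg_sym[OF k(2)], of D] by simp
    qed
    ultimately show ?thesis
      using k(1) by blast
  qed
  \<comment> \<open>Integrality of \<open>beta_hat\<close>, hidden by its denominator, is inherited
    from \<open>beta\<close> through a congruence modulo p^0.\<close>
  have hat_closed: "- beta_hat (inverse c) a k' \<in> W" for k'
  proof -
    obtain k w where k: "k > 0" "\<not> p ^ w dvd k" "cg (2 * w + 0 + 0 + 1) (a + of_nat (k + k')) 0"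
      using partner by blast
    have "cg 0 (beta c a k) (- beta_hat (inverse c) a k')"
      by (rule beta_reflect[OF a(1) c k(1,2) _ k(3)]) simp
    then show ?thesis
      using beta_closed[OF a(1) c] cg_closed' by blast
  qed
  have "\<exists>M. \<forall>k k'. cg M (a + of_nat (k + k')) 0 \<longrightarrow> cg m (beta c a k) (- beta_hat (inverse c) a k')" for m
  proof -
    obtain V where V: "\<And>k. p ^ V dvd k \<Longrightarrow> cg m (beta c a k) (beta c a 0)"
      using beta_limit(2)[OF a(1) c] by blast
    have "cg m (beta c a k) (- beta_hat (inverse c) a k')"
      if kk': "cg (2 * V + m + 1) (a + of_nat (k + k')) 0" for k k'
    proof (cases "p ^ V dvd k")
      case False
      then have "k > 0"
        by (intro gr0I) auto
      then show ?thesis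
        using False kk' by (intro beta_reflect[OF a(1) c]) auto
    next
      case True
      obtain k2 w where k2: "k2 > 0" "\<not> p ^ w dvd k2" "cg (2 * w + m + V + 1) (a + of_nat (k2 + k')) 0"
        using partner by blast
      have "cg V (a + of_nat (k2 + k') - (a + of_nat (k + k'))) (0 - 0)"
        using cg_mono[OF k2(3), of V] cg_mono[OF kk', of V] by (intro cg_diff) auto
      then have "cg V (of_nat k2) (of_nat k)"
        by (simp add: cg_diff_0)
      moreover have "cg V (of_nat k) 0"
        using True by (simp only: cg_of_nat_0_iff)
      ultimately have "cg V (of_nat k2) 0"
        by (rule cg_trans)
      then have "p ^ V dvd k2"
        by (simp only: cg_of_nat_0_iff)
      then have "cg m (beta c a k) (beta c a k2)"
        by (rule cg_trans[OF V[OF True] cg_sym[OF V]])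
      also have "cg m \<dots> (- beta_hat (inverse c) a k')"
        by (rule beta_reflect[OF a(1) c k2(1,2) _ k2(3)]) simp
      finally show ?thesis .
    qed
    then show ?thesis
      by blast
  qed
  then show ?thesis
    using beta_closed[OF a(1) c] hat_closed by (simp add: reflected_def)
qed

end

section \<open>Invertibility of the truncated hypergeometric series\<close>

context adic_subring
begin

section \<open>Frobenius modulo p and the factorisation of the truncations\<close>

lemma freshman_add:
  assumes "x = of_nat p" "Factorial_Ring.prime p" "u \<in> A" "v \<in> A"
  shows "cg 1 ((u + v) ^ p) (u ^ p + v ^ p)"
proof -
  have p: "p > 0"
    using prime_gt_0_nat[OF assms(2)] .
  have "(u + v) ^ p = (\<Sum>k\<in>{..p}. of_nat (p choose k) * u ^ k * v ^ (p - k))"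
    by (rule binomial_ring)
  also have "cg 1 \<dots> (\<Sum>k\<in>{..p}. if k \<in> {0, p} then u ^ k * v ^ (p - k) else 0)"
  proof (rule cg_sum)
    fix k
    assume k: "k \<in> {..p}"
    show "cg 1 (of_nat (p choose k) * u ^ k * v ^ (p - k)) (if k \<in> {0, p} then u ^ k * v ^ (p - k) else 0)"
    proof (cases "k \<in> {0, p}")
      case False
      then obtain j where "p choose k = p * j"
        using k dvd_choose_prime[of k p] assms(2) p by (auto elim: dvdE)
      then show ?thesis
        using False assms(1,3,4) cg_multiple[of "of_nat j * u ^ k * v ^ (p - k)" 1 1]
        by (simp add: mult.assoc)
    qed auto
  qed
  also have "(\<Sum>k\<in>{..p}. if k \<in> {0, p} then u ^ k * v ^ (p - k) else 0)
    = (\<Sum>k\<in>{0, p}. u ^ k * v ^ (p - k))"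
    by (intro sum.mono_neutral_cong_right) auto
  also have "\<dots> = u ^ p + v ^ p"
    using p by (simp add: add.commute)
  finally show ?thesis .
qed

lemma freshman_sum:
  assumes "x = of_nat p" "Factorial_Ring.prime p" "\<And>i. i \<in> I \<Longrightarrow> f i \<in> A" "finite I"
  shows "cg 1 (sum f I ^ p) (\<Sum>i\<in>I. f i ^ p)"
  using assms(4,3)
proof (induction I)
  case empty
  then show ?case
    using prime_gt_0_nat[OF assms(2)] by (simp add: power_0_left)
next
  case (insert i I)
  have "cg 1 ((f i + sum f I) ^ p) (f i ^ p + sum f I ^ p)"
    using insert.prems assms by (intro freshman_add sum_closed) auto
  also have "cg 1 \<dots> (f i ^ p + (\<Sum>i\<in>I. f i ^ p))"
    using insert by (intro cg_add cg_refl) auto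
  finally show ?case
    using insert by simp
qed

end

context hyp_sums
begin

lemma S_cg: "b \<in> Zp W p \<Longrightarrow> x \<in> B \<Longrightarrow> (\<And>k. cg m (f k) (g k)) \<Longrightarrow> B.cg m (S b n f x) (S b n g x)"
  unfolding S_def using hc_closed[of b]
  by (intro B.cg_sum B.cg_mult_right cg_const cg_mult_left) auto

text \<open>For u \<le> \<open>res b\<close>, reflection modulo p compares
  \<open>rho b (u + p * k)\<close> with a value independent of k; for larger u both sides are
  divisible by p. This is the congruence between the coefficient at u + p k and the product of the
  coefficient at u with that for b' at k.\<close>

lemma lo_one_cg:
  assumes "b \<in> Zp W p" "u < p"
  shows "cg 1 (lo b (\<lambda>_. 1) u k) (hc b u ^ s * 1)"
proof (cases "u \<le> res b")
  case True
  define e where "e = hyp_sign_exponent W p b"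
  have rho: "cg 1 (rho b (u + p * i)) ((- 1) ^ e * rho b (res b - u))" for i
  proof -
    have "(u + p * i + (res b - u)) mod p = res b"
      using True res(1)[OF assms(1)] by simp
    then have "cg 1 (b + of_nat (u + p * i + (res b - u))) 0"
      by (simp only: cg_add_of_nat_0_iff[OF assms(1)])
    then show ?thesis
      using rho_reflect[OF assms(1), of 1 "u + p * i" "res b - u"] True assms(2) by (simp add: e_def)
  qed
  have "cg 1 (rho b (u + p * k)) (rho b (u + p * 0))"
    by (rule cg_trans[OF rho cg_sym[OF rho]])
  then have "cg 1 (rho b (u + p * k) ^ s) (rho b (u + p * 0) ^ s)"
    using units_closed[OF rho_units[OF assms(1)]] by (intro cg_power)
  then show ?thesis
    using hc_low[OF assms(1) True, of 0] True by (simp add: lo_def)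
next
  case False
  have "cg 1 ((P * z) ^ s) 0" if "z \<in> W" for z
    using s_pos that cg_multiple[of "z * (P * z) ^ (s - 1)" 1 1]
    by (cases s) (simp_all add: mult.assoc)
  note 0 = this
  have W: "rho b i \<in> W" "prm b \<in> W" for i
    using units_closed[OF rho_units[OF assms(1)]] Zp_closed[OF prm_Zp[OF assms(1)]] by auto
  have "cg 1 (lo b (\<lambda>_. 1) u k) 0"
    using False 0[of "(prm b + of_nat k) * rho b (u + p * k)"] W by (simp add: lo_def mult.assoc)
  also have "cg 1 0 (hc b u ^ s * 1)"
    using hc_high[OF assms(1) _ assms(2), of 0] False W
      cg_sym[OF 0[of "prm b * rho b u"]] by (simp add: mult.assoc)
  finally show ?thesis .
qed

definition F1 :: "'K \<Rightarrow> 'K poly fract \<Rightarrow> 'K poly fract" where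
  "F1 b = S b 1 (\<lambda>_. 1)"

lemma F1_closed: "b \<in> Zp W p \<Longrightarrow> x \<in> B \<Longrightarrow> F1 b x \<in> B"
  unfolding F1_def by (intro S_closed) auto

lemma S_one_mod_p:
  assumes "b \<in> Zp W p" "x \<in> B"
  shows "B.cg 1 (S b (Suc n) (\<lambda>_. 1) x) (F1 b x * S (prm b) n (\<lambda>_. 1) (x ^ p))"
proof -
  have "S b (Suc n) (\<lambda>_. 1) x = (\<Sum>u<p. x ^ u * S (prm b) n (lo b (\<lambda>_. 1) u) (x ^ p))"
    by (rule S_split[OF assms(1)])
  also have "B.cg 1 \<dots> (\<Sum>u<p. x ^ u * S (prm b) n (\<lambda>k. hc b u ^ s * 1) (x ^ p))"
    using assms by (intro B.cg_sum B.cg_mult_left S_cg lo_one_cg prm_Zp) auto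
  also have "\<dots> = F1 b x * S (prm b) n (\<lambda>_. 1) (x ^ p)"
    unfolding S_scale F1_def S_def[of b 1] power_one_right sum_distrib_right
    by (intro sum.cong refl) (simp add: mult_ac)
  finally show ?thesis .
qed

text \<open>The coefficients reduce into the prime field, so that the Frobenius fixes them and acts
  on \<open>F1\<close> through the variable alone.\<close>

lemma hc_integral_mod_p:
  assumes "b \<in> Zp W p" "u < p"
  obtains m :: int where "cg 1 (hc b u) (of_int m)"
proof -
  have f: "(fact u :: 'K) \<in> units"
    using of_nat_units[of "fact u"] assms(2) prime_dvd_fact_iff[OF prime_p] by simp
  obtain N :: nat where N: "cg 1 (- b) (of_nat N)"
    using Zp_approx[OF Zp_uminus[OF assms(1)]] by metis
  have "cg 1 (fact u * (- b gchoose u)) (fact u * (of_nat N gchoose u))"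
    using N Zp_closed[OF assms(1)] by (intro cg_fact_gchoose) auto
  then have "cg 1 (inverse (fact u) * (fact u * (- b gchoose u))) (inverse (fact u) * (fact u * (of_nat N gchoose u)))"
    using units_inverse_closed[OF f] by (rule cg_mult_left)
  then have "cg 1 ((- 1) ^ u * (- b gchoose u)) ((- 1) ^ u * (of_nat N gchoose u))"
    by (intro cg_mult_left) (simp_all flip: mult.assoc)
  moreover have "(- 1) ^ u * (of_nat N gchoose u) = (of_int ((- 1) ^ u * int (N choose u)) :: 'K)"
    by (simp add: binomial_gbinomial)
  ultimately show ?thesis
    using that[of "(- 1) ^ u * int (N choose u)"] by (simp only: hc_eq_gchoose)
qed

lemma fermat_cg: "cg 1 (of_int m ^ p) (of_int m)"
proof -
  define N where "N = nat (m mod int p)"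
  have "int (p ^ 1) dvd m - int N"
    by (simp add: N_def flip: mod_eq_dvd_iff)
  then have m: "cg 1 (of_int m) (of_nat N)"
    using cg_of_int_iff[of 1 m "int N"] by simp
  have "cg 1 ((\<Sum>i<N. 1) ^ p) (\<Sum>i<N. 1 ^ p)"
    by (intro freshman_sum prime_p) auto
  then have "cg 1 (of_nat N ^ p) (of_nat N)"
    by simp
  then show ?thesis
    using cg_power[OF m, of p] cg_sym[OF m] cg_trans by (meson of_int_closed of_nat_closed)
qed

lemma F1_frobenius:
  assumes "b \<in> Zp W p" "x \<in> B"
  shows "B.cg 1 (F1 b (x ^ p)) (F1 b x ^ p)"
proof -
  have "B.cg 1 (F1 b x ^ p) (\<Sum>k<p. (rat_const (hc b k ^ s * 1) * x ^ k) ^ p)"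
    unfolding F1_def S_def power_one_right
    using hc_closed[OF assms(1)] assms(2)
    by (intro B.freshman_sum prime_p B.mult_closed const_closed) auto
  also have "B.cg 1 \<dots> (\<Sum>k<p. rat_const (hc b k ^ s * 1) * (x ^ p) ^ k)"
  proof (rule B.cg_sum)
    fix k
    assume "k \<in> {..<p}"
    then obtain m where m: "cg 1 (hc b k) (of_int m)"
      using hc_integral_mod_p[OF assms(1), of k] by auto
    have hW: "hc b k \<in> W"
      by (rule hc_closed[OF assms(1)])
    have "cg 1 (hc b k ^ p) (of_int m ^ p)"
      using m hW by (intro cg_power) auto
    also have "cg 1 \<dots> (of_int m)"
      by (rule fermat_cg)
    also have "cg 1 \<dots> (hc b k)"
      by (rule cg_sym[OF m])
    finally have "cg 1 ((hc b k ^ p) ^ s) (hc b k ^ s)"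
      using hW by (intro cg_power) auto
    then have "B.cg 1 (rat_const ((hc b k ^ p) ^ s) * (x ^ p) ^ k) (rat_const (hc b k ^ s) * (x ^ p) ^ k)"
      using assms(2) by (intro B.cg_mult_right cg_const) auto
    moreover have "(rat_const (hc b k ^ s * 1) * x ^ k) ^ p = rat_const ((hc b k ^ p) ^ s) * (x ^ p) ^ k"
      by (simp add: power_mult_distrib mult.commute flip: power_mult)
    ultimately show "B.cg 1 ((rat_const (hc b k ^ s * 1) * x ^ k) ^ p) (rat_const (hc b k ^ s * 1) * (x ^ p) ^ k)"
      by simp
  qed
  also have "\<dots> = F1 b (x ^ p)"
    by (simp add: F1_def S_def)
  finally show ?thesis
    by (rule B.cg_sym)
qed

lemma prm_funpow_Zp: "b \<in> Zp W p \<Longrightarrow> (prm ^^ i) b \<in> Zp W p"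
  by (induction i) (auto intro: prm_Zp)

text \<open>\<open>S_one_mod_p\<close> is iterated; each value at x^p becomes a p-th power by
  \<open>F1_frobenius\<close>, whence the exponents p^i.\<close>

lemma S_one_product:
  assumes "b \<in> Zp W p" "x \<in> B"
  shows "B.cg 1 (S b n (\<lambda>_. 1) x) (\<Prod>i<n. F1 ((prm ^^ i) b) x ^ (p ^ i))"
  using assms
proof (induction n arbitrary: b x)
  case 0
  then show ?case
    by (simp add: S_def)
next
  case (Suc n)
  have F: "F1 ((prm ^^ i) (prm b)) y \<in> B" if "y \<in> B" for i y
    using Suc.prems(1) that by (intro F1_closed prm_funpow_Zp prm_Zp)
  have "B.cg 1 (S b (Suc n) (\<lambda>_. 1) x) (F1 b x * S (prm b) n (\<lambda>_. 1) (x ^ p))"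
    by (rule S_one_mod_p[OF Suc.prems])
  also have "B.cg 1 \<dots> (F1 b x * (\<Prod>i<n. F1 ((prm ^^ i) (prm b)) (x ^ p) ^ (p ^ i)))"
    using Suc.prems by (intro B.cg_mult_left Suc.IH prm_Zp F1_closed) auto
  also have "B.cg 1 \<dots> (F1 b x * (\<Prod>i<n. (F1 ((prm ^^ i) (prm b)) x ^ p) ^ (p ^ i)))"
    using Suc.prems F
    by (intro B.cg_mult_left B.cg_prod B.cg_power F1_frobenius B.power_closed F1_closed prm_funpow_Zp prm_Zp) auto
  also have "\<dots> = (\<Prod>i<Suc n. F1 ((prm ^^ i) b) x ^ (p ^ i))"
    unfolding prod.lessThan_Suc_shift by (simp add: funpow_swap1 flip: power_mult)
  finally show ?case .
qed

lemma S_one_Unit: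
  assumes "b \<in> Zp W p" "x \<in> B" "\<And>i. F1 ((prm ^^ i) b) x \<in> B.units"
  shows "B.to_completion (S b n (\<lambda>_. 1) x) \<in> Units B.completion"
proof -
  define Q where "Q = (\<Prod>i<n. F1 ((prm ^^ i) b) x ^ (p ^ i))"
  have Q: "Q \<in> B.units"
    unfolding Q_def using assms(3) by (intro B.units_prod B.units_power)
  have "B.cg 1 (S b n (\<lambda>_. 1) x * inverse Q) (Q * inverse Q)"
    using S_one_product[OF assms(1,2), of n] B.units_inverse_closed[OF Q]
    unfolding Q_def by (rule B.cg_mult_right)
  then show ?thesis
    using B.units_nonzero[OF Q] B.units_inverse_closed[OF Q] S_closed[OF assms(1) _ assms(2), of "\<lambda>_. 1" n]
    by (intro B.to_completion_Unit[of _ "inverse Q"]) auto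
qed

end

section \<open>The transformation formula\<close>

context adic_subring
begin

lemma near_mult:
  "f m = f' m \<Longrightarrow> g m = g' m \<Longrightarrow> (f \<otimes>\<^bsub>completion\<^esub> g) m = (f' \<otimes>\<^bsub>completion\<^esub> g') m"
  by (simp add: adic_completion_def)

lemma near_uminus:
  assumes "f \<in> carrier completion" "g \<in> carrier completion" "f m = g m"
  shows "(\<ominus>\<^bsub>completion\<^esub> f) m = (\<ominus>\<^bsub>completion\<^esub> g) m"
proof -
  have neg: "\<ominus>\<^bsub>completion\<^esub> h = \<ominus>\<^bsub>completion\<^esub> \<one>\<^bsub>completion\<^esub> \<otimes>\<^bsub>completion\<^esub> h"
    if "h \<in> carrier completion" for h
    by (simp only: C.l_minus[OF C.one_closed that] C.l_one[OF that])
  show ?thesis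
    unfolding neg[OF assms(1)] neg[OF assms(2)] using assms(3) by (intro near_mult refl)
qed

lemma to_completion_uminus:
  "r \<in> A \<Longrightarrow> to_completion (- r) = \<ominus>\<^bsub>completion\<^esub> to_completion r"
  using to_completion_add[of "- r" r]
  by (intro C.minus_equality[symmetric]) (simp_all add: to_completion_zero)

lemma near_to_completion: "to_completion r m = to_completion s m \<longleftrightarrow> cg m r s"
  by (simp add: to_completion_eq cls_eq_iff)

text \<open>The inverses exist only in the completion, so the assumption is a cross-multiplied
  congruence in the ring. Both quotients are expanded to the common denominator v v'.\<close>

lemma near_quotients:
  assumes "cg m (u * v') (v * u')" "u \<in> A" "v \<in> A" "u' \<in> A" "v' \<in> A"
    and v: "to_completion v \<in> Units completion" and v': "to_completion v' \<in> Units completion"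
  shows "(to_completion u \<otimes>\<^bsub>completion\<^esub> inv\<^bsub>completion\<^esub> to_completion v) m
    = (to_completion u' \<otimes>\<^bsub>completion\<^esub> inv\<^bsub>completion\<^esub> to_completion v') m"
proof -
  define i i' where "i = inv\<^bsub>completion\<^esub> to_completion v" and "i' = inv\<^bsub>completion\<^esub> to_completion v'"
  have ii: "i \<in> carrier completion" "i' \<in> carrier completion"
    using v v' by (simp_all add: i_def i'_def)
  have iv: "to_completion v \<otimes>\<^bsub>completion\<^esub> i = \<one>\<^bsub>completion\<^esub>" "to_completion v' \<otimes>\<^bsub>completion\<^esub> i' = \<one>\<^bsub>completion\<^esub>"
    using v v' by (simp_all add: i_def i'_def)
  have "to_completion u \<otimes>\<^bsub>completion\<^esub> i
    = to_completion u \<otimes>\<^bsub>completion\<^esub> i \<otimes>\<^bsub>completion\<^esub> (to_completion v' \<otimes>\<^bsub>completion\<^esub> i')"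
    using ii assms(2) by (simp add: iv)
  also have "\<dots> = to_completion (u * v') \<otimes>\<^bsub>completion\<^esub> (i \<otimes>\<^bsub>completion\<^esub> i')"
    using ii assms(2-5) by (simp add: to_completion_mult C.m_ac)
  finally have 1: "to_completion u \<otimes>\<^bsub>completion\<^esub> i = to_completion (u * v') \<otimes>\<^bsub>completion\<^esub> (i \<otimes>\<^bsub>completion\<^esub> i')" .
  have "to_completion u' \<otimes>\<^bsub>completion\<^esub> i'
    = to_completion u' \<otimes>\<^bsub>completion\<^esub> i' \<otimes>\<^bsub>completion\<^esub> (to_completion v \<otimes>\<^bsub>completion\<^esub> i)"
    using ii assms(4) by (simp add: iv)
  also have "\<dots> = to_completion (v * u') \<otimes>\<^bsub>completion\<^esub> (i \<otimes>\<^bsub>completion\<^esub> i')"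
    using ii assms(2-5) by (simp add: to_completion_mult C.m_ac)
  finally have 2: "to_completion u' \<otimes>\<^bsub>completion\<^esub> i' = to_completion (v * u') \<otimes>\<^bsub>completion\<^esub> (i \<otimes>\<^bsub>completion\<^esub> i')" .
  show ?thesis
    unfolding i_def[symmetric] i'_def[symmetric] 1 2
    using assms(1) by (intro near_mult) (simp_all add: near_to_completion)
qed

end

lemma hom_inv:
  assumes "cring R" "cring S" "f \<in> ring_hom R S" "u \<in> Units R"
  shows "f u \<in> Units S" "f (inv\<^bsub>R\<^esub> u) = inv\<^bsub>S\<^esub> f u"
proof -
  interpret R: cring R by fact
  interpret S: cring S by fact
  have c: "f u \<in> carrier S" "f (inv\<^bsub>R\<^esub> u) \<in> carrier S"
    using assms(3,4) by (auto intro: ring_hom_closed)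
  have 1: "f u \<otimes>\<^bsub>S\<^esub> f (inv\<^bsub>R\<^esub> u) = \<one>\<^bsub>S\<^esub>"
    using ring_hom_mult[OF assms(3), of u "inv\<^bsub>R\<^esub> u"] ring_hom_one[OF assms(3)] assms(4)
    by (simp add: R.Units_closed)
  then show "f u \<in> Units S"
    using c S.m_comm[OF c] by (auto simp: Units_def)
  show "f (inv\<^bsub>R\<^esub> u) = inv\<^bsub>S\<^esub> f u"
    using S.inv_unique'[OF c 1] 1 S.m_comm[OF c] by simp
qed

context hyp_sums
begin

lemma S_eq_trunc_at:
  assumes "\<And>k. fps_nth G k = hc a k ^ s * f k"
  shows "trunc_at G (p ^ n) x = S a n f x"
  by (simp add: trunc_at_def S_def assms)

lemma quotient_limits:
  fixes t t' :: "'K poly fract"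
  assumes a: "a \<in> Zp W p" "\<And>n::nat. a \<noteq> - of_nat n" and c: "cg 1 c 1"
    and t: "t \<in> B" "t' \<in> B" "t * t' = 1"
    and units: "\<And>n. B.to_completion (S a n (\<lambda>_. 1) t) \<in> Units B.completion"
    and hom: "\<omega> \<in> ring_hom B.completion B.completion"
    and const: "\<And>w. w \<in> W \<Longrightarrow> \<omega> (B.to_completion (rat_const w)) = B.to_completion (rat_const w)"
    and cont: "\<And>z n. z \<in> carrier B.completion \<Longrightarrow> \<exists>m. \<forall>y\<in>carrier B.completion. y m = z m \<longrightarrow> \<omega> y n = \<omega> z n"
    and \<omega>t: "\<omega> (B.to_completion t) = B.to_completion t'"
  defines "quot \<equiv> (\<lambda>f n. B.to_completion (S a n f t) \<otimes>\<^bsub>B.completion\<^esub>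
    inv\<^bsub>B.completion\<^esub> B.to_completion (S a n (\<lambda>_. 1) t))"
  shows "adic_lim B.completion (B.to_completion (of_nat p)) sequentially (quot (beta c a)) =
    \<ominus>\<^bsub>B.completion\<^esub> \<omega> (adic_lim B.completion (B.to_completion (of_nat p)) sequentially (quot (beta_hat (inverse c) a)))"
proof -
  let ?C = "B.completion" and ?i = "B.to_completion"
  define f g where "f = beta c a" and "g = beta_hat (inverse c) a"
  have refl: "reflected a f (\<lambda>k. - g k)"
    unfolding f_def g_def by (rule reflected_beta[OF a c])
  then have fg: "f k \<in> W" "g k \<in> W" for k
    using uminus_closed[of "- g k"] by (auto simp: reflected_def)
  have one: "reflected a (\<lambda>_. 1) (\<lambda>_. 1)"
    by (simp add: reflected_def)
  have S_B: "S a n h x \<in> B" if "\<And>k. h k \<in> W" "x \<in> B" for n h x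
    using S_closed[OF a(1)] that .
  have hom_i: "\<omega> (?i u) \<in> carrier ?C" if "u \<in> B" for u
    using ring_hom_closed[OF hom B.to_completion_closed[OF that]] .
  have pow: "\<omega> (?i (t ^ k)) = ?i (t' ^ k)" for k
  proof (induction k)
    case 0
    then show ?case
      using ring_hom_one[OF hom] by (simp add: B.to_completion_one)
  next
    case (Suc k)
    then show ?case
      using ring_hom_mult[OF hom, of "?i t" "?i (t ^ k)"] t by (simp add: B.to_completion_mult \<omega>t)
  qed
  have \<omega>S: "\<omega> (?i (S a n h t)) = ?i (S a n h t')" if h: "\<And>k. h k \<in> W" for h n
  proof -
    define q where "q = (\<lambda>x N. \<Sum>k<N. rat_const (hc a k ^ s * h k) * x ^ k)"
    have coef: "rat_const (hc a k ^ s * h k) \<in> B" "hc a k ^ s * h k \<in> W" for k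
      using const_closed hc_closed[OF a(1)] h by (blast intro: mult_closed power_closed)+
    have q: "q x N \<in> B" if "x \<in> B" for x N
      unfolding q_def using coef that by (intro B.sum_closed B.mult_closed B.power_closed) auto
    have "\<omega> (?i (q t N)) = ?i (q t' N)" for N
    proof (induction N)
      case 0
      have "\<omega> (?i (rat_const 0)) = ?i (rat_const 0)"
        by (rule const) simp
      then show ?case
        by (simp add: q_def)
    next
      case (Suc N)
      define r where "r = rat_const (hc a N ^ s * h N)"
      have r: "r \<in> B" "\<omega> (?i r) = ?i r"
        unfolding r_def using coef const by blast+
      have "\<omega> (?i (q t N + r * t ^ N)) = \<omega> (?i (q t N)) \<oplus>\<^bsub>?C\<^esub> \<omega> (?i r) \<otimes>\<^bsub>?C\<^esub> \<omega> (?i (t ^ N))"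
        using ring_hom_add[OF hom, of "?i (q t N)" "?i (r * t ^ N)"] ring_hom_mult[OF hom, of "?i r" "?i (t ^ N)"]
          q[OF t(1), of N] r(1) t(1) by (simp add: B.to_completion_add B.to_completion_mult)
      also have "\<dots> = ?i (q t' N + r * t' ^ N)"
        using q[OF t(2), of N] r t(2) Suc pow by (simp add: B.to_completion_add B.to_completion_mult)
      finally show ?case
        by (simp add: q_def r_def)
    qed
    then show ?thesis
      by (simp add: q_def S_def)
  qed
  \<comment> \<open>At 1/t the denominators are invertible as images of units under the
    homomorphism.\<close>
  have units': "?i (S a n (\<lambda>_. 1) t') \<in> Units ?C" for n
    using hom_inv(1)[OF B.cring_completion B.cring_completion hom units[of n]] \<omega>S[of "\<lambda>_. 1" n] by simp
  have quot_closed: "quot h n \<in> carrier ?C" if "\<And>k. h k \<in> W" for h n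
    unfolding quot_def using S_B[OF that t(1)] units B.C.Units_inv_closed by simp
  have \<omega>quot: "\<omega> (quot h n) = ?i (S a n h t') \<otimes>\<^bsub>?C\<^esub> inv\<^bsub>?C\<^esub> ?i (S a n (\<lambda>_. 1) t')"
    if h: "\<And>k. h k \<in> W" for h n
    using ring_hom_mult[OF hom, of "?i (S a n h t)" "inv\<^bsub>?C\<^esub> ?i (S a n (\<lambda>_. 1) t)"]
      hom_inv(2)[OF B.cring_completion B.cring_completion hom units[of n]]
      \<omega>S[of h n] \<omega>S[of "\<lambda>_. 1" n] h S_B[OF h t(1)] units[of n]
    by (simp add: quot_def B.C.Units_inv_closed)
  have neg: "S a n (\<lambda>k. - g k) x = - S a n g x" for n x
    using S_scale[of a n "- 1" g x] by simp
  have neg_quot: "\<ominus>\<^bsub>?C\<^esub> (?i (S a n g x) \<otimes>\<^bsub>?C\<^esub> inv\<^bsub>?C\<^esub> ?i (S a n (\<lambda>_. 1) x)) =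
      ?i (S a n (\<lambda>k. - g k) x) \<otimes>\<^bsub>?C\<^esub> inv\<^bsub>?C\<^esub> ?i (S a n (\<lambda>_. 1) x)"
    if "x \<in> B" "?i (S a n (\<lambda>_. 1) x) \<in> Units ?C" for n x
    using that S_B[OF fg(2) that(1)] by (simp add: neg B.to_completion_uminus B.C.l_minus)
  \<comment> \<open>The form is used at (t, 1/t) and at (1/t, t). The second use yields the
    convergence of \<open>quot g\<close>, which does not follow from that of its image because
    \<omega> is not known to be injective.\<close>
  have near: "\<exists>N. \<forall>n\<ge>N. \<forall>n'\<ge>N. quot f n m = (\<ominus>\<^bsub>?C\<^esub> \<omega> (quot g n')) m \<and> \<omega> (quot f n) m = (\<ominus>\<^bsub>?C\<^esub> quot g n') m" for m
  proof -
    obtain N where N: "\<And>n n' x y. n \<ge> N \<Longrightarrow> n' \<ge> N \<Longrightarrow> x \<in> B \<Longrightarrow> y \<in> B \<Longrightarrow> x * y = 1 \<Longrightarrow>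
      B.cg m (S a n f x * S a n' (\<lambda>_. 1) y) (S a n (\<lambda>_. 1) x * S a n' (\<lambda>k. - g k) y)"
      using contracts[OF a(1) refl one, of m] unfolding contracts_def by blast
    have "quot f n m = (\<ominus>\<^bsub>?C\<^esub> \<omega> (quot g n')) m"
      if "n \<ge> N" "n' \<ge> N" for n n'
      unfolding \<omega>quot[OF fg(2)] neg_quot[OF t(2) units'] unfolding quot_def
      using that t fg units units' by (intro B.near_quotients N S_B) auto
    moreover have "\<omega> (quot f n) m = (\<ominus>\<^bsub>?C\<^esub> quot g n') m"
      if "n \<ge> N" "n' \<ge> N" for n n'
      unfolding \<omega>quot[OF fg(1)] unfolding quot_def neg_quot[OF t(1) units]
      using that t fg units units' by (intro B.near_quotients N S_B) (auto simp: mult.commute)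
    ultimately show ?thesis
      by blast
  qed
  have fC: "quot f n \<in> carrier ?C" for n
    by (rule quot_closed[OF fg(1)])
  \<comment> \<open>Two values of n are compared through one fixed n', which the independence of the
    two indices permits.\<close>
  have cauchy: "\<exists>N. \<forall>n\<ge>N. quot f n m = quot f N m" for m
  proof -
    obtain N where N: "\<And>n n'. n \<ge> N \<Longrightarrow> n' \<ge> N \<Longrightarrow> quot f n m = (\<ominus>\<^bsub>?C\<^esub> \<omega> (quot g n')) m"
      using near[of m] by blast
    have "quot f n m = quot f N m" if "n \<ge> N" for n
      using N[OF that order_refl] N[OF order_refl order_refl] by (rule trans[OF _ sym])
    then show ?thesis
      by blast
  qed
  obtain Y where Y: "Y \<in> carrier ?C" "\<And>m. eventually (\<lambda>n. quot f n m = Y m) sequentially"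
    using B.completion_Cauchy[of "quot f", OF fC cauchy] by (elim bexE) simp
  have gC: "quot g n \<in> carrier ?C" "\<omega> (quot g n) \<in> carrier ?C" for n
    using quot_closed[OF fg(2)] ring_hom_closed[OF hom] by auto
  have cauchy: "\<exists>N. \<forall>n\<ge>N. quot g n m = quot g N m" for m
  proof -
    obtain N where N: "\<And>n n'. n \<ge> N \<Longrightarrow> n' \<ge> N \<Longrightarrow> \<omega> (quot f n) m = (\<ominus>\<^bsub>?C\<^esub> quot g n') m"
      using near[of m] by blast
    have "quot g n m = quot g N m" if "n \<ge> N" for n
    proof -
      have "(\<ominus>\<^bsub>?C\<^esub> quot g n) m = (\<ominus>\<^bsub>?C\<^esub> quot g N) m"
        using N[of N n] N[of N N] that by simp
      then have "(\<ominus>\<^bsub>?C\<^esub> (\<ominus>\<^bsub>?C\<^esub> quot g n)) m = (\<ominus>\<^bsub>?C\<^esub> (\<ominus>\<^bsub>?C\<^esub> quot g N)) m"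
        by (rule B.near_uminus[OF B.C.a_inv_closed[OF gC(1)] B.C.a_inv_closed[OF gC(1)]])
      then show ?thesis
        using gC by simp
    qed
    then show ?thesis
      by blast
  qed
  obtain Z where Z: "Z \<in> carrier ?C" "\<And>m. eventually (\<lambda>n. quot g n m = Z m) sequentially"
    using B.completion_Cauchy[of "quot g", OF gC(1) cauchy] by (elim bexE) simp
  have YZ: "Y m = (\<ominus>\<^bsub>?C\<^esub> \<omega> Z) m" for m
  proof -
    obtain k where "\<forall>y\<in>carrier ?C. y k = Z k \<longrightarrow> \<omega> y m = \<omega> Z m"
      using cont[OF Z(1), of m] ..
    then have k: "y \<in> carrier ?C \<Longrightarrow> y k = Z k \<Longrightarrow> \<omega> y m = \<omega> Z m" for y
      by blast
    obtain N where N: "\<And>n n'. n \<ge> N \<Longrightarrow> n' \<ge> N \<Longrightarrow> quot f n m = (\<ominus>\<^bsub>?C\<^esub> \<omega> (quot g n')) m"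
      using near[of m] by blast
    have "eventually (\<lambda>n. Y m = (\<ominus>\<^bsub>?C\<^esub> \<omega> Z) m) sequentially"
      using Y(2)[of m] Z(2)[of k] eventually_ge_at_top[of N]
    proof eventually_elim
      case (elim n)
      have "Y m = (\<ominus>\<^bsub>?C\<^esub> \<omega> (quot g n)) m"
        using trans[OF sym[OF elim(1)] N[OF elim(3) elim(3)]] .
      also have "\<dots> = (\<ominus>\<^bsub>?C\<^esub> \<omega> Z) m"
        by (rule B.near_uminus[OF gC(2) ring_hom_closed[OF hom Z(1)] k[OF gC(1) elim(2)]])
      finally show ?case .
    qed
    then show ?thesis
      by simp
  qed
  have lims: "adic_lim ?C (?i (of_nat p)) sequentially (quot f) = Y"
    "adic_lim ?C (?i (of_nat p)) sequentially (quot g) = Z"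
    by (intro B.adic_lim_completion_eqI fC gC(1) Y Z trivial_limit_sequentially)+
  show ?thesis
    unfolding f_def[symmetric] g_def[symmetric] lims by (rule ext) (rule YZ)
qed

end

text \<open>Injectivity of the map to the completion gives separatedness, and surjectivity gives
  completeness.\<close>

lemma padic_ring_if_witt_ring_Fpbar:
  fixes W :: "'K::field_char_0 set"
  assumes W: "witt_ring_Fpbar p W" and p: "Factorial_Ring.prime p"
  shows "padic_ring W p"
proof -
  interpret R: cring "ring_on W"
    using W by (simp add: witt_ring_Fpbar_def)
  have of_nat: "of_nat k \<in> W" for k
    using R.one_closed R.zero_closed R.a_closed by (induction k) auto
  have bij: "bij_betw (to_adic_completion (ring_on W) (of_nat p)) W
      (carrier (adic_completion (ring_on W) (of_nat p)))"
    using W by (simp add: witt_ring_Fpbar_def)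
  interpret adic_subring W "of_nat p"
  proof
    fix u
    assume "u \<in> W"
    then have "\<ominus>\<^bsub>ring_on W\<^esub> u \<in> W" "\<ominus>\<^bsub>ring_on W\<^esub> u + u = 0"
      using R.a_inv_closed[of u] R.l_neg[of u] by simp_all
    then show "- u \<in> W"
      by (metis add_eq_0_iff2)
  qed (use R.one_closed R.zero_closed R.a_closed R.m_closed of_nat prime_gt_0_nat[OF p] in auto)
  show ?thesis
  proof
    fix z
    assume z: "z \<in> W" "\<And>n. cg n z 0"
    then have "to_completion z = to_completion 0"
      by (simp add: to_completion_eq cls_eq_iff fun_eq_iff)
    then show "z = 0"
      using inj_onD[OF bij_betw_imp_inj_on[OF bij] _ z(1) zero_closed] by blast
  next
    fix y :: "nat \<Rightarrow> 'K"
    assume "\<And>n. y n \<in> W" "\<And>n. cg n (y (Suc n)) (y n)"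
    then have "(\<lambda>n. cls n (y n)) \<in> carrier completion"
      by (rule completion_memI)
    then have "(\<lambda>n. cls n (y n)) \<in> to_completion ` W"
      using bij by (simp add: bij_betw_def)
    then obtain L where "L \<in> W" "(\<lambda>n. cls n (y n)) = (\<lambda>n. cls n L)"
      by (auto simp: to_completion_eq)
    then show "\<exists>L\<in>W. \<forall>n. cg n (y n) L"
      by (metis cls_eq_iff)
  qed (rule p)
qed

section \<open>Polynomials over W and the ring W[t, 1/t, 1/h]\<close>

lemma rat_t_neq_0 [simp]: "rat_t \<noteq> 0"
  by (simp add: rat_t_def)

context padic_ring
begin

definition int_polys :: "'K poly set" where
  "int_polys = {f. \<forall>n. coeff f n \<in> W}"

lemma int_polys_add: "f \<in> int_polys \<Longrightarrow> g \<in> int_polys \<Longrightarrow> f + g \<in> int_polys"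
  by (simp add: int_polys_def)

lemma int_polys_mult: "f \<in> int_polys \<Longrightarrow> g \<in> int_polys \<Longrightarrow> f * g \<in> int_polys"
  by (auto simp: int_polys_def coeff_mult intro!: sum_closed)

lemma int_polys_const: "w \<in> W \<Longrightarrow> [:w:] \<in> int_polys"
  by (auto simp: int_polys_def coeff_pCons split: nat.split)

lemma int_polys_t: "[:0, 1:] \<in> int_polys"
  by (auto simp: int_polys_def coeff_pCons split: nat.split)

lemma int_polys_power: "f \<in> int_polys \<Longrightarrow> f ^ n \<in> int_polys"
  using int_polys_const[of 1] by (induction n) (auto intro: int_polys_mult simp: one_pCons)

lemma laurent_loc_eq: "laurent_loc W h = {to_fract f / (rat_t ^ i * h ^ j) | f i j. f \<in> int_polys}"
  by (simp add: laurent_loc_def int_polys_def)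

lemma laurent_locI: "f \<in> int_polys \<Longrightarrow> to_fract f / (rat_t ^ i * h ^ j) \<in> laurent_loc W h"
  unfolding laurent_loc_eq by blast

lemma hyp_sums_laurent_loc:
  assumes g: "g \<in> int_polys" and h: "h = to_fract g" "h \<noteq> 0" and "s \<ge> 1"
  shows "hyp_sums W p (laurent_loc W h) s"
proof -
  have poly: "to_fract f \<in> laurent_loc W h" if "f \<in> int_polys" for f
    using laurent_locI[OF that, of 0 h 0] by simp
  have const: "rat_const w \<in> laurent_loc W h" if "w \<in> W" for w
    unfolding rat_const_def by (rule poly[OF int_polys_const[OF that]])
  have of_nat: "of_nat k \<in> laurent_loc W h" for k
    using const[of "of_nat k"] by simp
  have t: "rat_t = to_fract [:0, 1:]"
    by (simp add: rat_t_def)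
  have pow: "to_fract f ^ k = to_fract (f ^ k)" for f :: "'K poly" and k
    by (induction k) simp_all
  show ?thesis
  proof
    fix u v
    assume "u \<in> laurent_loc W h" "v \<in> laurent_loc W h"
    then obtain f i j f' i' j' where uv: "f \<in> int_polys" "f' \<in> int_polys"
      "u = to_fract f / (rat_t ^ i * h ^ j)" "v = to_fract f' / (rat_t ^ i' * h ^ j')"
      unfolding laurent_loc_eq by blast
    have "u * v = to_fract (f * f') / (rat_t ^ (i + i') * h ^ (j + j'))"
      by (simp add: uv power_add)
    then show "u * v \<in> laurent_loc W h"
      using laurent_locI[OF int_polys_mult[OF uv(1,2)]] by simp
    have "u + v = (to_fract f * (rat_t ^ i' * h ^ j') + to_fract f' * (rat_t ^ i * h ^ j))
        / (rat_t ^ (i + i') * h ^ (j + j'))"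
      using h(2) by (simp add: uv power_add add_frac_eq mult_ac)
    also have "to_fract f * (rat_t ^ i' * h ^ j') + to_fract f' * (rat_t ^ i * h ^ j) =
      to_fract (f * ([:0, 1:] ^ i' * g ^ j') + f' * ([:0, 1:] ^ i * g ^ j))"
      by (simp only: t h(1) pow to_fract_add to_fract_mult)
    finally have "u + v = to_fract (f * ([:0, 1:] ^ i' * g ^ j') + f' * ([:0, 1:] ^ i * g ^ j))
      / (rat_t ^ (i + i') * h ^ (j + j'))" .
    moreover have "f * ([:0, 1:] ^ i' * g ^ j') + f' * ([:0, 1:] ^ i * g ^ j) \<in> int_polys"
      by (intro int_polys_add int_polys_mult int_polys_power int_polys_t uv g)
    ultimately show "u + v \<in> laurent_loc W h"
      using laurent_locI by (simp only:)
  next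
    fix u
    assume "u \<in> laurent_loc W h"
    then obtain f i j where u: "f \<in> int_polys" "u = to_fract f / (rat_t ^ i * h ^ j)"
      unfolding laurent_loc_eq by blast
    then have "- u = to_fract (- f) / (rat_t ^ i * h ^ j)"
      by simp
    moreover have "- f \<in> int_polys"
      using u(1) by (simp add: int_polys_def)
    ultimately show "- u \<in> laurent_loc W h"
      using laurent_locI by (simp only:)
  next
    show "(of_nat p :: 'K poly fract) \<noteq> 0"
      using rat_const_of_nat[of p, where 'a = 'K] unfolding rat_const_def
      by (metis of_nat_eq_0_iff p_neq_0 pCons_eq_0_iff to_fract_eq_0_iff)
  qed (use const of_nat of_nat[of 0] of_nat[of 1] \<open>s \<ge> 1\<close> in auto)
qed

end

theorem theorem4p7:
  fixes p s r :: nat and W :: "'K::field_char_0 set" and a c :: 'K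
    and \<omega> :: "(nat \<Rightarrow> 'K poly fract set) \<Rightarrow> (nat \<Rightarrow> 'K poly fract set)"
  assumes p: "Factorial_Ring.prime p" and s: "s \<ge> 1"
    and W: "witt_ring_Fpbar p W"
    and dwork: "\<And>b. b \<in> Zp W p \<Longrightarrow>
      \<exists>\<epsilon>\<in>{1, -1 :: 'K poly fract}. (odd p \<longrightarrow> \<epsilon> = 1) \<and>
        dwork_fun W p s b rat_t =
          to_gauss W p (\<epsilon> * ((-1) ^ s * rat_t) ^ neg_residue W p b)
            \<otimes>\<^bsub>gauss_completion W p\<^esub> dwork_fun W p s b (inverse rat_t)"
    and a: "a \<in> Zp W p" "\<And>n::nat. a \<noteq> - of_nat n"
    and r: "r > 0" "(dwork_prime W p ^^ r) a = a"
    and c: "c \<in> {1 + of_nat p * u | u. u \<in> W}"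
    and \<omega>: "inversion_endo W p (hyp_h W p s a r) \<omega>"
  shows "hyp_log W p s (hyp_h W p s a r) c a =
    \<ominus>\<^bsub>W_hat W p (hyp_h W p s a r)\<^esub> \<omega> (hyp_log_hat W p s (hyp_h W p s a r) (inverse c) a)"
proof -
  interpret padic_ring W p
    by (rule padic_ring_if_witt_ring_Fpbar[OF W p])
  define h where "h = hyp_h W p s a r"
  \<comment> \<open>A polynomial whose value at b is F_b(t)_(<p). It makes h the image of a
    polynomial over \<open>W\<close>; the constant coefficient 1 of each factor shows that h is
    nonzero.\<close>
  define g where "g = (\<lambda>b. \<Sum>k<p. [:hc b k ^ s:] * [:0, 1:] ^ k)"
  define b where "b = (\<lambda>i. (dwork_prime W p ^^ i) a)"
  have b: "b i \<in> Zp W p" for i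
    unfolding b_def using a(1) by (induction i) (auto intro: prm_Zp)
  have g_int: "g (b i) \<in> int_polys" for i
  proof -
    have "(\<Sum>k<N. [:hc (b i) k ^ s:] * [:0, 1:] ^ k) \<in> int_polys" for N
      using hc_closed[OF b] int_polys_const[of 0]
      by (induction N) (auto intro!: int_polys_add int_polys_mult int_polys_const int_polys_power int_polys_t simp del: mult_pCons_left)
    then show ?thesis
      unfolding g_def .
  qed
  have pow: "to_fract f ^ k = to_fract (f ^ k)" for f :: "'K poly" and k
    by (induction k) simp_all
  have F_g: "trunc_at (hyp_fps s y) p rat_t = to_fract (g y)" for y
    unfolding trunc_at_def g_def rat_const_def rat_t_def hyp_fps_nth
    by (simp only: to_fract_sum to_fract_mult pow)
  have g_nz: "g y \<noteq> 0" for y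
  proof -
    have "coeff ([:hc y k ^ s:] * [:0, 1:] ^ k) 0 = (if k = 0 then 1 else 0)" for k
      by (cases k) (simp_all add: coeff_mult)
    then have "coeff (g y) 0 = 1"
      unfolding g_def coeff_sum by simp
    then show ?thesis
      by auto
  qed
  have h_g: "h = to_fract (\<Prod>i<r. g (b i))"
  proof -
    have "(\<Prod>i<N. to_fract (g (b i))) = to_fract (\<Prod>i<N. g (b i))" for N
      by (induction N) simp_all
    then show ?thesis
      by (simp add: h_def hyp_h_def b_def F_g)
  qed
  have prod_int: "(\<Prod>i<N. g (b i)) \<in> int_polys" for N
    using int_polys_const[of 1] g_int by (induction N) (auto intro: int_polys_mult simp: one_pCons)
  have h_nz: "h \<noteq> 0"
    unfolding h_g using g_nz by simp
  interpret hyp_sums W p "laurent_loc W h" s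
    using hyp_sums_laurent_loc[OF prod_int h_g h_nz s] .
  have t: "rat_t \<in> laurent_loc W h" "inverse rat_t \<in> laurent_loc W h" "inverse h \<in> laurent_loc W h"
    using laurent_locI[OF int_polys_t, of 0 h 0] laurent_locI[OF int_polys_const[OF one_closed], of 1 h 0]
      laurent_locI[OF int_polys_const[OF one_closed], of 0 h 1]
    by (simp_all add: rat_t_def inverse_eq_divide flip: one_pCons)
  have F1_eq: "F1 y rat_t = trunc_at (hyp_fps s y) p rat_t" for y
    by (simp add: F1_def S_def trunc_at_def hyp_fps_nth)
  have h_F1: "h = (\<Prod>i<r. F1 (b i) rat_t)"
    by (simp add: h_def hyp_h_def b_def F1_eq)
  have F1_units: "F1 (b i) rat_t \<in> B.units" for i
  proof -
    \<comment> \<open>By periodicity, the truncation for any i already occurs among the r factors of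
      h, and a factor of h is a unit because 1/h lies in the ring.\<close>
    define j where "j = i mod r"
    have j: "j < r" "b i = b j"
      using r funpow_mod_eq[where f = "dwork_prime W p" and n = r and x = a and m = i]
      by (simp_all add: j_def b_def)
    have cl: "F1 (b k) rat_t \<in> laurent_loc W h" for k
      using F1_closed[OF b t(1)] .
    have "F1 (b j) rat_t * ((\<Prod>k\<in>{..<r} - {j}. F1 (b k) rat_t) * inverse h) = h * inverse h"
      using prod.remove[of "{..<r}" j "\<lambda>k. F1 (b k) rat_t"] j(1) by (simp add: h_F1 mult.assoc)
    also have "\<dots> = 1"
      using h_nz by simp
    finally show ?thesis
      unfolding j(2) using cl t(3) B.units_one
      by (intro B.units_factor[of "F1 (b j) rat_t" "(\<Prod>k\<in>{..<r} - {j}. F1 (b k) rat_t) * inverse h"]) (auto intro!: B.mult_closed B.prod_closed)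
  qed
  have c1: "cg 1 c 1"
    using c by (auto simp: cg_def)
  have units: "B.to_completion (S a n (\<lambda>_. 1) rat_t) \<in> Units B.completion" for n
    using F1_units by (intro S_one_Unit a t) (simp add: b_def)
  have trunc: "trunc_at (hyp_fps s a) (p ^ n) rat_t = S a n (\<lambda>_. 1) rat_t"
    "trunc_at (hyp_G W p s c a) (p ^ n) rat_t = S a n (beta c a) rat_t"
    "trunc_at (hyp_G_hat W p s (inverse c) a) (p ^ n) rat_t = S a n (beta_hat (inverse c) a) rat_t" for n
    by (rule S_eq_trunc_at; simp add: hyp_fps_nth hyp_G_nth[OF a(1)] hyp_G_hat_nth[OF a(1)])+
  note endo = \<omega>[folded h_def, unfolded inversion_endo_def Let_def W_hat_def to_W_hat_def]
  note hom = conjunct1[OF endo] and const = bspec[OF conjunct1[OF conjunct2[OF endo]]]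
    and cont = conjunct1[OF conjunct2[OF conjunct2[OF endo]]]
    and \<omega>t = conjunct2[OF conjunct2[OF conjunct2[OF endo]]]
  \<comment> \<open>Continuity in terms of ideals becomes a statement about cosets at finite
    stages.\<close>
  have cont': "\<exists>m. \<forall>y\<in>carrier B.completion. y m = z m \<longrightarrow> \<omega> y n = \<omega> z n"
    if z: "z \<in> carrier B.completion" for z n
  proof -
    obtain m :: nat where m: "\<forall>y\<in>carrier B.completion.
      y \<ominus>\<^bsub>B.completion\<^esub> z \<in> PIdl\<^bsub>B.completion\<^esub> (B.to_completion (of_nat p) [^]\<^bsub>B.completion\<^esub> m) \<longrightarrow>
      \<omega> y \<ominus>\<^bsub>B.completion\<^esub> \<omega> z \<in> PIdl\<^bsub>B.completion\<^esub> (B.to_completion (of_nat p) [^]\<^bsub>B.completion\<^esub> n)"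
      using spec[OF bspec[OF cont z], of n] ..
    have "\<omega> y n = \<omega> z n" if y: "y \<in> carrier B.completion" "y m = z m" for y
    proof (rule iffD1[OF B.completion_near_iff])
      show "\<omega> y \<in> carrier B.completion" "\<omega> z \<in> carrier B.completion"
        by (rule ring_hom_closed[OF hom y(1)], rule ring_hom_closed[OF hom z])
      show "\<omega> y \<ominus>\<^bsub>B.completion\<^esub> \<omega> z
          \<in> PIdl\<^bsub>B.completion\<^esub> (B.to_completion (of_nat p) [^]\<^bsub>B.completion\<^esub> n)"
        using mp[OF bspec[OF m y(1)] iffD2[OF B.completion_near_iff[OF y(1) z] y(2)]] .
    qed
    then show ?thesis
      by blast
  qed
  have "rat_t * inverse rat_t = (1 :: 'K poly fract)"
    by simp
  from quotient_limits[OF a c1 t(1,2) this units hom const cont' \<omega>t] show ?thesis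
    unfolding h_def[symmetric] hyp_log_def hyp_log_hat_def quotient_lim_def W_hat_def to_W_hat_def trunc .
qed

end
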